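(* Let $\alpha,\beta,\gamma,\delta,k$ be complex constants with $\alpha\neq0$ and $k\neq0$. If the equation $$(1-D_x^2)u_t=\alpha u^ku_x+\beta u^ku_{xxx}+\gamma u^{k-1}u_xu_{xx}+\delta u^{k-2}u_x^3$$ is integrable (in the sense of formal series defined in the context), then $k=1$ or $k=2$.
   Context: $D_x$ denotes the total $x$-derivative. Assign weight $0$ to $u$ and weight $j$ to the $j$-th $x$-derivative of $u$. Consider formal series in a parameter $\epsilon$ of the form $$u_t=\lambda(u)u_x+\epsilon\big(a_1(u)u_{xx}+a_2(u)u_x^2\big)+\epsilon^2\big(b_1(u)u_{xxx}+b_2(u)u_xu_{xx}+b_3(u)u_x^3\big)+\cdots\qquad( * )$$ with $\lambda'(u)\neq0$, where the coefficient of $\epsilon^n$ is a differential polynomial in the $x$-derivatives of $u$, homogeneous of weight $n+1$, with coefficients that are functions of $u$. The series may or may not truncate. Definition (integrability, following Dubrovin and Zhang). The series $( * )$ is integrable if, for an arbitrary choice of the function $\mu(u)$, there exists another formal series of the same type $$u_\tau=\mu(u)u_x+\epsilon\big(A_1(u)u_{xx}+A_2(u)u_x^2\big)+\epsilon^2\big(B_1(u)u_{xxx}+B_2(u)u_xu_{xx}+B_3(u)u_x^3\big)+\cdots$$ that commutes with $( * )$, i.e. $(u_t)_\tau=(u_\tau)_t$ holds identically as formal series in $\epsilon$. The equation in the claim is regarded as a formal series of this type by rescaling $x$ and $t$ to introduce $\epsilon$ (which counts the weight) and inverting $1-\epsilon^2D_x^2$ as a geometric series: $$u_t=(1-\epsilon^2D_x^2)^{-1}\Big(\alpha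 u^ku_x+\epsilon^2\big(\beta u^ku_{xxx}+\gamma u^{k-1}u_xu_{xx}+\delta u^{k-2}u_x^3\big)\Big)=\alpha u^ku_x+\epsilon^2F_2[u]+\epsilon^4F_4[u]+\cdots,$$ where $$F_2[u]=(\alpha+\beta)u^ku_{xxx}+(3k\alpha+\gamma)u^{k-1}u_xu_{xx}+(\delta+k(k-1)\alpha)u^{k-2}u_x^3 .$$ The equation is called integrable if this formal series is integrable in the sense of the definition above.
   Formalization: The case β=-α, γ=-3kα, δ=-k(k-1)α (all corrections vanish, F_2=0) is excluded: there the series is u_t=αu^k u_x, which commutes with u_τ=μ(u)u_x for every μ and so is integrable for every k≠0, e.g. k=3. *)

theory Defs
  imports "HOL-Complex_Analysis.Complex_Analysis" "HOL-Library.Multiset"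
begin

text \<open>
  A jet \<open>u\<close> lists independent jet coordinates: \<open>u 0\<close> stands for the field, \<open>u j\<close> for its
  \<open>j\<close>-th \<open>x\<close>-derivative. A differential polynomial is represented by its function on jets;
  only its values at jets with \<open>u 0 \<in> U\<close> matter, where \<open>U\<close> is the domain of the coefficient
  functions.
\<close>

type_synonym jet = "nat \<Rightarrow> complex"

definition jet_pd :: "nat \<Rightarrow> (jet \<Rightarrow> complex) \<Rightarrow> jet \<Rightarrow> complex" where
  "jet_pd j P u = deriv (\<lambda>z. P (u(j := z))) (u j)"

text \<open>
  The infinite sums in the next two definitions have finitely many nonzero terms when \<open>P\<close> is a
  differential polynomial. \<open>evol_deriv Q P\<close> is the derivative of \<open>P\<close> along \<open>u\<^sub>\<tau> = Q\<close>.
\<close>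

definition total_deriv :: "(jet \<Rightarrow> complex) \<Rightarrow> jet \<Rightarrow> complex" where
  "total_deriv P u = (\<Sum>j. u (Suc j) * jet_pd j P u)"

definition evol_deriv :: "(jet \<Rightarrow> complex) \<Rightarrow> (jet \<Rightarrow> complex) \<Rightarrow> jet \<Rightarrow> complex" where
  "evol_deriv Q P u = (\<Sum>j. (total_deriv ^^ j) Q u * jet_pd j P u)"

text \<open>
  Monomials \<open>u\<^sub>i u\<^sub>j \<cdots>\<close> of weight \<open>n\<close> in the derivatives of order at least one correspond to the
  partitions of \<open>n\<close>.
\<close>

definition weight_monomials :: "nat \<Rightarrow> nat multiset set" where
  "weight_monomials n = {M. 0 \<notin># M \<and> \<Sum>\<^sub># M = n}"

definition homogeneous_diff_poly :: "complex set \<Rightarrow> nat \<Rightarrow> (jet \<Rightarrow> complex) \<Rightarrow> bool" where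
  "homogeneous_diff_poly U n P \<longleftrightarrow>
     (\<exists>c. (\<forall>M\<in>weight_monomials n. c M holomorphic_on U) \<and>
          (\<forall>u. u 0 \<in> U \<longrightarrow>
             P u = (\<Sum>M\<in>weight_monomials n. c M (u 0) * (\<Prod>j\<in>#M. u j))))"

lemma finite_weight_monomials: "finite (weight_monomials n)"
proof -
  have "weight_monomials n \<subseteq> mset ` {xs. set xs \<subseteq> {0..n} \<and> length xs \<le> n}"
  proof
    fix M assume "M \<in> weight_monomials n"
    then have M: "0 \<notin># M" "\<Sum>\<^sub># M = n" by (auto simp: weight_monomials_def)
    obtain xs where xs: "mset xs = M" using ex_mset by blast
    have "x \<le> n" if "x \<in># M" for x using M that sum_mset.remove[OF that] by simp
    moreover have "size M \<le> \<Sum>\<^sub># M" using M(1)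
      by (induction M) (auto simp: Suc_le_eq)
    ultimately show "M \<in> mset ` {xs. set xs \<subseteq> {0..n} \<and> length xs \<le> n}"
      using xs M by (intro image_eqI[of _ _ xs]) auto
  qed
  then show ?thesis
    by (rule finite_subset) (intro finite_imageI finite_lists_length_le, simp)
qed

text \<open>
  A formal series in \<open>\<epsilon>\<close> is the sequence of its coefficients; \<open>series_deriv G F n\<close> is the
  coefficient of \<open>\<epsilon>\<^sup>n\<close> in the derivative of the series \<open>F\<close> along \<open>u\<^sub>\<tau> = G\<close>.
\<close>

definition formal_series :: "complex set \<Rightarrow> (nat \<Rightarrow> jet \<Rightarrow> complex) \<Rightarrow> bool" where
  "formal_series U F \<longleftrightarrow> (\<forall>n. homogeneous_diff_poly U (n + 1) (F n))"

definition leading_coeff_is :: "complex set \<Rightarrow> (nat \<Rightarrow> jet \<Rightarrow> complex) \<Rightarrow> (complex \<Rightarrow> complex) \<Rightarrow> bool"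
  where "leading_coeff_is U F lam \<longleftrightarrow> (\<forall>u. u 0 \<in> U \<longrightarrow> F 0 u = lam (u 0) * u 1)"

definition series_deriv ::
  "(nat \<Rightarrow> jet \<Rightarrow> complex) \<Rightarrow> (nat \<Rightarrow> jet \<Rightarrow> complex) \<Rightarrow> nat \<Rightarrow> jet \<Rightarrow> complex" where
  "series_deriv G F n u = (\<Sum>i\<le>n. evol_deriv (G (n - i)) (F i) u)"

definition commuting_series ::
  "complex set \<Rightarrow> (nat \<Rightarrow> jet \<Rightarrow> complex) \<Rightarrow> (nat \<Rightarrow> jet \<Rightarrow> complex) \<Rightarrow> bool" where
  "commuting_series U F G \<longleftrightarrow>
     (\<forall>n u. u 0 \<in> U \<longrightarrow> series_deriv G F n u = series_deriv F G n u)"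

definition integrable_series :: "complex set \<Rightarrow> (nat \<Rightarrow> jet \<Rightarrow> complex) \<Rightarrow> bool" where
  "integrable_series U F \<longleftrightarrow>
     formal_series U F \<and>
     (\<exists>lam. lam holomorphic_on U \<and> leading_coeff_is U F lam \<and> (\<forall>z\<in>U. deriv lam z \<noteq> 0)) \<and>
     (\<forall>\<mu>. \<mu> holomorphic_on U \<longrightarrow>
        (\<exists>G. formal_series U G \<and> leading_coeff_is U G \<mu> \<and> commuting_series U F G))"

text \<open>
  The function \<open>ell\<close> is a branch of the logarithm on \<open>U\<close>; it fixes the branches of all powers
  of \<open>u\<close> consistently. \<open>geometric_inverse R\<close> is
  \<open>(1 - \<epsilon>\<^sup>2 D\<^sup>2)\<^sup>-\<^sup>1 R = R + \<epsilon>\<^sup>2 D\<^sup>2 R + \<epsilon>\<^sup>4 D\<^sup>4 R + \<cdots>\<close>.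
\<close>

definition branch_power :: "(complex \<Rightarrow> complex) \<Rightarrow> complex \<Rightarrow> complex \<Rightarrow> complex" where
  "branch_power ell a z = exp (a * ell z)"

definition geometric_inverse :: "(nat \<Rightarrow> jet \<Rightarrow> complex) \<Rightarrow> nat \<Rightarrow> jet \<Rightarrow> complex" where
  "geometric_inverse R n u = (\<Sum>m\<le>n div 2. (total_deriv ^^ (2 * m)) (R (n - 2 * m)) u)"

definition eq_rhs :: "(complex \<Rightarrow> complex) \<Rightarrow> complex \<Rightarrow> complex \<Rightarrow> complex \<Rightarrow> complex \<Rightarrow> complex \<Rightarrow>
    nat \<Rightarrow> jet \<Rightarrow> complex" where
  "eq_rhs ell \<alpha> \<beta> \<gamma> \<delta> k n u =
     (if n = 0 then \<alpha> * branch_power ell k (u 0) * u 1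
      else if n = 2 then
        \<beta> * branch_power ell k (u 0) * u 3
        + \<gamma> * branch_power ell (k - 1) (u 0) * u 1 * u 2
        + \<delta> * branch_power ell (k - 2) (u 0) * u 1 ^ 3
      else 0)"

definition eq_series :: "(complex \<Rightarrow> complex) \<Rightarrow> complex \<Rightarrow> complex \<Rightarrow> complex \<Rightarrow> complex \<Rightarrow> complex \<Rightarrow>
    nat \<Rightarrow> jet \<Rightarrow> complex" where
  "eq_series ell \<alpha> \<beta> \<gamma> \<delta> k = geometric_inverse (eq_rhs ell \<alpha> \<beta> \<gamma> \<delta> k)"

text \<open>
  On jets with \<open>u 0 \<in> U\<close> the \<open>\<epsilon>\<^sup>2\<close> coefficient of \<open>eq_series\<close> is
  \<open>(\<alpha> + \<beta>) u\<^sup>k u\<^sub>3 + (3 k \<alpha> + \<gamma>) u\<^bsup>k-1\<^esup> u\<^sub>1 u\<^sub>2 + (\<delta> + k (k - 1) \<alpha>) u\<^bsup>k-2\<^esup> u\<^sub>1\<^sup>3\<close>.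
  If all three constants vanish, the equation is \<open>(1 - D\<^sup>2) (u\<^sub>t - \<alpha> u\<^sup>k u\<^sub>1) = 0\<close>, the series
  reduces to \<open>\<alpha> u\<^sup>k u\<^sub>1\<close>, and it commutes with every \<open>\<mu>(u) u\<^sub>1\<close>: it is then integrable for
  every \<open>k \<noteq> 0\<close>. A statement restricting \<open>k\<close> has to exclude this case.
\<close>

end

theory Submission
  imports Defs
begin

text \<open>
  It suffices to use a single commuting series, the one with \<open>\<mu>(u) = u\<^bsup>2k\<^esup>\<close>. Taylor expansion of the
  commutator at the jet \<open>(z, 0, 0, \<dots>)\<close> turns commutativity into one equation for every multi-index
  of weight \<open>n + 2\<close>, bilinear in the Taylor coefficients of the two series. The
  equation at \<open>1 # M\<close> determines the coefficient of the commuting series at \<open>M\<close>, where it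
  has a nonzero multiple of \<open>\<lambda>'(u)\<close> as its factor; the equations at multi-indices without
  entry \<open>1\<close> are obstructions. With \<open>\<alpha> + \<beta> = \<alpha> k B\<close>, \<open>3k\<alpha> + \<gamma> = \<alpha> k (S - 3B)\<close> and
  \<open>\<delta> + k(k - 1)\<alpha> = \<alpha> k D\<close>, six obstructions at \<open>\<epsilon>\<^sup>8\<close> and \<open>\<epsilon>\<^sup>1\<^sup>0\<close> generate an ideal which, for
  \<open>B \<noteq> 0\<close>, contains \<open>(k - 1)(k - 2)\<close>. For \<open>B = 0\<close> the obstructions up to \<open>\<epsilon>\<^sup>1\<^sup>2\<close> give \<open>S = 0\<close> and then
  \<open>D = 0\<close>, which is the excluded degenerate case.
\<close>

section \<open>Differential polynomials on jets\<close>

text \<open>For \<mu>(u) = u^k the series of the equation commutes with itself, which yields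
  nothing; u^(2k) is another choice that keeps all data homogeneous under scaling of u. The
  commutator conditions are differential equations for unknown functions of u, but in the equation
  at \<open>1 # M\<close> the derivative of the unknown coefficient cancels, so it is solved
  algebraically. That each coefficient is a constant times a power of u is therefore a result of the
  recursion and no ansatz. The obstacle is size: up to \<epsilon>^12 the commutator is far too large
  to expand by rewriting with polynomials in jet variables. Its coefficients are therefore computed
  by an executable function on integer-weighted lists of multi-indices, proved correct once for all
  orders, and only the resulting polynomial identities are left to algebra. The case split has a
  reason as well: each of the six general obstructions carries a factor B and is void at B = 0.
  There the next obstructions carry a factor S and are void at S = 0, where one linear in D
  remains.\<close>

inductive diff_poly :: "complex set \<Rightarrow> nat \<Rightarrow> (jet \<Rightarrow> complex) \<Rightarrow> bool" for U where
  coeff: "c holomorphic_on U \<Longrightarrow> diff_poly U 0 (\<lambda>u. c (u 0))"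
| var: "j \<ge> 1 \<Longrightarrow> diff_poly U j (\<lambda>u. u j)"
| add: "diff_poly U n P \<Longrightarrow> diff_poly U n Q \<Longrightarrow> diff_poly U n (\<lambda>u. P u + Q u)"
| mult: "diff_poly U n P \<Longrightarrow> diff_poly U m Q \<Longrightarrow> diff_poly U (n + m) (\<lambda>u. P u * Q u)"
| cong: "diff_poly U n P \<Longrightarrow> (\<And>u. u 0 \<in> U \<Longrightarrow> Q u = P u) \<Longrightarrow> diff_poly U n Q"

text \<open>Zero has every weight. This absorbs the terms that vanish because a derivative is taken
  with respect to a coordinate of order above the weight.\<close>

lemma diff_poly_zero: "diff_poly U n (\<lambda>u. 0)"
proof -
  have c: "diff_poly U 0 (\<lambda>u. 0)" using coeff[of "\<lambda>_. 0" U] by simp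
  show ?thesis
  proof (cases "n = 0")
    case False
    then have "diff_poly U (0 + n) (\<lambda>u. 0 * u n)" using c by (intro mult var) auto
    then show ?thesis by simp
  qed (use c in simp)
qed

lemma diff_poly_sum: "finite X \<Longrightarrow> (\<And>x. x \<in> X \<Longrightarrow> diff_poly U n (P x)) \<Longrightarrow> diff_poly U n (\<lambda>u. \<Sum>x\<in>X. P x u)"
  by (induction X rule: finite_induct) (auto intro: diff_poly_zero add)

section \<open>Partial derivatives of differential polynomials\<close>

lemma eventually_jet_upd:
  assumes "open U" "u 0 \<in> U"
  shows "\<forall>\<^sub>F z in nhds (u j). (u(j := z)) 0 \<in> U"
proof (cases "j = 0")
  case True
  then show ?thesis using assms by (auto intro: eventually_nhds_in_open)
qed (use assms in auto)

lemma jet_pd_cong: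
  assumes "open U" "u 0 \<in> U" "\<And>u. u 0 \<in> U \<Longrightarrow> P u = Q u"
  shows "jet_pd j P u = jet_pd j Q u"
  unfolding jet_pd_def
  by (rule deriv_cong_ev[OF _ refl], rule eventually_mono[OF eventually_jet_upd[where u=u and j=j, OF assms(1,2)]])
     (use assms in auto)

text \<open>The sum and product rules for \<open>deriv\<close> hold only at points of
  differentiability, so this precedes all calculation with \<open>jet_pd\<close>. In the congruence
  case the two functions agree near the point because U is open.\<close>

lemma diff_poly_differentiable:
  assumes "open U" "diff_poly U n P" "u 0 \<in> U"
  shows "(\<lambda>z. P (u(j := z))) field_differentiable at (u j)"
  using assms(2,3)
proof (induction arbitrary: u rule: diff_poly.induct)
  case (coeff c)
  show ?case
  proof (cases "j = 0")
    case True
    with coeff assms(1) show ?thesis by (auto intro: holomorphic_on_imp_differentiable_at)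
  qed auto
next
  case (var i)
  then show ?case by (cases "i = j") auto
next
  case (cong n P Q)
  have "\<forall>\<^sub>F z in nhds (u j). Q (u(j := z)) = P (u(j := z))"
    by (rule eventually_mono[OF eventually_jet_upd[where u=u and j=j, OF assms(1) cong.prems]])
        (use cong.hyps in auto)
  moreover have "(\<lambda>z. P (u(j := z))) field_differentiable at (u j)"
    by (rule cong.IH) (rule cong.prems)
  ultimately show ?case
    unfolding field_differentiable_def
    using DERIV_cong_ev[OF refl _ refl, of "\<lambda>z. Q (u(j := z))" "\<lambda>z. P (u(j := z))" "u j"] by blast
qed (auto intro!: field_differentiable_add field_differentiable_mult)

lemma jet_pd_add:
  assumes "open U" "diff_poly U n P" "diff_poly U m Q" "u 0 \<in> U"
  shows "jet_pd j (\<lambda>u. P u + Q u) u = jet_pd j P u + jet_pd j Q u"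
  unfolding jet_pd_def using assms by (intro deriv_add) (auto intro: diff_poly_differentiable)

lemma jet_pd_mult:
  assumes "open U" "diff_poly U n P" "diff_poly U m Q" "u 0 \<in> U"
  shows "jet_pd j (\<lambda>u. P u * Q u) u = P u * jet_pd j Q u + jet_pd j P u * Q u"
  unfolding jet_pd_def using assms by (subst deriv_mult) (auto intro: diff_poly_differentiable)

lemma jet_pd_coeff: "jet_pd j (\<lambda>u. c (u 0)) u = (if j = 0 then deriv c (u 0) else 0)"
  by (auto simp: jet_pd_def)

lemma jet_pd_var: "jet_pd j (\<lambda>u. u i) u = (if i = j then 1 else 0)"
  by (auto simp: jet_pd_def)

lemma jet_pd_zero [simp]: "jet_pd j (\<lambda>u. 0) u = 0"
  by (simp add: jet_pd_def)

lemma jet_pd_sum: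
  assumes "open U" "finite X" "\<And>x. x \<in> X \<Longrightarrow> diff_poly U n (P x)" "u 0 \<in> U"
  shows "jet_pd j (\<lambda>u. \<Sum>x\<in>X. P x u) u = (\<Sum>x\<in>X. jet_pd j (P x) u)"
  using assms(2,3)
proof (induction X rule: finite_induct)
  case (insert x X)
  have "jet_pd j (\<lambda>u. P x u + (\<Sum>x\<in>X. P x u)) u
      = jet_pd j (P x) u + jet_pd j (\<lambda>u. \<Sum>x\<in>X. P x u) u"
    using assms(1,4) insert by (intro jet_pd_add[of U n _ n] diff_poly_sum) auto
  then show ?case using insert by simp
qed simp

lemma jet_pd_eq_0:
  assumes "open U" "diff_poly U n P" "n < j" "u 0 \<in> U"
  shows "jet_pd j P u = 0"
  using assms(2-4)
proof (induction arbitrary: u rule: diff_poly.induct)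
  case (coeff c)
  then show ?case by (simp add: jet_pd_coeff)
next
  case (var i)
  then show ?case by (simp add: jet_pd_var)
next
  case (add n P Q)
  have "jet_pd j (\<lambda>u. P u + Q u) u = jet_pd j P u + jet_pd j Q u"
    using assms(1) add by (intro jet_pd_add)
  then show ?case using add by simp
next
  case (mult n P m Q)
  have "jet_pd j (\<lambda>u. P u * Q u) u = P u * jet_pd j Q u + jet_pd j P u * Q u"
    using assms(1) mult by (intro jet_pd_mult)
  then show ?case using mult by simp
next
  case (cong n P Q)
  have "jet_pd j Q u = jet_pd j P u" using assms(1) cong by (intro jet_pd_cong)
  then show ?case using cong by simp
qed

lemma diff_poly_pd:
  assumes "open U" "diff_poly U n P" "j \<le> n"
  shows "diff_poly U (n - j) (jet_pd j P)"
  using assms(2,3)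
proof (induction rule: diff_poly.induct)
  case (coeff c)
  have "diff_poly U 0 (\<lambda>u. deriv c (u 0))"
    using coeff assms(1) by (intro diff_poly.coeff) (auto intro: holomorphic_deriv)
  moreover have "jet_pd j (\<lambda>u. c (u 0)) = (\<lambda>u. deriv c (u 0))"
    using coeff by (simp add: jet_pd_coeff fun_eq_iff)
  ultimately show ?case by simp
next
  case (var i)
  show ?case
  proof (cases "i = j")
    case True
    then have "jet_pd j (\<lambda>u. u i) = (\<lambda>u. 1)" by (simp add: jet_pd_var fun_eq_iff)
    then show ?thesis using coeff[of "\<lambda>_. 1" U] True by simp
  next
    case False
    then have "jet_pd j (\<lambda>u. u i) = (\<lambda>u. 0)" by (simp add: jet_pd_var fun_eq_iff)
    then show ?thesis by (simp add: diff_poly_zero)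
  qed
next
  case (add n P Q)
  have "diff_poly U (n - j) (\<lambda>u. jet_pd j P u + jet_pd j Q u)"
    using add by (intro diff_poly.add)
  then show ?case
    by (rule cong) (use assms(1) add.hyps in \<open>intro jet_pd_add\<close>)
next
  case (mult n P m Q)
  \<comment> \<open>When j exceeds the weight of the differentiated factor, subtraction of weights
    truncates, but that derivative is 0 and may be given the weight required.\<close>
  have 1: "diff_poly U (n + m - j) (\<lambda>u. P u * jet_pd j Q u)"
  proof (cases "j \<le> m")
    case True
    then show ?thesis using mult diff_poly.mult[of U n P "m - j" "jet_pd j Q"] by simp
  next
    case False
    show ?thesis
      by (rule cong[OF diff_poly_zero]) (use False assms(1) mult.hyps(2) in \<open>simp add: jet_pd_eq_0\<close>)
  qed
  have 2: "diff_poly U (n + m - j) (\<lambda>u. jet_pd j P u * Q u)"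
  proof (cases "j \<le> n")
    case True
    then show ?thesis using mult diff_poly.mult[of U "n - j" "jet_pd j P" m Q] by simp
  next
    case False
    show ?thesis
      by (rule cong[OF diff_poly_zero]) (use False assms(1) mult.hyps(1) in \<open>simp add: jet_pd_eq_0\<close>)
  qed
  show ?case
    by (rule cong[OF add[OF 1 2]]) (use assms(1) mult.hyps in \<open>intro jet_pd_mult\<close>)
next
  case (cong n P Q)
  have "diff_poly U (n - j) (jet_pd j P)" using cong by simp
  then show ?case
    by (rule diff_poly.cong) (use assms(1) cong.hyps in \<open>intro jet_pd_cong\<close>)
qed

text \<open>For \<open>j > n\<close> the truncated difference \<open>n - j\<close> is \<open>0\<close>, which is harmless since the
  derivative vanishes.\<close>

lemma diff_poly_pd':
  assumes "open U" "diff_poly U n P"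
  shows "diff_poly U (n - j) (jet_pd j P)"
proof (cases "j \<le> n")
  case False
  show ?thesis
    by (rule cong[OF diff_poly_zero]) (use False assms in \<open>simp add: jet_pd_eq_0\<close>)
qed (use diff_poly_pd assms in auto)

text \<open>Structural induction replaces an analytic argument on mixed partials: second derivatives
  of variables vanish, those of coefficient functions are nonzero only for i = j = 0, and the twice
  applied product rule is symmetric in i and j.\<close>

lemma jet_pd_commute:
  assumes "open U" "diff_poly U n P" "u 0 \<in> U"
  shows "jet_pd i (jet_pd j P) u = jet_pd j (jet_pd i P) u"
  using assms(2,3)
proof (induction arbitrary: u rule: diff_poly.induct)
  case (coeff c)
  show ?case by (cases "i = 0"; cases "j = 0") (auto simp: jet_pd_coeff[abs_def])
next
  case (var l)
  then show ?case by (auto simp: jet_pd_var[abs_def] jet_pd_def)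
next
  case (add n P Q)
  note dp = diff_poly_pd'[OF assms(1) add.hyps(1)] diff_poly_pd'[OF assms(1) add.hyps(2)]
  have "jet_pd i (jet_pd j (\<lambda>u. P u + Q u)) u = jet_pd i (jet_pd j P) u + jet_pd i (jet_pd j Q) u"
      for i j
  proof -
    have "jet_pd i (jet_pd j (\<lambda>u. P u + Q u)) u = jet_pd i (\<lambda>u. jet_pd j P u + jet_pd j Q u) u"
      using assms(1) add.prems
    proof (rule jet_pd_cong)
      fix u :: jet assume "u 0 \<in> U"
      then show "jet_pd j (\<lambda>u. P u + Q u) u = jet_pd j P u + jet_pd j Q u"
        using assms(1) add.hyps by (intro jet_pd_add)
    qed
    also have "\<dots> = jet_pd i (jet_pd j P) u + jet_pd i (jet_pd j Q) u"
      by (rule jet_pd_add) (fact assms(1) dp add.prems)+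
    finally show ?thesis .
  qed
  then show ?case using add.IH add.prems by simp
next
  case (mult n P m Q)
  note dp = diff_poly_pd'[OF assms(1) mult.hyps(1)] diff_poly_pd'[OF assms(1) mult.hyps(2)]
  have "jet_pd i (jet_pd j (\<lambda>u. P u * Q u)) u
      = P u * jet_pd i (jet_pd j Q) u + jet_pd i P u * jet_pd j Q u
      + (jet_pd j P u * jet_pd i Q u + jet_pd i (jet_pd j P) u * Q u)" for i j
  proof -
    have "jet_pd i (jet_pd j (\<lambda>u. P u * Q u)) u
        = jet_pd i (\<lambda>u. P u * jet_pd j Q u + jet_pd j P u * Q u) u"
      using assms(1) mult.prems
    proof (rule jet_pd_cong)
      fix u :: jet assume "u 0 \<in> U"
      then show "jet_pd j (\<lambda>u. P u * Q u) u = P u * jet_pd j Q u + jet_pd j P u * Q u"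
        using assms(1) mult.hyps by (intro jet_pd_mult)
    qed
    also have "\<dots> = jet_pd i (\<lambda>u. P u * jet_pd j Q u) u + jet_pd i (\<lambda>u. jet_pd j P u * Q u) u"
      by (rule jet_pd_add, fact assms(1), rule diff_poly.mult[OF mult.hyps(1) dp(2)],
          rule diff_poly.mult[OF dp(1) mult.hyps(2)], fact mult.prems)
    also have "jet_pd i (\<lambda>u. P u * jet_pd j Q u) u
        = P u * jet_pd i (jet_pd j Q) u + jet_pd i P u * jet_pd j Q u"
      by (rule jet_pd_mult) (fact assms(1) mult.hyps dp mult.prems)+
    also have "jet_pd i (\<lambda>u. jet_pd j P u * Q u) u
        = jet_pd j P u * jet_pd i Q u + jet_pd i (jet_pd j P) u * Q u"
      by (rule jet_pd_mult) (fact assms(1) mult.hyps dp mult.prems)+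
    finally show ?thesis .
  qed
  then show ?case using mult.IH mult.prems by (simp add: algebra_simps)
next
  case (cong n P Q)
  have "jet_pd i (jet_pd j Q) u = jet_pd i (jet_pd j P) u" for i j
    using assms(1) cong.prems cong.hyps(2) by (intro jet_pd_cong) auto
  then show ?case using cong.IH[of u] cong.prems by simp
qed

section \<open>The total derivative and its commutator with partial derivatives\<close>

lemma total_deriv_eq_sum:
  assumes "open U" "diff_poly U n P" "u 0 \<in> U"
  shows "total_deriv P u = (\<Sum>j\<le>n. u (Suc j) * jet_pd j P u)"
  unfolding total_deriv_def using assms
  by (intro suminf_finite) (auto simp: jet_pd_eq_0)

lemma evol_deriv_eq_sum:
  assumes "open U" "diff_poly U n P" "u 0 \<in> U"
  shows "evol_deriv Q P u = (\<Sum>j\<le>n. (total_deriv ^^ j) Q u * jet_pd j P u)"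
  unfolding evol_deriv_def using assms
  by (intro suminf_finite) (auto simp: jet_pd_eq_0)

lemma diff_poly_total_deriv_term:
  assumes "open U" "diff_poly U n P" "j \<le> n"
  shows "diff_poly U (Suc n) (\<lambda>u. u (Suc j) * jet_pd j P u)"
  using mult[OF var[of "Suc j" U] diff_poly_pd[OF assms]] assms(3) by simp

lemma diff_poly_total_deriv:
  assumes "open U" "diff_poly U n P"
  shows "diff_poly U (Suc n) (total_deriv P)"
  by (rule cong[OF diff_poly_sum[of "{..n}" _ _ "\<lambda>j u. u (Suc j) * jet_pd j P u"]])
     (auto intro: diff_poly_total_deriv_term assms simp: total_deriv_eq_sum[OF assms])

lemma diff_poly_total_deriv_pow:
  assumes "open U" "diff_poly U n P"
  shows "diff_poly U (n + j) ((total_deriv ^^ j) P)"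
  by (induction j) (use assms diff_poly_total_deriv in auto)

text \<open>The classical relation that the commutator of the i-th partial derivative with D is the
  (i-1)-th one: it comes from differentiating the factor \<open>u (Suc j)\<close> with
  \<open>Suc j = i\<close>. Everything about coefficients of D P rests on it.\<close>

lemma jet_pd_total_deriv:
  assumes "open U" "diff_poly U n P" "u 0 \<in> U"
  shows "jet_pd i (total_deriv P) u
    = total_deriv (jet_pd i P) u + (if i = 0 then 0 else jet_pd (i - 1) P u)"
proof -
  have "jet_pd i (total_deriv P) u = jet_pd i (\<lambda>u. \<Sum>j\<le>n. u (Suc j) * jet_pd j P u) u"
    by (rule jet_pd_cong) (use assms in \<open>auto simp: total_deriv_eq_sum[OF assms(1,2)]\<close>)
  also have "\<dots> = (\<Sum>j\<le>n. jet_pd i (\<lambda>u. u (Suc j) * jet_pd j P u) u)"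
    using assms by (intro jet_pd_sum[of U _ "Suc n"]) (auto intro: diff_poly_total_deriv_term)
  also have "\<dots> = (\<Sum>j\<le>n. u (Suc j) * jet_pd j (jet_pd i P) u
      + (if Suc j = i then jet_pd j P u else 0))"
  proof (rule sum.cong[OF refl])
    fix j assume "j \<in> {..n}"
    have "diff_poly U (Suc j) (\<lambda>u. u (Suc j))" by (intro var) simp
    then have "jet_pd i (\<lambda>u. u (Suc j) * jet_pd j P u) u
        = u (Suc j) * jet_pd i (jet_pd j P) u + jet_pd i (\<lambda>u. u (Suc j)) u * jet_pd j P u"
      by (intro jet_pd_mult[where m = "n - j"]) (use assms diff_poly_pd' in auto)
    then show "jet_pd i (\<lambda>u. u (Suc j) * jet_pd j P u) u
        = u (Suc j) * jet_pd j (jet_pd i P) u + (if Suc j = i then jet_pd j P u else 0)"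
      using jet_pd_commute[OF assms(1,2), of u i j] assms(3) by (simp add: jet_pd_var)
  qed
  also have "\<dots> = (\<Sum>j\<le>n. u (Suc j) * jet_pd j (jet_pd i P) u)
      + (\<Sum>j\<le>n. if Suc j = i then jet_pd j P u else 0)"
    by (rule sum.distrib)
  also have "(\<Sum>j\<le>n. u (Suc j) * jet_pd j (jet_pd i P) u) = total_deriv (jet_pd i P) u"
  proof -
    have "total_deriv (jet_pd i P) u = (\<Sum>j\<le>n-i. u (Suc j) * jet_pd j (jet_pd i P) u)"
      using assms by (intro total_deriv_eq_sum diff_poly_pd')
    also have "\<dots> = (\<Sum>j\<le>n. u (Suc j) * jet_pd j (jet_pd i P) u)"
      using jet_pd_eq_0[OF assms(1) diff_poly_pd'[OF assms(1,2), of i], of _ u] assms(3)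
      by (intro sum.mono_neutral_left) auto
    finally show ?thesis ..
  qed
  also have "(\<Sum>j\<le>n. if Suc j = i then jet_pd j P u else 0) = (if i = 0 then 0 else jet_pd (i - 1) P u)"
  proof (cases i)
    case (Suc l)
    \<comment> \<open>The index l may lie beyond the summation bound n; then the sum is empty of it
      and the derivative on the right is 0 too.\<close>
    then show ?thesis using jet_pd_eq_0[OF assms(1,2), of l u] assms(3)
      by (auto simp: sum.delta)
  qed simp
  finally show ?thesis .
qed

lemma total_deriv_cong:
  assumes "open U" "u 0 \<in> U" "\<And>u. u 0 \<in> U \<Longrightarrow> P u = Q u"
  shows "total_deriv P u = total_deriv Q u"
proof -
  have "jet_pd j P u = jet_pd j Q u" for j using assms by (rule jet_pd_cong)
  then show ?thesis by (simp add: total_deriv_def)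
qed

lemma total_deriv_pow_cong:
  assumes "open U" "u 0 \<in> U" "\<And>u. u 0 \<in> U \<Longrightarrow> P u = Q u"
  shows "(total_deriv ^^ j) P u = (total_deriv ^^ j) Q u"
  using assms(2) by (induction j arbitrary: u) (auto intro: assms(3) total_deriv_cong[OF assms(1)])

text \<open>Each summand may have its own weight: truncated subtraction can attach different weights
  to terms of one identity once more derivatives are taken than the weight allows.\<close>

lemma diff_poly_differentiable_sum_list:
  assumes "open U" "\<And>x. x \<in> set xs \<Longrightarrow> \<exists>n. diff_poly U n (P x)" "u 0 \<in> U"
  shows "(\<lambda>z. \<Sum>x\<leftarrow>xs. P x (u(j := z))) field_differentiable at (u j)"
  using assms(2)
proof (induction xs)
  case (Cons x xs)
  obtain n where "diff_poly U n (P x)" using Cons.prems by auto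
  then have "(\<lambda>z. P x (u(j := z))) field_differentiable at (u j)"
    using assms by (intro diff_poly_differentiable)
  then show ?case using Cons by (auto intro!: field_differentiable_add simp del: fun_upd_apply)
qed simp

lemma jet_pd_sum_list:
  assumes "open U" "\<And>x. x \<in> set xs \<Longrightarrow> \<exists>n. diff_poly U n (P x)" "u 0 \<in> U"
  shows "jet_pd j (\<lambda>u. \<Sum>x\<leftarrow>xs. P x u) u = (\<Sum>x\<leftarrow>xs. jet_pd j (P x) u)"
  using assms(2)
proof (induction xs)
  case (Cons x xs)
  obtain n where "diff_poly U n (P x)" using Cons.prems by auto
  then have "(\<lambda>z. P x (u(j := z))) field_differentiable at (u j)"
    using assms by (intro diff_poly_differentiable)
  moreover have "(\<lambda>z. \<Sum>x\<leftarrow>xs. P x (u(j := z))) field_differentiable at (u j)"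
    using assms(1,3) Cons.prems by (intro diff_poly_differentiable_sum_list) auto
  ultimately show ?case using Cons by (simp add: jet_pd_def)
qed simp

section \<open>Iterated derivatives and Taylor coefficients at constant jets\<close>

fun jet_pds :: "nat list \<Rightarrow> (jet \<Rightarrow> complex) \<Rightarrow> jet \<Rightarrow> complex" where
  "jet_pds [] P = P"
| "jet_pds (i # T) P = jet_pd i (jet_pds T P)"

lemma jet_pds_append: "jet_pds (S @ T) P = jet_pds S (jet_pds T P)"
  by (induction S) auto

lemma diff_poly_pds:
  assumes "open U" "diff_poly U n P"
  shows "diff_poly U (n - sum_list T) (jet_pds T P)"
proof (induction T)
  case (Cons i T)
  show ?case using diff_poly_pd'[OF assms(1) Cons, of i] by (simp add: add.commute)
qed (use assms in simp)

lemma jet_pds_cong: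
  assumes "open U" "u 0 \<in> U" "\<And>u. u 0 \<in> U \<Longrightarrow> P u = Q u"
  shows "jet_pds T P u = jet_pds T Q u"
  using assms(2) by (induction T arbitrary: u) (auto intro: assms(3) jet_pd_cong[OF assms(1)])

lemma jet_pds_zero [simp]: "jet_pds T (\<lambda>u. 0) = (\<lambda>u. 0)"
proof (induction T)
  case (Cons i T)
  then show ?case by (simp add: fun_eq_iff[of "jet_pd i (\<lambda>u. 0)"])
qed simp

lemma jet_pds_eq_0:
  assumes "open U" "diff_poly U n P" "n < sum_list T" "u 0 \<in> U"
  shows "jet_pds T P u = 0"
  using assms(3,4)
proof (induction T arbitrary: u)
  case (Cons i T)
  show ?case
  proof (cases "n < sum_list T")
    case True
    have "jet_pd i (jet_pds T P) u = jet_pd i (\<lambda>u. 0) u"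
      using assms(1) Cons.prems(2) True by (intro jet_pd_cong) (auto intro: Cons.IH)
    then show ?thesis by simp
  next
    case False
    then show ?thesis
      using Cons.prems jet_pd_eq_0[OF assms(1) diff_poly_pds[OF assms(1,2), of T], of i u] by auto
  qed
qed simp

definition base_jet :: "complex \<Rightarrow> jet" where
  "base_jet z = (\<lambda>j. if j = 0 then z else 0)"

lemma base_jet_0 [simp]: "base_jet z 0 = z" and base_jet_Suc [simp]: "base_jet z (Suc j) = 0"
  by (simp_all add: base_jet_def)

text \<open>Every term of positive weight contains some derivative of order at least one, and these
  are 0 on the jet of a constant function.\<close>

lemma diff_poly_base_jet:
  assumes "diff_poly U n P" "n > 0" "z \<in> U"
  shows "P (base_jet z) = 0"
  using assms by induction (auto simp: base_jet_def)

text \<open>The jet \<open>base_jet z\<close> turns the coefficients of a differential polynomial into iterated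
  derivatives, so that no identity theorem for polynomials in infinitely many variables is needed.\<close>

definition jet_coeff :: "nat list \<Rightarrow> (jet \<Rightarrow> complex) \<Rightarrow> complex \<Rightarrow> complex" where
  "jet_coeff T P z = jet_pds T P (base_jet z)"

lemma jet_coeff_cong:
  assumes "open U" "z \<in> U" "\<And>u. u 0 \<in> U \<Longrightarrow> P u = Q u"
  shows "jet_coeff T P z = jet_coeff T Q z"
  unfolding jet_coeff_def using assms by (intro jet_pds_cong) auto

text \<open>Too few derivatives leave positive weight, which vanishes at the constant jet; too many
  give 0 identically. This rule turns the sums over orders below into single terms.\<close>

lemma jet_coeff_eq_0:
  assumes "open U" "diff_poly U n P" "z \<in> U" "sum_list T \<noteq> n"
  shows "jet_coeff T P z = 0"
proof (cases "sum_list T < n")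
  case True
  then show ?thesis unfolding jet_coeff_def
    using assms diff_poly_pds[OF assms(1,2)] by (intro diff_poly_base_jet) auto
next
  case False
  then show ?thesis unfolding jet_coeff_def
    using assms by (intro jet_pds_eq_0) auto
qed

lemma jet_coeff_0_Cons:
  "jet_coeff (0 # T) P z = deriv (jet_coeff T P) z"
proof -
  have "(base_jet z)(0 := y) = base_jet y" for y by (auto simp: base_jet_def)
  then show ?thesis by (simp add: jet_coeff_def[abs_def] jet_pd_def)
qed

lemma jet_pds_move:
  assumes "open U" "diff_poly U n P" "u 0 \<in> U"
  shows "jet_pds (S @ i # T) P u = jet_pds (i # S @ T) P u"
  using assms(3)
proof (induction S arbitrary: u)
  case (Cons j S)
  have "jet_pds ((j # S) @ i # T) P u = jet_pd j (jet_pds (i # S @ T) P) u"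
    unfolding append_Cons jet_pds.simps(2)[of j]
    using assms(1) Cons by (intro jet_pd_cong)
  also have "\<dots> = jet_pd i (jet_pd j (jet_pds (S @ T) P)) u"
    unfolding jet_pds.simps(2)
    by (rule jet_pd_commute) (use assms(1) Cons.prems diff_poly_pds[OF assms(1,2), of "S @ T"] in auto)
  finally show ?case by simp
qed simp

lemma jet_pds_perm:
  assumes "open U" "diff_poly U n P" "u 0 \<in> U" "mset S = mset T"
  shows "jet_pds S P u = jet_pds T P u"
  using assms(3,4)
proof (induction S arbitrary: u T)
  case (Cons i S)
  then have "i \<in> set T" by (metis list.set_intros(1) set_mset_mset)
  then obtain T1 T2 where T: "T = T1 @ i # T2" by (auto dest: split_list)
  then have "mset S = mset (T1 @ T2)" using Cons.prems by simp
  then have "jet_pd i (jet_pds S P) u = jet_pd i (jet_pds (T1 @ T2) P) u"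
    using assms(1) Cons by (intro jet_pd_cong) auto
  then show ?case using jet_pds_move[OF assms(1,2), of u T1 i T2] Cons.prems T by simp
qed simp

lemma jet_coeff_perm:
  assumes "open U" "diff_poly U n P" "z \<in> U" "mset S = mset T"
  shows "jet_coeff S P z = jet_coeff T P z"
  unfolding jet_coeff_def using assms by (intro jet_pds_perm) auto

section \<open>Coefficients of total derivatives by lowering multi-indices\<close>

fun lowers :: "nat list \<Rightarrow> nat list list" where
  "lowers [] = []"
| "lowers (a # L) = (if a = 0 then [] else [(a - 1) # L]) @ map ((#) a) (lowers L)"

lemma sum_list_lowers: "L \<in> set (lowers T) \<Longrightarrow> Suc (sum_list L) = sum_list T"
  by (induction T arbitrary: L) (auto split: if_splits)

lemma jet_pds_total_deriv:
  assumes "open U" "diff_poly U n P" "u 0 \<in> U"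
  shows "jet_pds T (total_deriv P) u = total_deriv (jet_pds T P) u + (\<Sum>L\<leftarrow>lowers T. jet_pds L P u)"
  using assms(3)
proof (induction T arbitrary: u)
  case (Cons i T)
  note dp = diff_poly_pds[OF assms(1,2)]
  have "jet_pd i (jet_pds T (total_deriv P)) u
      = jet_pd i (\<lambda>u. total_deriv (jet_pds T P) u + (\<Sum>L\<leftarrow>lowers T. jet_pds L P u)) u"
    using assms(1) Cons by (intro jet_pd_cong)
  also have "\<dots> = jet_pd i (\<lambda>u. \<Sum>Q\<leftarrow>total_deriv (jet_pds T P) # map (\<lambda>L. jet_pds L P) (lowers T). Q u) u"
    by (simp add: comp_def)
  also have "\<dots> = (\<Sum>Q\<leftarrow>total_deriv (jet_pds T P) # map (\<lambda>L. jet_pds L P) (lowers T). jet_pd i Q u)"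
    using assms(1) Cons.prems dp diff_poly_total_deriv[OF assms(1) dp[of T]]
    by (intro jet_pd_sum_list) auto
  also have "\<dots> = jet_pd i (total_deriv (jet_pds T P)) u + (\<Sum>L\<leftarrow>lowers T. jet_pds (i # L) P u)"
    by (simp add: comp_def)
  also have "jet_pd i (total_deriv (jet_pds T P)) u
      = total_deriv (jet_pds (i # T) P) u + (if i = 0 then 0 else jet_pds ((i - 1) # T) P u)"
    using jet_pd_total_deriv[OF assms(1) dp[of T], of u i] Cons.prems by simp
  finally show ?case by (simp add: comp_def)
qed simp

text \<open>Moving all partial derivatives past D leaves one term per lowered entry plus D applied
  last, and D of anything is 0 at a constant jet. On coefficients, D is thus the transpose of
  lowering one entry.\<close>

lemma jet_coeff_total_deriv:
  assumes "open U" "diff_poly U n P" "z \<in> U"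
  shows "jet_coeff T (total_deriv P) z = (\<Sum>L\<leftarrow>lowers T. jet_coeff L P z)"
proof -
  have "total_deriv (jet_pds T P) (base_jet z) = 0"
    unfolding total_deriv_def by simp
  then show ?thesis
    using jet_pds_total_deriv[OF assms(1,2), of "base_jet z" T] assms(3)
    by (simp add: jet_coeff_def)
qed

section \<open>Leibniz rule and coefficients of evolutionary derivatives\<close>

fun splits :: "'a list \<Rightarrow> ('a list \<times> 'a list) list" where
  "splits [] = [([], [])]"
| "splits (x # T) = map (\<lambda>(A, B). (x # A, B)) (splits T) @ map (\<lambda>(A, B). (A, x # B)) (splits T)"

lemma sum_list_splits: "(A, B) \<in> set (splits T) \<Longrightarrow> sum_list A + sum_list B = sum_list (T :: nat list)"
  by (induction T arbitrary: A B) auto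

text \<open>The entries of T are treated as labelled, so repeated splits occur as often as they
  should and no binomial coefficients appear.\<close>

lemma jet_pds_mult:
  assumes "open U" "diff_poly U n P" "diff_poly U m Q" "u 0 \<in> U"
  shows "jet_pds T (\<lambda>u. P u * Q u) u = (\<Sum>(A, B)\<leftarrow>splits T. jet_pds A P u * jet_pds B Q u)"
  using assms(4)
proof (induction T arbitrary: u)
  case (Cons i T)
  note dp = diff_poly_pds[OF assms(1,2)] diff_poly_pds[OF assms(1,3)]
  have "jet_pd i (jet_pds T (\<lambda>u. P u * Q u)) u
      = jet_pd i (\<lambda>u. \<Sum>x\<leftarrow>splits T. jet_pds (fst x) P u * jet_pds (snd x) Q u) u"
    using assms(1) Cons by (intro jet_pd_cong) (auto simp: case_prod_beta)
  also have "\<dots> = (\<Sum>x\<leftarrow>splits T. jet_pd i (\<lambda>u. jet_pds (fst x) P u * jet_pds (snd x) Q u) u)"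
    using assms(1) Cons.prems dp by (intro jet_pd_sum_list) (auto intro: diff_poly.mult)
  also have "\<dots> = (\<Sum>x\<leftarrow>splits T. jet_pds (i # fst x) P u * jet_pds (snd x) Q u
      + jet_pds (fst x) P u * jet_pds (i # snd x) Q u)"
  proof (intro arg_cong[of _ _ sum_list] map_cong refl)
    fix x
    have "jet_pd i (\<lambda>u. jet_pds (fst x) P u * jet_pds (snd x) Q u) u
        = jet_pds (fst x) P u * jet_pd i (jet_pds (snd x) Q) u + jet_pd i (jet_pds (fst x) P) u
            * jet_pds (snd x) Q u"
      by (rule jet_pd_mult) (fact assms(1) dp Cons.prems)+
    then show "jet_pd i (\<lambda>u. jet_pds (fst x) P u * jet_pds (snd x) Q u) u
        = jet_pds (i # fst x) P u * jet_pds (snd x) Q u + jet_pds (fst x) P u * jet_pds (i # snd x) Q u"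
      by simp
  qed
  finally show ?case
    by (simp add: sum_list_addf comp_def case_prod_beta)
qed simp

lemma jet_pds_sum:
  assumes "open U" "finite X" "\<And>x. x \<in> X \<Longrightarrow> diff_poly U n (P x)" "u 0 \<in> U"
  shows "jet_pds T (\<lambda>u. \<Sum>x\<in>X. P x u) u = (\<Sum>x\<in>X. jet_pds T (P x) u)"
  using assms(4)
proof (induction T arbitrary: u)
  case (Cons i T)
  have "jet_pd i (jet_pds T (\<lambda>u. \<Sum>x\<in>X. P x u)) u = jet_pd i (\<lambda>u. \<Sum>x\<in>X. jet_pds T (P x) u) u"
    using assms(1) Cons by (intro jet_pd_cong)
  also have "\<dots> = (\<Sum>x\<in>X. jet_pd i (jet_pds T (P x)) u)"
    using assms(1,2) Cons.prems diff_poly_pds[OF assms(1) assms(3), of _ T] by (intro jet_pd_sum)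
  finally show ?case by simp
qed simp

lemma sum_sum_list_swap:
  fixes f :: "'a \<Rightarrow> 'b \<Rightarrow> 'c::comm_monoid_add"
  shows "(\<Sum>j\<in>J. \<Sum>x\<leftarrow>xs. f j x) = (\<Sum>x\<leftarrow>xs. \<Sum>j\<in>J. f j x)"
  by (induction xs) (simp_all add: sum.distrib)

text \<open>After the Leibniz rule, A goes to the partial derivative of P and B to the power of D
  applied to Q. The order j of that power is then forced by the weight of P.\<close>

lemma jet_coeff_evol_deriv:
  assumes "open U" "diff_poly U p P" "diff_poly U q Q" "z \<in> U"
  shows "jet_coeff T (evol_deriv Q P) z = (\<Sum>(A, B)\<leftarrow>splits T. if sum_list A \<le> p
    then jet_coeff ((p - sum_list A) # A) P z * jet_coeff B ((total_deriv ^^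
        (p - sum_list A)) Q) z else 0)"
proof -
  let ?D = "\<lambda>j. (total_deriv ^^ j) Q"
  have "jet_coeff T (evol_deriv Q P) z = jet_coeff T (\<lambda>u. \<Sum>j\<in>{..p}. jet_pd j P u * ?D j u) z"
    using assms by (intro jet_coeff_cong) (auto simp: evol_deriv_eq_sum mult.commute)
  also have "\<dots> = (\<Sum>j\<le>p. jet_pds T (\<lambda>u. jet_pd j P u * ?D j u) (base_jet z))"
    unfolding jet_coeff_def
  proof (rule jet_pds_sum[OF assms(1)])
    fix j assume "j \<in> {..p}"
    then show "diff_poly U (p + q) (\<lambda>u. jet_pd j P u * ?D j u)"
      using mult[OF diff_poly_pd[OF assms(1,2), of j] diff_poly_total_deriv_pow[OF assms(1,3), of j]]
          by simp
  qed (use assms in auto)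
  also have "\<dots> = (\<Sum>j\<le>p. \<Sum>(A, B)\<leftarrow>splits T. jet_coeff (j # A) P z * jet_coeff B (?D j) z)"
  proof (rule sum.cong[OF refl])
    fix j
    have "jet_pds T (\<lambda>u. jet_pd j P u * ?D j u) (base_jet z)
        = (\<Sum>(A, B)\<leftarrow>splits T. jet_pds A (jet_pd j P) (base_jet z) * jet_pds B (?D j) (base_jet z))"
      by (rule jet_pds_mult[OF assms(1) diff_poly_pd'[OF assms(1,2)] diff_poly_total_deriv_pow[OF assms(1,3)]])
         (simp add: assms(4))
    moreover have "jet_pds A (jet_pd j P) (base_jet z) = jet_coeff (j # A) P z" for A
      using jet_pds_move[OF assms(1,2), of "base_jet z" A j "[]"] assms(4)
      by (simp add: jet_pds_append jet_coeff_def)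
    ultimately show "jet_pds T (\<lambda>u. jet_pd j P u * ?D j u) (base_jet z)
        = (\<Sum>(A, B)\<leftarrow>splits T. jet_coeff (j # A) P z * jet_coeff B (?D j) z)"
      by (simp add: jet_coeff_def)
  qed
  finally have "jet_coeff T (evol_deriv Q P) z = (\<Sum>j\<le>p. \<Sum>(A, B)\<leftarrow>splits T.
      jet_coeff (j # A) P z * jet_coeff B (?D j) z)" .
  also have "\<dots> = (\<Sum>(A, B)\<leftarrow>splits T. \<Sum>j\<le>p. jet_coeff (j # A) P z * jet_coeff B (?D j) z)"
    unfolding case_prod_beta by (rule sum_sum_list_swap)
  finally have "jet_coeff T (evol_deriv Q P) z = (\<Sum>(A, B)\<leftarrow>splits T. \<Sum>j\<le>p.
      jet_coeff (j # A) P z * jet_coeff B (?D j) z)" .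
  \<comment> \<open>A term is nonzero only if \<open>j # A\<close> has weight exactly p, which
    leaves at most the one index \<open>p - sum_list A\<close>.\<close>
  moreover have "(\<Sum>j\<le>p. jet_coeff (j # A) P z * jet_coeff B (?D j) z) =
      (if sum_list A \<le> p then jet_coeff ((p - sum_list A) # A) P z * jet_coeff B (?D
          (p - sum_list A)) z else 0)" for A B
  proof -
    have "(\<Sum>j\<le>p. jet_coeff (j # A) P z * jet_coeff B (?D j) z)
        = (\<Sum>j\<le>p. if j + sum_list A = p then jet_coeff ((p - sum_list A) # A) P z * jet_coeff B (?D
            (p - sum_list A)) z else 0)"
      by (intro sum.cong) (auto simp: jet_coeff_eq_0[OF assms(1,2,4)])
    also have "\<dots> = (if sum_list A \<le> p then jet_coeff ((p - sum_list A) # A) P z * jet_coeff B (?D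
        (p - sum_list A)) z else 0)"
    proof (cases "sum_list A \<le> p")
      case True
      then have "j + sum_list A = p \<longleftrightarrow> j = p - sum_list A" for j by auto
      then show ?thesis using True by (simp add: sum.delta)
    qed auto
    finally show ?thesis .
  qed
  ultimately show ?thesis by simp
qed

section \<open>Evaluation of the commutator equations\<close>

text \<open>Formal integer combinations as association lists. Terms that cancel are removed, so the
  massive cancellation in the commutator takes place in integer arithmetic, before any polynomial
  value is substituted.\<close>

fun add_term :: "int \<Rightarrow> 'k \<Rightarrow> (int \<times> 'k) list \<Rightarrow> (int \<times> 'k) list" where
  "add_term c x [] = [(c, x)]"
| "add_term c x ((d, y) # ts) =
     (if x = y then (if c + d = 0 then ts else (c + d, y) # ts) else (d, y) # add_term c x ts)"

definition add_terms :: "(int \<times> 'k) list \<Rightarrow> (int \<times> 'k) list \<Rightarrow> (int \<times> 'k) list" where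
  "add_terms us ts = foldr (\<lambda>(c, x). add_term c x) us ts"

definition scale_terms :: "int \<Rightarrow> (int \<times> 'k) list \<Rightarrow> (int \<times> 'k) list" where
  "scale_terms c ts = map (\<lambda>(d, x). (c * d, x)) ts"

fun add_row :: "'r \<Rightarrow> (int \<times> 'k) list \<Rightarrow> ('r \<times> (int \<times> 'k) list) list \<Rightarrow> ('r \<times> (int \<times> 'k) list) list" where
  "add_row r us [] = [(r, us)]"
| "add_row r us ((s, ts) # rws) =
     (if r = s then (s, add_terms us ts) # rws else (s, ts) # add_row r us rws)"

definition add_rows :: "int \<Rightarrow> (int \<times> 'r) list \<Rightarrow> (int \<times> 'k) list \<Rightarrow>
    ('r \<times> (int \<times> 'k) list) list \<Rightarrow> ('r \<times> (int \<times> 'k) list) list" where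
  "add_rows c xs ys rws = foldr (\<lambda>(d, r). add_row r (scale_terms (c * d) ys)) xs rws"

definition eval_terms :: "('k \<Rightarrow> complex) \<Rightarrow> (int \<times> 'k) list \<Rightarrow> complex" where
  "eval_terms h ts = (\<Sum>(c, x)\<leftarrow>ts. of_int c * h x)"

definition eval_rows :: "('r \<Rightarrow> complex) \<Rightarrow> ('k \<Rightarrow> complex) \<Rightarrow> ('r \<times> (int \<times> 'k) list) list \<Rightarrow> complex" where
  "eval_rows f h rws = (\<Sum>(r, ts)\<leftarrow>rws. f r * eval_terms h ts)"

lemma eval_terms_simps [simp]:
  "eval_terms h [] = 0" "eval_terms h ((c, x) # ts) = of_int c * h x + eval_terms h ts"
  by (simp_all add: eval_terms_def)

lemma eval_rows_simps [simp]:
  "eval_rows f h [] = 0" "eval_rows f h ((r, ts) # rws) = f r * eval_terms h ts + eval_rows f h rws"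
  by (simp_all add: eval_rows_def)

lemma eval_add_term: "eval_terms h (add_term c x ts) = of_int c * h x + eval_terms h ts"
proof (induction ts)
  case (Cons t ts)
  obtain d y where t: "t = (d, y)" by fastforce
  have "of_int c * h y + of_int d * h y = 0" if "c + d = 0"
  proof -
    have "of_int c * h y + of_int d * h y = of_int (c + d) * h y" by (simp add: algebra_simps)
    then show ?thesis using that by simp
  qed
  then show ?case using Cons by (auto simp: t algebra_simps)
qed simp

lemma eval_add_terms: "eval_terms h (add_terms us ts) = eval_terms h us + eval_terms h ts"
  by (induction us) (auto simp: add_terms_def eval_add_term algebra_simps)

lemma eval_scale_terms: "eval_terms h (scale_terms c ts) = of_int c * eval_terms h ts"
  by (induction ts) (auto simp: scale_terms_def algebra_simps)

lemma eval_add_row: "eval_rows f h (add_row r us rws) = f r * eval_terms h us + eval_rows f h rws"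
  by (induction rws) (auto simp: eval_add_terms algebra_simps)

lemma eval_add_rows:
  "eval_rows f h (add_rows c xs ys rws) = of_int c * eval_terms f xs * eval_terms h ys
      + eval_rows f h rws"
  by (induction xs) (auto simp: add_rows_def eval_add_row eval_scale_terms algebra_simps)

lemma eval_terms_cong:
  assumes "\<And>c x. (c, x) \<in> set ts \<Longrightarrow> h x = h' x"
  shows "eval_terms h ts = eval_terms h' ts"
  unfolding eval_terms_def using assms by (intro arg_cong[of _ _ sum_list] map_cong) auto

lemma eval_terms_divide: "eval_terms (\<lambda>x. h x / a) ts = eval_terms h ts / a"
  by (induction ts) (auto simp: add_divide_distrib)

lemma set_add_term: "(d, y) \<in> set (add_term c x ts) \<Longrightarrow> y = x \<or> y \<in> snd ` set ts"
  by (induction ts) (force split: if_splits)+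

lemma set_add_terms: "(d, y) \<in> set (add_terms us ts) \<Longrightarrow> y \<in> snd ` set us \<or> y \<in> snd ` set ts"
proof (induction us arbitrary: d y)
  case (Cons u us)
  obtain c x where u: "u = (c, x)" by fastforce
  have "(d, y) \<in> set (add_term c x (add_terms us ts))"
    using Cons.prems by (simp add: add_terms_def u)
  then have "y = x \<or> y \<in> snd ` set (add_terms us ts)" by (rule set_add_term)
  then show ?case using Cons.IH u by force
qed (force simp: add_terms_def)

text \<open>The code equation of \<open>sort\<close> is quicksort, which \<open>code_simp\<close> evaluates much more slowly.\<close>

definition insertion_sort :: "nat list \<Rightarrow> nat list" where
  "insertion_sort L = foldr insort L []"

lemma insertion_sort_eq_sort [simp]: "insertion_sort = sort"
  by (simp add: fun_eq_iff insertion_sort_def sort_key_def)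

text \<open>Lowering can disturb the order of entries; sorting gives permuted multi-indices the same
  key, so that \<open>add_terms\<close> merges them. Symmetry of mixed partials makes this
  sound.\<close>

definition lower_step :: "(int \<times> nat list) list \<Rightarrow> (int \<times> nat list) list" where
  "lower_step ts = add_terms (concat (map (\<lambda>(c, L). map (\<lambda>L'. (c, insertion_sort L'))
      (lowers L)) ts)) []"

fun lower_chain :: "nat \<Rightarrow> (int \<times> nat list) list \<Rightarrow> (int \<times> nat list) list list" where
  "lower_chain 0 ts = [ts]"
| "lower_chain (Suc n) ts = ts # lower_chain n (lower_step ts)"

lemma lower_chain_nth: "j \<le> n \<Longrightarrow> lower_chain n ts ! j = (lower_step ^^ j) ts"
proof (induction n arbitrary: j ts)
  case (Suc n)
  then show ?case by (cases j) (simp_all del: funpow.simps add: funpow_Suc_right)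
qed simp

lemma length_lower_chain: "length (lower_chain n ts) = Suc n"
  by (induction n arbitrary: ts) auto

lemma last_lower_chain: "last (lower_chain n ts) = (lower_step ^^ n) ts"
  using lower_chain_nth[of n n ts] length_lower_chain[of n ts] last_conv_nth[of "lower_chain n ts"]
  by (metis Suc_neq_Zero diff_Suc_1 le_refl list.size(3))

lemma length_lowers: "L \<in> set (lowers T) \<Longrightarrow> length L = length T"
  by (induction T arbitrary: L) (auto split: if_splits)

lemma sum_length_lower_step:
  assumes "(c, L) \<in> set (lower_step ts)"
  shows "\<exists>c' L'. (c', L') \<in> set ts \<and> Suc (sum_list L) = sum_list L' \<and> length L = length L'"
proof -
  obtain c' L' M where "(c', L') \<in> set ts" "M \<in> set (lowers L')" "L = sort M"
    using set_add_terms[OF assms[unfolded lower_step_def]] by auto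
  then show ?thesis
    using sum_list_lowers[of M L'] length_lowers[of M L']
    by (metis length_sort mset_sort sum_mset_sum_list)
qed

text \<open>The weight identifies the member of the family to which a lowered multi-index belongs;
  the unchanged length identifies the power of u by which its coefficient is scaled.\<close>

lemma sum_length_lower_pow:
  assumes "(c, L) \<in> set ((lower_step ^^ j) [(1, T)])"
  shows "sum_list L + j = sum_list T \<and> length L = length T"
  using assms
proof (induction j arbitrary: c L)
  case (Suc j)
  then show ?case using sum_length_lower_step[of c L "(lower_step ^^ j) [(1, T)]"] by force
qed simp

lemma eval_lower_step:
  assumes "open U" "diff_poly U n P" "z \<in> U"
  shows "eval_terms (\<lambda>L. jet_coeff L P z) (lower_step ts) = eval_terms (\<lambda>L. jet_coeff L
      (total_deriv P) z) ts"
proof -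
  have "jet_coeff (sort L) P z = jet_coeff L P z" for L
    using assms by (intro jet_coeff_perm) auto
  then have "eval_terms (\<lambda>L. jet_coeff L P z) (map (\<lambda>L'. (c, sort L')) (lowers L))
      = of_int c * jet_coeff L (total_deriv P) z" for c L
    unfolding jet_coeff_total_deriv[OF assms]
    by (simp add: eval_terms_def comp_def sum_list_const_mult)
  moreover have "eval_terms h (xs @ ys) = eval_terms h xs + eval_terms h ys"
      for h :: "nat list \<Rightarrow> complex" and xs ys
    by (simp add: eval_terms_def)
  ultimately show ?thesis
    unfolding lower_step_def insertion_sort_eq_sort eval_add_terms by (induction ts) auto
qed

lemma eval_lower_pow:
  assumes "open U" "diff_poly U n P" "z \<in> U"
  shows "eval_terms (\<lambda>L. jet_coeff L P z) ((lower_step ^^ j) ts)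
    = eval_terms (\<lambda>L. jet_coeff L ((total_deriv ^^ j) P) z) ts"
  using assms(2)
proof (induction j arbitrary: n P)
  case (Suc j)
  show ?case
    using eval_lower_step[OF assms(1) Suc.prems assms(3), of "(lower_step ^^ j) ts"]
      Suc.IH[OF diff_poly_total_deriv[OF assms(1) Suc.prems]]
    by (simp add: funpow_swap1)
qed simp

text \<open>The rows \<open>(r, ts)\<close> encode the bilinear form \<open>eval_rows\<close> in the coefficients of the two
  series. Since \<open>F\<^sub>i = D\<^sub>x\<^bsup>i-2\<^esup> F\<^sub>2\<close> for the even \<open>i \<ge> 2\<close>, the coefficients of \<open>F\<^sub>i\<close> are expressed by
  those of \<open>F\<^sub>0\<close> and \<open>F\<^sub>2\<close>; this accounts for the \<open>i - 2\<close> additional lowering steps.\<close>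

definition split_rows :: "nat \<Rightarrow> nat \<Rightarrow> int \<Rightarrow> nat list \<Rightarrow> nat \<Rightarrow> (int \<times> nat list) list list \<Rightarrow>
    (nat list \<times> (int \<times> nat list) list) list \<Rightarrow> (nat list \<times> (int \<times> nat list) list) list" where
  "split_rows n i c A s ch rws =
     (if s \<le> i + 1
      then add_rows c (last (lower_chain (i - 2) [(1, insertion_sort ((i + 1 - s) # A))])) (ch ! (i
          + 1 - s)) else id)
     ((if s \<le> n - i + 1
       then add_rows (- c) (ch ! (n - i + 1 - s + (i - 2))) [(1, insertion_sort ((n - i
           + 1 - s) # A))] else id) rws)"

definition all_split_rows :: "nat \<Rightarrow> int \<Rightarrow> nat list \<Rightarrow> nat \<Rightarrow> (int \<times> nat list) list list \<Rightarrow>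
    (nat list \<times> (int \<times> nat list) list) list \<Rightarrow> (nat list \<times> (int \<times> nat list) list) list" where
  "all_split_rows n c A s ch rws =
     foldr (\<lambda>i. split_rows n i c A s ch) (map ((*) 2) [0..<n div 2 + 1]) rws"

text \<open>Equal splits are first merged with their multiplicity, and the successive lowerings of B
  are computed once and shared by all orders i. A chain of length \<open>sum_list B\<close>
  suffices, since no more than that many lowerings are asked for.\<close>

definition comm_terms :: "nat \<Rightarrow> nat list \<Rightarrow> (nat list \<times> (int \<times> nat list) list) list" where
  "comm_terms n T = foldr (\<lambda>(c, A, B). all_split_rows n c A (sum_list A) (lower_chain
      (sum_list B) [(1, B)]))
     (add_terms (map (\<lambda>x. (1, x)) (splits T)) []) []"

lemma length_splits: "(A, B) \<in> set (splits T) \<Longrightarrow> length A + length B = length T"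
  by (induction T arbitrary: A B) auto

text \<open>Differential polynomials of weight \<open>i + 1\<close> are read off at multi-indices of weight \<open>i + 1\<close>,
  so the weight of \<open>M\<close> selects the member of the family.\<close>

definition scaled_coeff :: "(nat \<Rightarrow> jet \<Rightarrow> complex) \<Rightarrow>
    (nat \<Rightarrow> complex) \<Rightarrow> complex \<Rightarrow> nat list \<Rightarrow> complex" where
  "scaled_coeff P s z M = jet_coeff M (P (sum_list M - 1)) z / s (length M)"

section \<open>Correctness of the computed bilinear form\<close>

context
  fixes U :: "complex set" and F G :: "nat \<Rightarrow> jet \<Rightarrow> complex" and z :: complex
  assumes U: "open U" "z \<in> U"
    and F: "\<And>i. diff_poly U (i + 1) (F i)" and G: "\<And>i. diff_poly U (i + 1) (G i)"
    and F_even: "\<And>i u. even i \<Longrightarrow> u 0 \<in> U \<Longrightarrow> F i u = (total_deriv ^^ (i - 2)) (F (min i 2)) u"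
    and F_odd: "\<And>i u. odd i \<Longrightarrow> u 0 \<in> U \<Longrightarrow> F i u = 0"
begin

lemma eval_F:
  assumes "even i" "sum_list L = i + 1 + j"
  shows "eval_terms (\<lambda>M. jet_coeff M (F (sum_list M - 1)) z) ((lower_step ^^ (j + (i - 2))) [(1, L)])
    = jet_coeff L ((total_deriv ^^ j) (F i)) z"
proof -
  have "eval_terms (\<lambda>M. jet_coeff M (F (sum_list M - 1)) z) ((lower_step ^^ (j + (i - 2))) [(1, L)])
      = eval_terms (\<lambda>M. jet_coeff M (F (min i 2)) z) ((lower_step ^^ (j + (i - 2))) [(1, L)])"
  proof (rule eval_terms_cong)
    fix c M assume "(c, M) \<in> set ((lower_step ^^ (j + (i - 2))) [(1, L)])"
    then have "sum_list M + (j + (i - 2)) = i + 1 + j"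
      using sum_length_lower_pow assms(2) by metis
    \<comment> \<open>For i = 0 the number i - 2 is truncated to 0 and the final weight is 1; for
      even i \<ge> 2 it is 3. These are the weights of the order 0 and order 2 parts of F.\<close>
    then have "sum_list M - 1 = min i 2"
      using assms(1) by (cases "i = 0"; cases "i = 1") auto
    then show "jet_coeff M (F (sum_list M - 1)) z = jet_coeff M (F (min i 2)) z" by simp
  qed
  also have "\<dots> = jet_coeff L ((total_deriv ^^ (j + (i - 2))) (F (min i 2))) z"
    by (subst eval_lower_pow[OF U(1) F U(2)]) simp
  also have "\<dots> = jet_coeff L ((total_deriv ^^ j) ((total_deriv ^^ (i - 2)) (F (min i 2)))) z"
    by (simp add: funpow_add)
  also have "\<dots> = jet_coeff L ((total_deriv ^^ j) (F i)) z"
    by (rule jet_coeff_cong[OF U], rule total_deriv_pow_cong[OF U(1)]) (auto simp: F_even[OF assms(1)])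
  finally show ?thesis .
qed

lemma eval_G:
  assumes "sum_list L = i + 1 + j"
  shows "eval_terms (\<lambda>M. jet_coeff M (G (sum_list M - 1)) z) ((lower_step ^^ j) [(1, L)])
    = jet_coeff L ((total_deriv ^^ j) (G i)) z"
proof -
  have "eval_terms (\<lambda>M. jet_coeff M (G (sum_list M - 1)) z) ((lower_step ^^ j) [(1, L)])
      = eval_terms (\<lambda>M. jet_coeff M (G i) z) ((lower_step ^^ j) [(1, L)])"
  proof (rule eval_terms_cong)
    fix c M assume "(c, M) \<in> set ((lower_step ^^ j) [(1, L)])"
    then have "sum_list M - 1 = i" using sum_length_lower_pow assms by fastforce
    then show "jet_coeff M (G (sum_list M - 1)) z = jet_coeff M (G i) z" by simp
  qed
  then show ?thesis by (simp add: eval_lower_pow[OF U(1) G U(2)])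
qed

definition bracket_coeff :: "nat \<Rightarrow> nat \<Rightarrow> nat list \<Rightarrow> nat list \<Rightarrow> complex" where
  "bracket_coeff n i A B =
     (if sum_list A \<le> i + 1 then jet_coeff ((i + 1 - sum_list A) # A) (F i) z
        * jet_coeff B ((total_deriv ^^ (i + 1 - sum_list A)) (G (n - i))) z else 0)
   - (if sum_list A \<le> n - i + 1 then jet_coeff ((n - i + 1 - sum_list A) # A) (G (n - i)) z
        * jet_coeff B ((total_deriv ^^ (n - i + 1 - sum_list A)) (F i)) z else 0)"

context
  fixes s t :: "nat \<Rightarrow> complex" and N :: nat and S :: complex
  assumes st: "\<And>i j. i + j = Suc N \<Longrightarrow> s i * t j = S"
begin

lemma eval_scaled_F:
  assumes "even i" "sum_list L = i + 1 + j"
  shows "eval_terms (scaled_coeff F s z) ((lower_step ^^ (j + (i - 2))) [(1, L)])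
    = jet_coeff L ((total_deriv ^^ j) (F i)) z / s (length L)"
proof -
  have "eval_terms (scaled_coeff F s z) ((lower_step ^^ (j + (i - 2))) [(1, L)])
     = eval_terms (\<lambda>M. jet_coeff M (F (sum_list M - 1)) z / s (length L)) ((lower_step ^^ (j +
         (i - 2))) [(1, L)])"
    by (rule eval_terms_cong) (metis sum_length_lower_pow scaled_coeff_def)
  then show ?thesis by (simp only: eval_terms_divide eval_F[OF assms])
qed

lemma eval_scaled_G:
  assumes "sum_list L = i + 1 + j"
  shows "eval_terms (scaled_coeff G t z) ((lower_step ^^ j) [(1, L)])
    = jet_coeff L ((total_deriv ^^ j) (G i)) z / t (length L)"
proof -
  have "eval_terms (scaled_coeff G t z) ((lower_step ^^ j) [(1, L)])
     = eval_terms (\<lambda>M. jet_coeff M (G (sum_list M - 1)) z / t (length L)) ((lower_step ^^ j) [(1, L)])"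
    by (rule eval_terms_cong) (metis sum_length_lower_pow scaled_coeff_def)
  then show ?thesis by (simp only: eval_terms_divide eval_G[OF assms])
qed

lemma sum_list_sort: "sum_list (sort L) = sum_list (L :: nat list)"
  by (metis mset_sort sum_mset_sum_list)

text \<open>In each product one factor has the multi-index \<open>j # A\<close> and the other a
  lowering of B, so the lengths add up to N + 1 and the scalings multiply to the common factor S.
  Hence the scaled commutator is the true one divided by S.\<close>

lemma eval_split_rows:
  assumes "even i" "i \<le> n" "sum_list A + sum_list B = n + 2" "length A + length B = N"
  shows "eval_rows (scaled_coeff F s z) (scaled_coeff G t z) (split_rows n i c A (sum_list A)
      (lower_chain (sum_list B) [(1, B)]) rws)
    = of_int c * bracket_coeff n i A B / S + eval_rows (scaled_coeff F s z) (scaled_coeff G t z) rws"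
proof -
  define a where "a = sum_list A"
  have S1: "s (Suc (length A)) * t (length B) = S" "s (length B) * t (Suc (length A)) = S"
    using assms(4) by (auto intro: st)
  have 1: "eval_terms (scaled_coeff F s z) (last (lower_chain (i - 2) [(1, sort ((i + 1 - a) # A))]))
        * eval_terms (scaled_coeff G t z) (lower_chain (sum_list B) [(1, B)] ! (i + 1 - a))
      = jet_coeff ((i + 1 - a) # A) (F i) z * jet_coeff B ((total_deriv ^^ (i + 1 - a)) (G
          (n - i))) z / S"
    if "a \<le> i + 1"
  proof -
    have "eval_terms (scaled_coeff F s z) (last (lower_chain (i - 2) [(1, sort ((i + 1 - a) # A))]))
        = jet_coeff (sort ((i + 1 - a) # A)) (F i) z / s (Suc (length A))"
      unfolding last_lower_chain
      using eval_scaled_F[OF assms(1), of "sort ((i + 1 - a) # A)" 0] that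
      by (simp only: sum_list_sort length_sort) (simp add: a_def)
    moreover have "jet_coeff (sort ((i + 1 - a) # A)) (F i) z = jet_coeff ((i + 1 - a) # A) (F i) z"
      by (rule jet_coeff_perm[OF U(1) F U(2)]) simp
    moreover have "eval_terms (scaled_coeff G t z) (lower_chain (sum_list B) [(1, B)] ! (i + 1 - a))
        = jet_coeff B ((total_deriv ^^ (i + 1 - a)) (G (n - i))) z / t (length B)"
    proof -
      have "i + 1 - a \<le> sum_list B" "sum_list B = (n - i) + 1 + (i + 1 - a)"
        using that assms(2,3) a_def by auto
      then show ?thesis by (simp only: lower_chain_nth eval_scaled_G)
    qed
    ultimately show ?thesis using S1(1) by simp
  qed
  have 2: "eval_terms (scaled_coeff F s z) (lower_chain (sum_list B) [(1, B)] ! (n - i + 1 - a +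
      (i - 2)))
        * eval_terms (scaled_coeff G t z) [(1, sort ((n - i + 1 - a) # A))]
      = jet_coeff ((n - i + 1 - a) # A) (G (n - i)) z * jet_coeff B ((total_deriv ^^ (n - i + 1 - a))
          (F i)) z / S"
    if "a \<le> n - i + 1"
  proof -
    have "n - i + 1 - a + (i - 2) \<le> sum_list B" "sum_list B = i + 1 + (n - i + 1 - a)"
      using that assms(2,3) a_def by auto
    then have "eval_terms (scaled_coeff F s z) (lower_chain (sum_list B) [(1, B)] ! (n - i + 1 - a +
        (i - 2)))
        = jet_coeff B ((total_deriv ^^ (n - i + 1 - a)) (F i)) z / s (length B)"
      by (simp only: lower_chain_nth eval_scaled_F[OF assms(1)])
    moreover have "eval_terms (scaled_coeff G t z) [(1, sort ((n - i + 1 - a) # A))]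
        = jet_coeff (sort ((n - i + 1 - a) # A)) (G (n - i)) z / t (Suc (length A))"
      using eval_scaled_G[of "sort ((n - i + 1 - a) # A)" "n - i" 0] that
      by (simp only: sum_list_sort length_sort) (simp add: a_def)
    moreover have "jet_coeff (sort ((n - i + 1 - a) # A)) (G (n - i)) z = jet_coeff ((n - i
        + 1 - a) # A) (G (n - i)) z"
      by (rule jet_coeff_perm[OF U(1) G U(2)]) simp
    ultimately show ?thesis using S1(2) by (simp add: mult.commute)
  qed
  show ?thesis
    unfolding split_rows_def bracket_coeff_def a_def[symmetric] insertion_sort_eq_sort
    using 1 2 by (simp add: eval_add_rows diff_divide_distrib algebra_simps)
qed

lemma eval_comm_terms:
  assumes "even n" "sum_list T = n + 2" "length T = N"
  shows "eval_rows (scaled_coeff F s z) (scaled_coeff G t z) (comm_terms n T)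
    = (\<Sum>(A, B)\<leftarrow>splits T. \<Sum>i\<leftarrow>map ((*) 2) [0..<n div 2 + 1]. bracket_coeff n i A B) / S"
proof -
  define I where "I = map ((*) 2) [0..<n div 2 + 1]"
  have I: "even i \<and> i \<le> n" if "i \<in> set I" for i
    using that assms(1) by (auto simp: I_def)
  define W where "W = (\<lambda>(A, B). (\<Sum>i\<leftarrow>I. bracket_coeff n i A B) / S)"
  have all: "eval_rows (scaled_coeff F s z) (scaled_coeff G t z) (all_split_rows n c A (sum_list A)
      (lower_chain (sum_list B) [(1, B)]) rws)
      = of_int c * W (A, B) + eval_rows (scaled_coeff F s z) (scaled_coeff G t z) rws"
    if "(A, B) \<in> set (splits T)" for c A B rws
  proof -
    have "eval_rows (scaled_coeff F s z) (scaled_coeff G t z) (foldr (\<lambda>i. split_rows n i c A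
        (sum_list A) (lower_chain (sum_list B) [(1, B)])) J rws)
        = of_int c * ((\<Sum>i\<leftarrow>J. bracket_coeff n i A B) / S) + eval_rows (scaled_coeff F s z)
            (scaled_coeff G t z) rws" if "set J \<subseteq> set I" for J
      using that
    proof (induction J)
      case (Cons i J)
      then show ?case
        using I[of i] sum_list_splits[OF \<open>(A, B) \<in> set (splits T)\<close>] length_splits[OF \<open>(A, B) \<in> set
            (splits T)\<close>] assms
        by (simp add: eval_split_rows add_divide_distrib algebra_simps)
    qed simp
    from this[of I] show ?thesis by (simp add: all_split_rows_def I_def W_def)
  qed
  have "eval_rows (scaled_coeff F s z) (scaled_coeff G t z) (foldr (\<lambda>(c, A, B). all_split_rows n c A
      (sum_list A) (lower_chain (sum_list B) [(1, B)])) ts [])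
      = eval_terms W ts" if "snd ` set ts \<subseteq> set (splits T)" for ts
    using that by (induction ts) (auto simp: all)
  moreover have "snd ` set (add_terms (map (\<lambda>x. (1, x)) (splits T)) []) \<subseteq> set (splits T)"
    by (force dest: set_add_terms)
  ultimately have "eval_rows (scaled_coeff F s z) (scaled_coeff G t z) (comm_terms n T) = eval_terms W
      (map (\<lambda>x. (1, x)) (splits T))"
    unfolding comm_terms_def by (simp add: eval_add_terms)
  also have "\<dots> = (\<Sum>x\<leftarrow>splits T. W x)" by (simp add: eval_terms_def comp_def)
  also have "\<dots> = (\<Sum>(A, B)\<leftarrow>splits T. \<Sum>i\<leftarrow>I. bracket_coeff n i A B) / S"
  proof -
    have "(\<Sum>(A, B)\<leftarrow>xs. h A B / S) = (\<Sum>(A, B)\<leftarrow>xs. h A B) / S"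
      for h and xs :: "(nat list \<times> nat list) list"
      by (induction xs) (auto simp: add_divide_distrib)
    then show ?thesis by (simp add: W_def)
  qed
  finally show ?thesis by (simp add: I_def)
qed

end

text \<open>At even n only pairs of even orders survive. The odd part of G may be anything, and it
  never enters the equations.\<close>

lemma bracket_coeff_odd: "odd i \<Longrightarrow> bracket_coeff n i A B = 0"
proof -
  assume i: "odd i"
  have "jet_coeff T (F i) z = jet_coeff T (\<lambda>u. 0) z" for T
    by (rule jet_coeff_cong[OF U]) (rule F_odd[OF i])
  moreover have "jet_coeff T ((total_deriv ^^ j) (F i)) z = jet_coeff T ((total_deriv ^^ j)
      (\<lambda>u. 0)) z" for T j
    by (rule jet_coeff_cong[OF U], rule total_deriv_pow_cong[OF U(1)]) (auto simp: F_odd[OF i])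
  moreover have "(total_deriv ^^ j) (\<lambda>u. 0) = (\<lambda>u. 0)" for j
    by (induction j) (auto simp: total_deriv_def)
  moreover have "jet_coeff T (\<lambda>u. 0) z = 0" for T by (simp add: jet_coeff_def)
  ultimately show ?thesis by (simp add: bracket_coeff_def)
qed

lemma sum_bracket_coeff:
  assumes "commuting_series U F G"
  shows "(\<Sum>(A, B)\<leftarrow>splits T. \<Sum>i\<le>n. bracket_coeff n i A B) = 0"
proof -
  have dp: "diff_poly U (p + q) (evol_deriv Q P)" if "diff_poly U p P" "diff_poly U q Q" for p q P Q
  proof (rule cong[OF diff_poly_sum[of "{..p}" _ _ "\<lambda>j u. (total_deriv ^^ j) Q u * jet_pd j P u"]])
    fix j assume "j \<in> {..p}"
    then show "diff_poly U (p + q) (\<lambda>u. (total_deriv ^^ j) Q u * jet_pd j P u)"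
      using mult[OF diff_poly_total_deriv_pow[OF U(1) that(2), of j] diff_poly_pd[OF U(1) that(1), of j]]
      by (simp add: add.commute)
  qed (auto simp: evol_deriv_eq_sum[OF U(1) that(1)])
  define br where "br = (\<lambda>P p Q A B. if sum_list A \<le> p then jet_coeff ((p - sum_list A) # A) P z
    * jet_coeff B ((total_deriv ^^ (p - sum_list A)) Q) z else 0)"
  have split_sum: "(\<Sum>i\<le>n. \<Sum>(A, B)\<leftarrow>splits T. h i A B) = (\<Sum>(A, B)\<leftarrow>splits T. \<Sum>i\<le>n. h i A B)"
    for h :: "nat \<Rightarrow> nat list \<Rightarrow> nat list \<Rightarrow> complex"
    unfolding case_prod_beta by (rule sum_sum_list_swap)
  have series: "jet_coeff T (series_deriv Q P n) z
      = (\<Sum>(A, B)\<leftarrow>splits T. \<Sum>i\<le>n. br (P i) (i + 1) (Q (n - i)) A B)"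
    if "\<And>i. diff_poly U (i + 1) (P i)" "\<And>i. diff_poly U (i + 1) (Q i)" for P Q
  proof -
    have "jet_coeff T (series_deriv Q P n) z = (\<Sum>i\<le>n. jet_coeff T (evol_deriv (Q (n - i)) (P i)) z)"
      unfolding jet_coeff_def series_deriv_def
    proof (rule jet_pds_sum[OF U(1)])
      fix i assume "i \<in> {..n}"
      then show "diff_poly U (n + 2) (evol_deriv (Q (n - i)) (P i))"
        using dp[OF that(1)[of i] that(2)[of "n - i"]] by simp
    qed (use U in auto)
    also have "\<dots> = (\<Sum>i\<le>n. \<Sum>(A, B)\<leftarrow>splits T. br (P i) (i + 1) (Q (n - i)) A B)"
      unfolding br_def by (intro sum.cong refl jet_coeff_evol_deriv[OF U(1) that(1) that(2) U(2)])
    finally show ?thesis by (simp only: split_sum)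
  qed
  have "jet_coeff T (series_deriv G F n) z = jet_coeff T (series_deriv F G n) z"
    using assms U by (intro jet_coeff_cong) (auto simp: commuting_series_def)
  then have "(\<Sum>(A, B)\<leftarrow>splits T. \<Sum>i\<le>n. br (F i) (i + 1) (G (n - i)) A B)
      = (\<Sum>(A, B)\<leftarrow>splits T. \<Sum>i\<le>n. br (G i) (i + 1) (F (n - i)) A B)"
    using series[of F G] series[of G F] F G by simp
  \<comment> \<open>Reversing the summation pairs the order i of F with the order n - i of G in both
    halves of the commutator.\<close>
  moreover have "(\<Sum>i\<le>n. br (G i) (i + 1) (F (n - i)) A B) = (\<Sum>i\<le>n. br (G (n - i)) (n - i + 1)
      (F i) A B)" for A B
    by (rule sum.reindex_bij_witness[of _ "\<lambda>i. n - i" "\<lambda>i. n - i"]) auto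
  moreover have "bracket_coeff n i A B = br (F i) (i + 1) (G (n - i)) A B - br (G (n - i)) (n - i + 1)
      (F i) A B" for i A B
    by (simp add: bracket_coeff_def br_def)
  moreover have "(\<Sum>(A, B)\<leftarrow>xs. h A B - h' A B) = (\<Sum>(A, B)\<leftarrow>xs. h A B) - (\<Sum>(A, B)\<leftarrow>xs. h' A B)"
    for h h' :: "nat list \<Rightarrow> nat list \<Rightarrow> complex" and xs
    by (induction xs) auto
  ultimately show ?thesis by (simp add: sum_subtractf)
qed

lemma eval_comm_terms_eq_0:
  assumes "commuting_series U F G" "even n" "sum_list T = n + 2"
    "\<And>i j. i + j = Suc (length T) \<Longrightarrow> s i * t j = S"
  shows "eval_rows (scaled_coeff F s z) (scaled_coeff G t z) (comm_terms n T) = 0"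
proof -
  have "(\<Sum>i\<leftarrow>map ((*) 2) [0..<n div 2 + 1]. bracket_coeff n i A B) = (\<Sum>i\<le>n. bracket_coeff n i A B)"
      for A B
  proof -
    have "(\<Sum>i\<leftarrow>map ((*) 2) [0..<n div 2 + 1]. bracket_coeff n i A B) = (\<Sum>j\<in>{0..<n div 2
        + 1}. bracket_coeff n (2 * j) A B)"
      by (simp only: sum_list_distinct_conv_sum_set[OF distinct_upt, symmetric] set_upt[symmetric] map_map comp_def)
    also have "\<dots> = (\<Sum>i\<in>{i. even i \<and> i \<le> n}. bracket_coeff n i A B)"
      by (rule sum.reindex_bij_witness[of _ "\<lambda>i. i div 2" "\<lambda>j. 2 * j"]) auto
    also have "\<dots> = (\<Sum>i\<le>n. bracket_coeff n i A B)"
      using bracket_coeff_odd by (intro sum.mono_neutral_left) auto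
    finally show ?thesis .
  qed
  then show ?thesis
    using eval_comm_terms[OF assms(4) assms(2,3) refl] sum_bracket_coeff[OF assms(1)] by simp
qed

end

section \<open>The equation and its commuting series\<close>

lemma diff_poly_prod_mset: "0 \<notin># M \<Longrightarrow> diff_poly U (\<Sum>\<^sub># M) (\<lambda>u. \<Prod>j\<in>#M. u j)"
proof (induction M)
  case empty
  then show ?case using coeff[of "\<lambda>_. 1" U] by simp
next
  case (add j M)
  then show ?case using mult[OF var[of j U] add.IH] by simp
qed

text \<open>Passes from the normal form by partitions to the inductive closure, which supports
  induction and is stable under all the derivatives used.\<close>

lemma homogeneous_imp_diff_poly:
  assumes "homogeneous_diff_poly U n P"
  shows "diff_poly U n P"
proof -
  obtain c where c: "\<And>M. M \<in> weight_monomials n \<Longrightarrow> c M holomorphic_on U"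
    "\<And>u. u 0 \<in> U \<Longrightarrow> P u = (\<Sum>M\<in>weight_monomials n. c M (u 0) * (\<Prod>j\<in>#M. u j))"
    using assms by (auto simp: homogeneous_diff_poly_def)
  have "diff_poly U n (\<lambda>u. \<Sum>M\<in>weight_monomials n. c M (u 0) * (\<Prod>j\<in>#M. u j))"
  proof (rule diff_poly_sum[OF finite_weight_monomials])
    fix M assume M: "M \<in> weight_monomials n"
    then have "diff_poly U (\<Sum>\<^sub># M) (\<lambda>u. \<Prod>j\<in>#M. u j)"
      by (intro diff_poly_prod_mset) (simp add: weight_monomials_def)
    from mult[OF coeff[OF c(1)[OF M]] this] M
    show "diff_poly U n (\<lambda>u. c M (u 0) * (\<Prod>j\<in>#M. u j))"
      by (simp add: weight_monomials_def)
  qed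
  then show ?thesis by (rule cong) (rule c(2))
qed

lemma total_deriv_add:
  assumes "open U" "diff_poly U n P" "diff_poly U n Q" "u 0 \<in> U"
  shows "total_deriv (\<lambda>u. P u + Q u) u = total_deriv P u + total_deriv Q u"
proof -
  have "jet_pd j (\<lambda>u. P u + Q u) u = jet_pd j P u + jet_pd j Q u" for j
    using assms by (intro jet_pd_add)
  then show ?thesis
    using total_deriv_eq_sum[OF assms(1) add[OF assms(2,3)], of u] total_deriv_eq_sum[OF assms(1,2), of u]
      total_deriv_eq_sum[OF assms(1,3), of u] assms(4)
    by (simp add: sum.distrib algebra_simps)
qed

lemma total_deriv_pow_add:
  assumes "open U" "diff_poly U n P" "diff_poly U n Q" "u 0 \<in> U"
  shows "(total_deriv ^^ j) (\<lambda>u. P u + Q u) u = (total_deriv ^^ j) P u + (total_deriv ^^ j) Q u"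
  using assms(4)
proof (induction j arbitrary: u)
  case (Suc j)
  have "total_deriv ((total_deriv ^^ j) (\<lambda>u. P u + Q u)) u
      = total_deriv (\<lambda>u. (total_deriv ^^ j) P u + (total_deriv ^^ j) Q u) u"
    using assms(1) Suc by (intro total_deriv_cong)
  also have "\<dots> = total_deriv ((total_deriv ^^ j) P) u + total_deriv ((total_deriv ^^ j) Q) u"
    by (rule total_deriv_add[OF assms(1) diff_poly_total_deriv_pow[OF assms(1,2)]
          diff_poly_total_deriv_pow[OF assms(1,3)]]) (rule Suc.prems)
  finally show ?case by simp
qed simp

lemma total_deriv_pow_zero [simp]: "(total_deriv ^^ j) (\<lambda>u. 0) = (\<lambda>u. 0)"
  by (induction j) (auto simp: total_deriv_def)

lemma jet_coeff_add:
  assumes "open U" "diff_poly U n P" "diff_poly U n Q" "z \<in> U"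
  shows "jet_coeff T (\<lambda>u. P u + Q u) z = jet_coeff T P z + jet_coeff T Q z"
  using jet_pds_sum[OF assms(1), of "{True, False}" n "\<lambda>b. if b then P else Q" "base_jet z" T] assms
  by (simp add: jet_coeff_def)

text \<open>A leading \<open>0\<close> in a multi-index is a derivative in \<open>z\<close>, so evaluating it requires the coefficient
  to be the same constant on all of \<open>U\<close>.\<close>

definition known :: "complex set \<Rightarrow> (complex \<Rightarrow> nat list \<Rightarrow> complex) \<Rightarrow> nat list \<Rightarrow> bool" where
  "known U h L \<longleftrightarrow> (\<exists>C. \<forall>z\<in>U. h z L = C)"

lemma knownI: "(\<And>z. z \<in> U \<Longrightarrow> h z L = C) \<Longrightarrow> known U h L"
  by (auto simp: known_def)

named_theorems coeff_table "evaluation of the coefficients of the commutator"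

lemmas [coeff_table] = eval_rows_simps eval_terms_simps of_int_numeral of_int_1 of_int_minus
  list.size of_nat_add of_nat_Suc of_nat_0 of_nat_1
  add_0_left add_0_right diff_0_right mult_zero_left mult_zero_right power_zero_numeral

section \<open>Powers of u on a fixed branch, and homogeneity\<close>

locale log_branch =
  fixes U :: "complex set" and ell :: "complex \<Rightarrow> complex"
  assumes open_U: "open U" and ell_holo: "ell holomorphic_on U"
    and exp_ell: "\<And>z. z \<in> U \<Longrightarrow> exp (ell z) = z"
begin

abbreviation "pw \<equiv> branch_power ell"

lemma pw_nonzero [simp]: "pw a z \<noteq> 0"
  by (simp add: branch_power_def)

lemma pw_add: "pw (a + b) z = pw a z * pw b z"
  by (simp add: branch_power_def algebra_simps exp_add)

lemma pw_minus_1: "z \<in> U \<Longrightarrow> pw (a - 1) z = pw a z / z"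
  using exp_ell[of z] by (simp add: branch_power_def algebra_simps exp_diff)

lemma pw_deriv:
  assumes "z \<in> U"
  shows "(pw a has_field_derivative a * pw (a - 1) z) (at z)"
proof -
  obtain D where D: "(ell has_field_derivative D) (at z)"
    using ell_holo open_U assms by (metis holomorphic_on_imp_differentiable_at field_differentiable_def)
  have z: "z \<noteq> 0" using exp_ell[OF assms] by (metis exp_not_eq_zero)
  \<comment> \<open>The derivative of exp composed with \<open>ell\<close> is computed twice, by the
    chain rule and from exp (ell z) = z, which yields the derivative 1/z of the branch.\<close>
  have "((\<lambda>z. exp (ell z)) has_field_derivative exp (ell z) * D) (at z)"
    using D by (auto intro!: derivative_eq_intros)
  moreover have "((\<lambda>z. exp (ell z)) has_field_derivative 1) (at z)"
    by (rule has_field_derivative_transform_within_open[OF DERIV_ident open_U assms])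
       (simp add: exp_ell)
  ultimately have "exp (ell z) * D = 1" by (rule DERIV_unique)
  then have "z * D = 1" using exp_ell[OF assms] by simp
  then have "D = 1 / z" using z by (simp add: field_simps)
  then have "((\<lambda>z. exp (a * ell z)) has_field_derivative a * (exp (a * ell z) / z)) (at z)"
    using D by (auto intro!: derivative_eq_intros)
  moreover have "a * pw (a - 1) z = a * (exp (a * ell z) / z)"
    unfolding pw_minus_1[OF assms] by (simp add: branch_power_def)
  ultimately show ?thesis by (simp only: branch_power_def[abs_def])
qed

lemma pw_holo: "pw a holomorphic_on U"
  using pw_deriv open_U by (auto simp: holomorphic_on_open)

text \<open>Differentiation in z lowers the exponent by one, and the extra entry 0 lengthens the
  multi-index by one, which lowers the scaling exponent equally. After scaling, only the old
  exponent remains as a factor.\<close>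

lemma scaled_coeff_0_Cons:
  assumes "known U (\<lambda>z. scaled_coeff P (\<lambda>i. C * pw (a - of_nat i) z) z) L" "z \<in> U"
  shows "scaled_coeff P (\<lambda>i. C * pw (a - of_nat i) z) z (0 # L)
    = (a - of_nat (length L)) * scaled_coeff P (\<lambda>i. C * pw (a - of_nat i) z) z L"
\<comment> \<open>For C = 0 both sides are quotients by 0 and hence equal to 0.\<close>
proof (cases "C = 0")
  case False
  let ?e = "a - of_nat (length L)"
  obtain c where c: "\<And>z. z \<in> U \<Longrightarrow> scaled_coeff P (\<lambda>i. C * pw (a - of_nat i) z) z L = c"
    using assms(1) by (auto simp: known_def)
  have jc: "jet_coeff L (P (sum_list L - 1)) z = c * C * pw ?e z" if "z \<in> U" for z
    using c[OF that] False by (simp add: scaled_coeff_def field_simps)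
  have "((\<lambda>z. c * C * pw ?e z) has_field_derivative c * C * (?e * pw (?e - 1) z)) (at z)"
    using pw_deriv[OF assms(2)] by (intro DERIV_cmult)
  then have "(jet_coeff L (P (sum_list L - 1)) has_field_derivative c * C * (?e * pw (?e - 1) z))
      (at z)"
    by (rule has_field_derivative_transform_within_open[OF _ open_U assms(2)])
        (simp add: jc del: One_nat_def)
  then have "jet_coeff (0 # L) (P (sum_list L - 1)) z = c * C * (?e * pw (?e - 1) z)"
    unfolding jet_coeff_0_Cons by (rule DERIV_imp_deriv)
  moreover have "?e - 1 = a - of_nat (length (0 # L))" by simp
  ultimately show ?thesis using c[OF assms(2)] False
    by (simp add: scaled_coeff_def field_simps)
qed (simp add: scaled_coeff_def)

lemma known_0_Cons:
  assumes "known U (\<lambda>z. scaled_coeff P (\<lambda>i. C * pw (a - of_nat i) z) z) L"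
  shows "known U (\<lambda>z. scaled_coeff P (\<lambda>i. C * pw (a - of_nat i) z) z) (0 # L)"
  using scaled_coeff_0_Cons[OF assms] assms unfolding known_def by metis

end

text \<open>The substitution defining \<open>B\<close>, \<open>S\<close>, \<open>D\<close> makes every coefficient found below a polynomial in
  \<open>k\<close>, \<open>B\<close>, \<open>S\<close>, \<open>D\<close>. The series \<open>G\<close> is the one with \<open>\<mu>(u) = u\<^bsup>2k\<^esup>\<close>; by homogeneity its
  coefficient at a multi-index \<open>M\<close> is a constant multiple of \<open>u\<close> to the power \<open>2k + 1 - length M\<close>.\<close>

locale commuting_flows = log_branch +
  fixes \<alpha> \<beta> \<gamma> \<delta> k B S D :: complex and G :: "nat \<Rightarrow> jet \<Rightarrow> complex"
  assumes alpha: "\<alpha> \<noteq> 0" and k: "k \<noteq> 0"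
    and BSD: "\<alpha> + \<beta> = \<alpha> * k * B" "3 * k * \<alpha> + \<gamma> = \<alpha> * k * (S - 3 * B)"
      "\<delta> + k * (k - 1) * \<alpha> = \<alpha> * k * D"
    and formal: "formal_series U (eq_series ell \<alpha> \<beta> \<gamma> \<delta> k)" "formal_series U G"
    and leading: "leading_coeff_is U G (branch_power ell (2 * k))"
    and commuting: "commuting_series U (eq_series ell \<alpha> \<beta> \<gamma> \<delta> k) G"
begin

abbreviation "F \<equiv> eq_series ell \<alpha> \<beta> \<gamma> \<delta> k"
abbreviation "R \<equiv> eq_rhs ell \<alpha> \<beta> \<gamma> \<delta> k"

definition f :: "complex \<Rightarrow> nat list \<Rightarrow> complex" where
  "f z = scaled_coeff F (\<lambda>i. \<alpha> * pw (k + 1 - of_nat i) z) z"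

definition g :: "complex \<Rightarrow> nat list \<Rightarrow> complex" where
  "g z = scaled_coeff G (\<lambda>i. 1 * pw (2 * k + 1 - of_nat i) z) z"

lemma diff_poly_F: "diff_poly U (i + 1) (F i)" and diff_poly_G: "diff_poly U (i + 1) (G i)"
  using formal by (auto intro!: homogeneous_imp_diff_poly simp: formal_series_def)

section \<open>The coefficients of the given series\<close>

lemma R_0: "R 0 = (\<lambda>u. \<alpha> * pw k (u 0) * u 1)"
  and R_2: "R 2 = (\<lambda>u. \<beta> * pw k (u 0) * u 3 + \<gamma> * pw (k - 1) (u 0) * u 1 * u 2 + \<delta> * pw (k - 2) (u 0)
      * u 1 ^ 3)"
  and R_other: "n \<noteq> 0 \<Longrightarrow> n \<noteq> 2 \<Longrightarrow> R n = (\<lambda>u. 0)"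
  by (auto simp: eq_rhs_def fun_eq_iff)

lemma diff_poly_R_0: "diff_poly U 1 (R 0)"
proof -
  have "diff_poly U 0 (\<lambda>u. \<alpha> * pw k (u 0))"
    using pw_holo by (intro coeff holomorphic_intros)
  from mult[OF this var[of 1 U]] show ?thesis by (simp add: R_0)
qed

lemma diff_poly_R_2: "diff_poly U 3 (R 2)"
proof -
  have v: "diff_poly U 1 (\<lambda>u. u 1)" "diff_poly U 2 (\<lambda>u. u 2)" "diff_poly U 3 (\<lambda>u. u 3)"
    by (auto intro: var)
  have c: "diff_poly U 0 (\<lambda>u. C * pw a (u 0))" for a C
    using pw_holo by (intro coeff holomorphic_intros)
  have "diff_poly U (0 + 3) (\<lambda>u. \<beta> * pw k (u 0) * u 3)" by (intro mult c v)
  moreover have "diff_poly U (0 + 1 + 2) (\<lambda>u. \<gamma> * pw (k - 1) (u 0) * u 1 * u 2)" by (intro mult c v)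
  moreover have "diff_poly U (0 + 1 + 1 + 1) (\<lambda>u. \<delta> * pw (k - 2) (u 0) * u 1 * u 1 * u 1)" by
      (intro mult c v)
  ultimately have "diff_poly U 3 (\<lambda>u. \<beta> * pw k (u 0) * u 3 + \<gamma> * pw (k - 1) (u 0) * u 1 * u 2
      + \<delta> * pw (k - 2) (u 0) * u 1 * u 1 * u 1)"
    by (intro add) (simp_all add: eval_nat_numeral)
  then show ?thesis by (rule cong) (simp add: R_2 power3_eq_cube algebra_simps)
qed

lemma F_0: "F 0 = R 0"
  by (simp add: eq_series_def geometric_inverse_def fun_eq_iff)

lemma F_2: "F 2 u = R 2 u + (total_deriv ^^ 2) (R 0) u"
  by (simp add: eq_series_def geometric_inverse_def eval_nat_numeral)

lemma F_odd: "odd i \<Longrightarrow> F i u = 0"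
proof -
  assume "odd i"
  then have "R (i - 2 * m) = (\<lambda>u. 0)" if "m \<le> i div 2" for m
    using that by (intro R_other) presburger+
  then show ?thesis by (simp add: eq_series_def geometric_inverse_def)
qed

lemma F_even:
  assumes "even i" "u 0 \<in> U"
  shows "F i u = (total_deriv ^^ (i - 2)) (F (min i 2)) u"
proof (cases "i = 0")
  case False
  then obtain j where i: "i = 2 * j + 2" using assms(1)
    by (metis add_2_eq_Suc' evenE mult_0_right mult_Suc_right not0_implies_Suc add.commute)
  have "F i u = (\<Sum>m\<le>Suc j. (total_deriv ^^ (2 * m)) (R (i - 2 * m)) u)"
    by (simp add: eq_series_def geometric_inverse_def i)
  \<comment> \<open>Before inversion the right-hand side has only the orders 0 and 2, so only the
    last two terms of the geometric sum survive.\<close>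
  also have "\<dots> = (\<Sum>m\<in>{j, Suc j}. (total_deriv ^^ (2 * m)) (R (i - 2 * m)) u)"
  proof (rule sum.mono_neutral_right)
    show "\<forall>m\<in>{..Suc j} - {j, Suc j}. (total_deriv ^^ (2 * m)) (R (i - 2 * m)) u = 0"
    proof
      fix m assume "m \<in> {..Suc j} - {j, Suc j}"
      then have "R (i - 2 * m) = (\<lambda>u. 0)" using i by (intro R_other) auto
      then show "(total_deriv ^^ (2 * m)) (R (i - 2 * m)) u = 0" by simp
    qed
  qed auto
  also have "\<dots> = (total_deriv ^^ (2 * j)) (R 2) u + (total_deriv ^^ (2 * j + 2)) (R 0) u"
    by (simp add: i)
  also have "\<dots> = (total_deriv ^^ (2 * j)) (R 2) u + (total_deriv ^^ (2 * j)) ((total_deriv ^^ 2)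
      (R 0)) u"
    by (simp only: funpow_add comp_def)
  also have "\<dots> = (total_deriv ^^ (2 * j)) (\<lambda>u. R 2 u + (total_deriv ^^ 2) (R 0) u) u"
    by (rule total_deriv_pow_add[OF open_U diff_poly_R_2, symmetric])
       (use diff_poly_total_deriv_pow[OF open_U diff_poly_R_0, of 2] assms in \<open>auto simp: numeral_eq_Suc\<close>)
  also have "\<dots> = (total_deriv ^^ (i - 2)) (F (min i 2)) u"
  proof -
    have "i - 2 = 2 * j" "min i 2 = 2" using i by auto
    then show ?thesis by (simp only: F_2[abs_def])
  qed
  finally show ?thesis .
qed simp

lemma comm_eq:
  assumes "z \<in> U" "even n" "sum_list T = n + 2"
  shows "eval_rows (f z) (g z) (comm_terms n T) = 0"
  unfolding f_def g_def
proof (rule eval_comm_terms_eq_0[OF open_U assms(1) diff_poly_F diff_poly_G F_even F_odd commuting assms(2,3)])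
  fix i j assume "i + j = Suc (length T)"
  then have "pw (k + 1 - of_nat i + (2 * k + 1 - of_nat j)) z = pw (3 * k + 2 - of_nat (Suc
      (length T))) z"
    by (intro arg_cong[of _ _ "\<lambda>a. pw a z"]) (simp add: algebra_simps flip: of_nat_add of_nat_Suc)
  then show "\<alpha> * pw (k + 1 - of_nat i) z * (1 * pw (2 * k + 1 - of_nat j) z)
      = \<alpha> * pw (3 * k + 2 - of_nat (Suc (length T))) z"
    by (simp only: pw_add[symmetric] mult_1 mult.assoc)
qed

lemma f_0_Cons: "known U f L \<Longrightarrow> z \<in> U \<Longrightarrow> f z (0 # L) = (k + 1 - of_nat (length L)) * f z L"
  unfolding f_def[abs_def] by (rule scaled_coeff_0_Cons)

lemma g_0_Cons: "known U g L \<Longrightarrow> z \<in> U \<Longrightarrow> g z (0 # L) = (2 * k + 1 - of_nat (length L)) * g z L"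
  unfolding g_def[abs_def] by (rule scaled_coeff_0_Cons)

lemma known_f_0_Cons: "known U f L \<Longrightarrow> known U f (0 # L)"
  unfolding f_def[abs_def] by (rule known_0_Cons)

lemma known_g_0_Cons: "known U g L \<Longrightarrow> known U g (0 # L)"
  unfolding g_def[abs_def] by (rule known_0_Cons)

lemma g_1: "z \<in> U \<Longrightarrow> g z [1] = 1"
proof -
  assume z: "z \<in> U"
  have "jet_coeff [1] (G 0) z = jet_coeff [1] (\<lambda>u. pw (2 * k) (u 0) * u 1) z"
    using leading by (intro jet_coeff_cong[OF open_U z]) (auto simp: leading_coeff_is_def)
  also have "\<dots> = pw (2 * k) z" by (simp add: jet_coeff_def jet_pd_def)
  finally show ?thesis by (simp add: g_def scaled_coeff_def)
qed

lemma f_1: "z \<in> U \<Longrightarrow> f z [1] = 1"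
proof -
  assume z: "z \<in> U"
  have "jet_coeff [1] (F 0) z = \<alpha> * pw k z" by (simp add: F_0 R_0 jet_coeff_def jet_pd_def)
  then show ?thesis using alpha by (simp add: f_def scaled_coeff_def)
qed

lemma jet_coeff_F_2:
  assumes "z \<in> U"
  shows "jet_coeff L (F 2) z
    = jet_coeff L (R 2) z + (\<Sum>M\<leftarrow>lowers L. \<Sum>N\<leftarrow>lowers M. jet_coeff N (R 0) z)"
proof -
  have "diff_poly U 3 ((total_deriv ^^ 2) (R 0))"
    using diff_poly_total_deriv_pow[OF open_U diff_poly_R_0, of 2] by (simp add: numeral_eq_Suc)
  then have "jet_coeff L (F 2) z = jet_coeff L (R 2) z + jet_coeff L (total_deriv (total_deriv
      (R 0))) z"
  proof -
    have "total_deriv ^^ 2 = total_deriv \<circ> total_deriv" by (simp add: numeral_2_eq_2)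
    moreover have "F 2 = (\<lambda>u. R 2 u + (total_deriv ^^ 2) (R 0) u)" by (simp add: F_2 fun_eq_iff)
    ultimately show ?thesis
      using jet_coeff_add[OF open_U diff_poly_R_2 \<open>diff_poly U 3 ((total_deriv ^^ 2) (R 0))\<close> assms]
      by (simp only: comp_def)
  qed
  also have "jet_coeff L (total_deriv (total_deriv (R 0))) z = (\<Sum>M\<leftarrow>lowers L. \<Sum>N\<leftarrow>lowers M. jet_coeff N
      (R 0) z)"
    by (simp only: jet_coeff_total_deriv[OF open_U diff_poly_total_deriv[OF open_U diff_poly_R_0] assms]
        jet_coeff_total_deriv[OF open_U diff_poly_R_0 assms])
  finally show ?thesis .
qed

lemma deriv_pw: "z \<in> U \<Longrightarrow> deriv (\<lambda>z. C * pw a z) z = C * (a * pw (a - 1) z)"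
  by (intro DERIV_imp_deriv DERIV_cmult pw_deriv)

lemma jet_coeff_R_0:
  assumes "z \<in> U"
  shows "jet_coeff [1] (R 0) z = \<alpha> * pw k z" "jet_coeff [0, 1] (R 0) z = \<alpha> * k * pw (k - 1) z"
    "jet_coeff [0, 0, 1] (R 0) z = \<alpha> * k * (k - 1) * pw (k - 2) z"
proof -
  have 1: "jet_coeff [1] (R 0) = (\<lambda>z. \<alpha> * pw k z)"
    by (simp add: R_0 jet_coeff_def jet_pd_def fun_eq_iff)
  have 2: "jet_coeff [0, 1] (R 0) z = \<alpha> * k * pw (k - 1) z" if "z \<in> U" for z
    using that by (simp add: jet_coeff_0_Cons 1 deriv_pw del: One_nat_def)
  have "deriv (jet_coeff [0, 1] (R 0)) z = deriv (\<lambda>z. \<alpha> * k * pw (k - 1) z) z"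
    using assms open_U by (intro deriv_cong_ev)
        (auto simp: 2 eventually_nhds simp del: One_nat_def intro!: exI[of _ U])
  then show "jet_coeff [1] (R 0) z = \<alpha> * pw k z" "jet_coeff [0, 1] (R 0) z = \<alpha> * k * pw (k - 1) z"
    "jet_coeff [0, 0, 1] (R 0) z = \<alpha> * k * (k - 1) * pw (k - 2) z"
    using assms by (simp_all add: jet_coeff_0_Cons[of "[0, 1]"] deriv_pw 1 2 del: One_nat_def)
qed

lemma jet_coeff_R_2:
  "jet_coeff [3] (R 2) z = \<beta> * pw k z" "jet_coeff [1, 2] (R 2) z = \<gamma> * pw (k - 1) z"
  "jet_coeff [1, 1, 1] (R 2) z = 6 * \<delta> * pw (k - 2) z"
proof -
  have p3: "jet_pd 3 (R 2) = (\<lambda>u. \<beta> * pw k (u 0))"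
    by (auto simp: R_2 jet_pd_def fun_eq_iff intro!: DERIV_imp_deriv derivative_eq_intros)
  have p2: "jet_pd 2 (R 2) = (\<lambda>u. \<gamma> * pw (k - 1) (u 0) * u 1)"
    by (auto simp: R_2 jet_pd_def fun_eq_iff intro!: DERIV_imp_deriv derivative_eq_intros)
  have p12: "jet_pd 1 (\<lambda>u. \<gamma> * pw (k - 1) (u 0) * u 1) = (\<lambda>u. \<gamma> * pw (k - 1) (u 0))"
    by (auto simp: jet_pd_def fun_eq_iff intro!: DERIV_imp_deriv derivative_eq_intros)
  have p1: "jet_pd 1 (R 2) = (\<lambda>u. \<gamma> * pw (k - 1) (u 0) * u 2 + 3 * \<delta> * pw (k - 2) (u 0) * u 1 ^ 2)"
    by (auto simp: R_2 jet_pd_def fun_eq_iff intro!: DERIV_imp_deriv derivative_eq_intros)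
  have p11: "jet_pd 1 (\<lambda>u. \<gamma> * pw (k - 1) (u 0) * u 2 + 3 * \<delta> * pw (k - 2) (u 0) * u 1 ^ 2)
      = (\<lambda>u. 6 * \<delta> * pw (k - 2) (u 0) * u 1)"
    by (auto simp: jet_pd_def fun_eq_iff intro!: DERIV_imp_deriv derivative_eq_intros)
  have p111: "jet_pd 1 (\<lambda>u. 6 * \<delta> * pw (k - 2) (u 0) * u 1) = (\<lambda>u. 6 * \<delta> * pw (k - 2) (u 0))"
    by (auto simp: jet_pd_def fun_eq_iff intro!: DERIV_imp_deriv derivative_eq_intros)
  show "jet_coeff [3] (R 2) z = \<beta> * pw k z" "jet_coeff [1, 2] (R 2) z = \<gamma> * pw (k - 1) z"
    "jet_coeff [1, 1, 1] (R 2) z = 6 * \<delta> * pw (k - 2) z"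
    unfolding jet_coeff_def jet_pds.simps p1 p2 p3 p11 p12 p111 by simp_all
qed

text \<open>All coefficients of the given series reduce to these three and \<open>f_1\<close>. The
  factor 6 is the third derivative of u_1^3.\<close>

lemma f_3: "z \<in> U \<Longrightarrow> f z [3] = k * B"
  and f_12: "z \<in> U \<Longrightarrow> f z [1, 2] = k * (S - 3 * B)"
  and f_111: "z \<in> U \<Longrightarrow> f z [1, 1, 1] = 6 * k * D"
proof -
  assume z: "z \<in> U"
  have perm: "jet_coeff [1, 0] (R 0) z = jet_coeff [0, 1] (R 0) z"
    "jet_coeff [0, 1, 0] (R 0) z = jet_coeff [0, 0, 1] (R 0) z"
    "jet_coeff [1, 0, 0] (R 0) z = jet_coeff [0, 0, 1] (R 0) z"
    by (rule jet_coeff_perm[OF open_U diff_poly_R_0 z]; simp)+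
  have lowers: "lowers [3] = [[2]]" "lowers [2] = [[1]]" "lowers [1, 2] = [[0, 2], [1, 1]]"
    "lowers [0, 2] = [[0, 1]]" "lowers [1, 1] = [[0, 1], [1, 0]]"
    "lowers [1, 1, 1] = [[0, 1, 1], [1, 0, 1], [1, 1, 0]]" "lowers [0, 1, 1] = [[0, 0, 1], [0, 1, 0]]"
    "lowers [1, 0, 1] = [[0, 0, 1], [1, 0, 0]]" "lowers [1, 1, 0] = [[0, 1, 0], [1, 0, 0]]"
    by simp_all
  note rules = jet_coeff_F_2[OF z] jet_coeff_R_2 lowers perm jet_coeff_R_0[OF z] list.map sum_list.Cons sum_list.Nil
  have 3: "jet_coeff [3] (F 2) z = (\<alpha> + \<beta>) * pw k z"
    unfolding rules by (simp add: algebra_simps)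
  have 12: "jet_coeff [1, 2] (F 2) z = (3 * k * \<alpha> + \<gamma>) * pw (k - 1) z"
    unfolding rules by (simp add: algebra_simps)
  have 111: "jet_coeff [1, 1, 1] (F 2) z = 6 * (\<delta> + k * (k - 1) * \<alpha>) * pw (k - 2) z"
    unfolding rules by (simp add: algebra_simps)
  have sums: "sum_list [3] - 1 = (2::nat)" "sum_list [1, 2] - 1 = (2::nat)" "sum_list [1, 1, 1] - 1 =
      (2::nat)"
    by simp_all
  show "f z [3] = k * B" "f z [1, 2] = k * (S - 3 * B)" "f z [1, 1, 1] = 6 * k * D"
    unfolding f_def scaled_coeff_def sums 3 12 111 BSD using alpha by simp_all
qed

lemma comm_eqD:
  assumes "z \<in> U" "even n" "sum_list T = n + 2" "comm_terms n T = rws"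
    "eval_rows (f z) (g z) rws = e" "e = x"
  shows "x = 0"
  using comm_eq[OF assms(1-3)] assms(4-6) by simp

text \<open>Here x is the unknown coefficient at M and T is \<open>1 # M\<close>. Along \<lambda>(u)
  u_1, the monomial of M acquires \<lambda>'(u) u_1 times e, where e is the sum of j + 1 over the
  entries j \<ge> 2 of M, plus the number of entries 1, minus 1. The constant is c = -m e, where m
  is the number of entries 1 in T, from differentiating u_1^m. The factor k is the scaled
  \<lambda>'(u). Only M = [1] has e = 0, which is why \<mu> is free and must be prescribed by
  \<open>g_1\<close>.\<close>

lemma solve_comm_eq:
  assumes "z \<in> U" "even n" "sum_list T = n + 2" "c \<noteq> 0" "comm_terms n T = rws"
    "eval_rows (f z) (g z) rws = e" "e = c * k * (x - y)"
  shows "x = y"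
  using comm_eqD[OF assms(1-3,5-7)] assms(4) k by simp

lemma known_f: "known U f [1]" "known U f [3]" "known U f [1, 2]" "known U f [1, 1, 1]"
  using f_1 f_3 f_12 f_111 by (blast intro: knownI)+

lemma known_g_1: "known U g [1]"
  by (rule knownI) (rule g_1)

lemmas [coeff_table] = f_1 f_3 f_12 f_111 g_1 f_0_Cons g_0_Cons known_f known_g_1
  known_f_0_Cons known_g_0_Cons

end

text \<open>The vanishing parameter is a rewrite rule of the table, so every value found for
  arbitrary B is specialised when it is used and the polynomials stay short.\<close>

locale commuting_flows_B0 = commuting_flows +
  assumes B_eq_0 [coeff_table]: "B = 0"

locale commuting_flows_S0 = commuting_flows_B0 +
  assumes S_eq_0 [coeff_table]: "S = 0"

section \<open>Coefficients and obstructions for arbitrary \<open>B\<close>\<close>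

text \<open>The right-hand sides were found with computer algebra, by solving the equations at \<open>1 # M\<close>
  successively.\<close>

context commuting_flows
begin

text \<open>Within one power of \<epsilon> the system is triangular. Besides M, the equation at
  \<open>1 # M\<close> involves only shorter multi-indices and those of equal length with one more
  entry 1, which arise by merging entries a, b \<ge> 2 into a + b - 1. Every solved value enters the
  table together with its \<open>known\<close> fact, so that its z-derivatives can be evaluated
  too.\<close>

lemma g_3 [coeff_table]:
  assumes "z \<in> U"
  shows "g z [3] = 2 * k * B"
  by (rule solve_comm_eq[OF assms, of 2 "[1, 3]" "- 3"], simp, simp, simp)
    (code_simp, simp only: coeff_table assms, algebra)

lemmas known_g_3 [coeff_table] = knownI[of U g, OF g_3]

lemma g_5 [coeff_table]:
  assumes "z \<in> U"
  shows "g z [5] = 6/5 * k^2 * B^2 + 2 * k * B"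
  by (rule solve_comm_eq[OF assms, of 4 "[1, 5]" "- 5"], simp, simp, simp)
    (code_simp, simp only: coeff_table assms, algebra)

lemmas known_g_5 [coeff_table] = knownI[of U g, OF g_5]

lemma g_7 [coeff_table]:
  assumes "z \<in> U"
  shows "g z [7] = 6/35 * k^3 * B^3 + 16/7 * k^2 * B^2 + 2 * k * B"
  by (rule solve_comm_eq[OF assms, of 6 "[1, 7]" "- 7"], simp, simp, simp)
    (code_simp, simp only: coeff_table assms, algebra)

lemmas known_g_7 [coeff_table] = knownI[of U g, OF g_7]

lemma g_9 [coeff_table]:
  assumes "z \<in> U"
  shows "g z [9] = -2/105 * k^4 * B^4 + 26/63 * k^3 * B^3 + 10/3 * k^2 * B^2 + 2 * k * B"
  by (rule solve_comm_eq[OF assms, of 8 "[1, 9]" "- 9"], simp, simp, simp)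
    (code_simp, simp only: coeff_table assms, algebra)

lemmas known_g_9 [coeff_table] = knownI[of U g, OF g_9]

lemma g_1_2 [coeff_table]:
  assumes "z \<in> U"
  shows "g z [1, 2] = 4 * k^2 * B - 6 * k * B + 2 * k * S"
  by (rule solve_comm_eq[OF assms, of 2 "[1, 1, 2]" "- 6"], simp, simp, simp)
    (code_simp, simp only: coeff_table assms, algebra)

lemmas known_g_1_2 [coeff_table] = knownI[of U g, OF g_1_2]

lemma g_1_4 [coeff_table]:
  assumes "z \<in> U"
  shows "g z [1, 4] = 
      16/5 * k^3 * B^2 - 6 * k^2 * B^2 + 2 * k^2 * B * S + 10 * k^2 * B - 6 * k * B + 2 * k * S"
  by (rule solve_comm_eq[OF assms, of 4 "[1, 1, 4]" "- 10"], simp, simp, simp)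
    (code_simp, simp only: coeff_table assms, algebra)

lemmas known_g_1_4 [coeff_table] = knownI[of U g, OF g_1_4]

lemma g_1_6 [coeff_table]:
  assumes "z \<in> U"
  shows "g z [1, 6] = 
      4/7 * k^4 * B^3 - 6/5 * k^3 * B^3 + 2/5 * k^3 * B^2 * S + 86/7 * k^3 * B^2 - 12 * k^2 * B^2
      + 4 * k^2 * B * S + 16 * k^2 * B - 6 * k * B + 2 * k * S"
  by (rule solve_comm_eq[OF assms, of 6 "[1, 1, 6]" "- 14"], simp, simp, simp)
    (code_simp, simp only: coeff_table assms, algebra)

lemmas known_g_1_6 [coeff_table] = knownI[of U g, OF g_1_6]

lemma g_1_1_1 [coeff_table]:
  assumes "z \<in> U"
  shows "g z [1, 1, 1] = 6 * k^3 * B - 24 * k^2 * B + 6 * k^2 * S + 12 * k * D"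
  by (rule solve_comm_eq[OF assms, of 2 "[1, 1, 1, 1]" "- 8"], simp, simp, simp)
    (code_simp, simp only: coeff_table assms, algebra)

lemmas known_g_1_1_1 [coeff_table] = knownI[of U g, OF g_1_1_1]

lemma g_2_3 [coeff_table]:
  assumes "z \<in> U"
  shows "g z [2, 3] = 
      4 * k^3 * B^2 - 12 * k^2 * B^2 + 4 * k^2 * B * S + 12 * k^2 * B - 18 * k * B + 6 * k * S"
  by (rule solve_comm_eq[OF assms, of 4 "[1, 2, 3]" "- 6"], simp, simp, simp)
    (code_simp, simp only: coeff_table assms, algebra)

lemmas known_g_2_3 [coeff_table] = knownI[of U g, OF g_2_3]

lemma g_1_1_3 [coeff_table]:
  assumes "z \<in> U"
  shows "g z [1, 1, 3] = 
      28/5 * k^4 * B^2 - 168/5 * k^3 * B^2 + 48/5 * k^3 * B * S + 204/5 * k^3 * B +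
      152/5 * k^2 * B^2 - 76/5 * k^2 * B * S + 44/5 * k^2 * B * D - 396/5 * k^2 * B +
      8/5 * k^2 * S^2 + 92/5 * k^2 * S + 24 * k * B - 8 * k * S + 12 * k * D"
  by (rule solve_comm_eq[OF assms, of 4 "[1, 1, 1, 3]" "- 15"], simp, simp, simp)
    (code_simp, simp only: coeff_table assms, algebra)

lemmas known_g_1_1_3 [coeff_table] = knownI[of U g, OF g_1_1_3]

lemma g_2_5 [coeff_table]:
  assumes "z \<in> U"
  shows "g z [2, 5] = 
      3/5 * k^4 * B^3 - 18/5 * k^3 * B^3 + 13/10 * k^3 * B^2 * S + 203/10 * k^3 * B^2 +
      12/5 * k^2 * B^3 - 6/5 * k^2 * B^2 * S - 6/5 * k^2 * B^2 * D - 206/5 * k^2 * B^2 +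
      1/10 * k^2 * B * S^2 + 139/10 * k^2 * B * S + 33 * k^2 * B - 30 * k * B + 10 * k * S"
  by (rule solve_comm_eq[OF assms, of 6 "[1, 2, 5]" "- 8"], simp, simp, simp)
    (code_simp, simp only: coeff_table assms, algebra)

lemmas known_g_2_5 [coeff_table] = knownI[of U g, OF g_2_5]

lemma g_1_8 [coeff_table]:
  assumes "z \<in> U"
  shows "g z [1, 8] = 
      -8/105 * k^5 * B^4 + 6/35 * k^4 * B^4 - 2/35 * k^4 * B^3 * S + 814/315 * k^4 * B^3 -
      102/35 * k^3 * B^3 + 34/35 * k^3 * B^2 * S + 82/3 * k^3 * B^2 - 18 * k^2 * B^2 +
      6 * k^2 * B * S + 22 * k^2 * B - 6 * k * B + 2 * k * S"
  by (rule solve_comm_eq[OF assms, of 8 "[1, 1, 8]" "- 18"], simp, simp, simp)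
    (code_simp, simp only: coeff_table assms, algebra)

lemmas known_g_1_8 [coeff_table] = knownI[of U g, OF g_1_8]

lemma g_1_1_5 [coeff_table]:
  assumes "z \<in> U"
  shows "g z [1, 1, 5] = 
      6/7 * k^5 * B^3 - 282/35 * k^4 * B^3 + 19/7 * k^4 * B^2 * S + 1909/35 * k^4 * B^2 +
      96/7 * k^3 * B^3 - 247/35 * k^3 * B^2 * S + 12/35 * k^3 * B^2 * D - 5437/35 * k^3 * B^2 +
      23/35 * k^3 * B * S^2 + 1377/35 * k^3 * B * S + 822/7 * k^3 * B - 24/5 * k^2 * B^3 +
      12/5 * k^2 * B^2 * S + 12/5 * k^2 * B^2 * D + 3284/35 * k^2 * B^2 - 1/5 * k^2 * B * S^2 -
      1473/35 * k^2 * B * S + 20 * k^2 * B * D - 1110/7 * k^2 * B + 24/7 * k^2 * S^2 +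
      216/7 * k^2 * S + 48 * k * B - 16 * k * S + 12 * k * D"
  by (rule solve_comm_eq[OF assms, of 6 "[1, 1, 1, 5]" "- 21"], simp, simp, simp)
    (code_simp, simp only: coeff_table assms, algebra)

lemmas known_g_1_1_5 [coeff_table] = knownI[of U g, OF g_1_1_5]

lemma g_1_2_2 [coeff_table]:
  assumes "z \<in> U"
  shows "g z [1, 2, 2] = 
      26/5 * k^4 * B^2 - 216/5 * k^3 * B^2 + 66/5 * k^3 * B * S + 228/5 * k^3 * B +
      304/5 * k^2 * B^2 - 152/5 * k^2 * B * S + 28/5 * k^2 * B * D - 582/5 * k^2 * B +
      16/5 * k^2 * S^2 + 144/5 * k^2 * S + 36 * k * B - 12 * k * S + 24 * k * D"
  by (rule solve_comm_eq[OF assms, of 4 "[1, 1, 2, 2]" "- 12"], simp, simp, simp)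
    (code_simp, simp only: coeff_table assms, algebra)

lemmas known_g_1_2_2 [coeff_table] = knownI[of U g, OF g_1_2_2]

lemma g_3_4 [coeff_table]:
  assumes "z \<in> U"
  shows "g z [3, 4] = 
      1/5 * k^4 * B^3 - 6 * k^3 * B^3 + 23/10 * k^3 * B^2 * S + 249/10 * k^3 * B^2 +
      36/5 * k^2 * B^3 - 18/5 * k^2 * B^2 * S - 18/5 * k^2 * B^2 * D - 348/5 * k^2 * B^2 +
      3/10 * k^2 * B * S^2 + 237/10 * k^2 * B * S + 45 * k^2 * B - 60 * k * B + 20 * k * S"
  by (rule solve_comm_eq[OF assms, of 6 "[1, 3, 4]" "- 8"], simp, simp, simp)
    (code_simp, simp only: coeff_table assms, algebra)

lemmas known_g_3_4 [coeff_table] = knownI[of U g, OF g_3_4]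

lemma g_1_1_1_2 [coeff_table]:
  assumes "z \<in> U"
  shows "g z [1, 1, 1, 2] = 
      24/5 * k^5 * B^2 - 408/5 * k^4 * B^2 + 24 * k^4 * B * S + 732/5 * k^4 * B +
      1416/5 * k^3 * B^2 - 132 * k^3 * B * S + 168/5 * k^3 * B * D - 540 * k^3 * B +
      12 * k^3 * S^2 + 456/5 * k^3 * S - 1032/5 * k^2 * B^2 + 108 * k^2 * B * S -
      564/5 * k^2 * B * D + 2328/5 * k^2 * B - 12 * k^2 * S^2 + 108/5 * k^2 * S * D -
      576/5 * k^2 * S + 156 * k^2 * D - 72 * k * B + 24 * k * S - 168 * k * D"
  by (rule solve_comm_eq[OF assms, of 4 "[1, 1, 1, 1, 2]" "- 20"], simp, simp, simp)
    (code_simp, simp only: coeff_table assms, algebra)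

lemmas known_g_1_1_1_2 [coeff_table] = knownI[of U g, OF g_1_1_1_2]

lemma g_1_2_4 [coeff_table]:
  assumes "z \<in> U"
  shows "g z [1, 2, 4] = 
      -29/35 * k^5 * B^3 - 426/35 * k^4 * B^3 + 79/14 * k^4 * B^2 * S + 5161/70 * k^4 * B^2 +
      1664/35 * k^3 * B^3 - 881/35 * k^3 * B^2 * S - 202/35 * k^3 * B^2 * D - 11152/35 * k^3 * B^2
      + 83/35 * k^3 * B * S^2 + 6239/70 * k^3 * B * S + 3021/14 * k^3 * B - 168/5 * k^2 * B^3 +
      98/5 * k^2 * B^2 * S + 84/5 * k^2 * B^2 * D + 1878/7 * k^2 * B^2 - 14/5 * k^2 * B * S^2 -
      7/5 * k^2 * B * S * D - 8649/70 * k^2 * B * S + 45 * k^2 * B * D - 5673/14 * k^2 * B +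
      1/10 * k^2 * S^3 + 374/35 * k^2 * S^2 + 1289/14 * k^2 * S + 138 * k * B - 46 * k * S +
      48 * k * D"
  by (rule solve_comm_eq[OF assms, of 6 "[1, 1, 2, 4]" "- 16"], simp, simp, simp)
    (code_simp, simp only: coeff_table assms, algebra)

lemmas known_g_1_2_4 [coeff_table] = knownI[of U g, OF g_1_2_4]

lemma g_3_6 [coeff_table]:
  assumes "z \<in> U"
  shows "g z [3, 6] = 
      -129/350 * k^5 * B^4 + 103/50 * k^4 * B^4 + 61/700 * k^4 * B^3 * S + 3217/420 * k^4 * B^3 +
      2082/175 * k^3 * B^4 - 4647/700 * k^3 * B^3 * S - 1041/175 * k^3 * B^3 * D -
      69301/2100 * k^3 * B^3 + 89/175 * k^3 * B^2 * S^2 + 331/28 * k^3 * B^2 * S +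
      14583/140 * k^3 * B^2 - 414/25 * k^2 * B^4 + 48/5 * k^2 * B^3 * S + 207/25 * k^2 * B^3 * D +
      3212/175 * k^2 * B^3 - 27/20 * k^2 * B^2 * S^2 - 33/50 * k^2 * B^2 * S * D -
      3753/350 * k^2 * B^2 * S - 121/10 * k^2 * B^2 * D - 31029/140 * k^2 * B^2 +
      1/20 * k^2 * B * S^3 + 71/70 * k^2 * B * S^2 + 10567/140 * k^2 * B * S + 126 * k^2 * B -
      126 * k * B + 42 * k * S"
  by (rule solve_comm_eq[OF assms, of 8 "[1, 3, 6]" "- 10"], simp, simp, simp)
    (code_simp, simp only: coeff_table assms, algebra)

lemmas known_g_3_6 [coeff_table] = knownI[of U g, OF g_3_6]

lemma g_2_7 [coeff_table]:
  assumes "z \<in> U"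
  shows "g z [2, 7] = 
      -51/350 * k^5 * B^4 + 261/350 * k^4 * B^4 - 87/700 * k^4 * B^3 * S + 3459/700 * k^4 * B^3 +
      258/175 * k^3 * B^4 - 579/700 * k^3 * B^3 * S - 129/175 * k^3 * B^3 * D - 373/28 * k^3 * B^3
      + 33/700 * k^3 * B^2 * S^2 + 3247/700 * k^3 * B^2 * S + 4601/70 * k^3 * B^2 -
      54/25 * k^2 * B^4 + 27/25 * k^2 * B^3 * S + 27/25 * k^2 * B^3 * D + 824/175 * k^2 * B^3 -
      9/100 * k^2 * B^2 * S^2 - 1817/700 * k^2 * B^2 * S - 14/5 * k^2 * B^2 * D -
      6151/70 * k^2 * B^2 + 8/35 * k^2 * B * S^2 + 1038/35 * k^2 * B * S + 66 * k^2 * B -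
      42 * k * B + 14 * k * S"
  by (rule solve_comm_eq[OF assms, of 8 "[1, 2, 7]" "- 10"], simp, simp, simp)
    (code_simp, simp only: coeff_table assms, algebra)

lemmas known_g_2_7 [coeff_table] = knownI[of U g, OF g_2_7]

lemma g_11 [coeff_table]:
  assumes "z \<in> U"
  shows "g z [11] = 
      2/385 * k^5 * B^5 - 76/1155 * k^4 * B^4 + 268/385 * k^3 * B^3 + 48/11 * k^2 * B^2 +
      2 * k * B"
  by (rule solve_comm_eq[OF assms, of 10 "[1, 11]" "- 11"], simp, simp, simp)
    (code_simp, simp only: coeff_table assms, algebra)

lemmas known_g_11 [coeff_table] = knownI[of U g, OF g_11]

lemma g_1_10 [coeff_table]:
  assumes "z \<in> U"
  shows "g z [1, 10] = 
      4/165 * k^6 * B^5 - 2/35 * k^5 * B^5 + 2/105 * k^5 * B^4 * S - 218/495 * k^5 * B^4 +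
      64/105 * k^4 * B^4 - 64/315 * k^4 * B^3 * S + 1064/165 * k^4 * B^3 - 172/35 * k^3 * B^3 +
      172/105 * k^3 * B^2 * S + 532/11 * k^3 * B^2 - 24 * k^2 * B^2 + 8 * k^2 * B * S +
      28 * k^2 * B - 6 * k * B + 2 * k * S"
  by (rule solve_comm_eq[OF assms, of 10 "[1, 1, 10]" "- 22"], simp, simp, simp)
    (code_simp, simp only: coeff_table assms, algebra)

lemmas known_g_1_10 [coeff_table] = knownI[of U g, OF g_1_10]

lemma g_1_1_7 [coeff_table]:
  assumes "z \<in> U"
  shows "g z [1, 1, 7] = 
      -37/225 * k^6 * B^4 + 262/175 * k^5 * B^4 - 401/1050 * k^5 * B^3 * S +
      113413/9450 * k^5 * B^3 - 607/315 * k^4 * B^4 + 129/175 * k^4 * B^3 * S -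
      78/175 * k^4 * B^3 * D - 22741/525 * k^4 * B^3 - 121/1050 * k^4 * B^2 * S^2 +
      37963/3150 * k^4 * B^2 * S + 12569/63 * k^4 * B^2 - 432/175 * k^3 * B^4 +
      283/210 * k^3 * B^3 * S + 216/175 * k^3 * B^3 * D + 379877/9450 * k^3 * B^3 -
      13/175 * k^3 * B^2 * S^2 - 30203/1575 * k^3 * B^2 * S + 584/315 * k^3 * B^2 * D -
      127342/315 * k^3 * B^2 + 496/315 * k^3 * B * S^2 + 9664/105 * k^3 * B * S + 704/3 * k^3 * B
      + 68/25 * k^2 * B^4 - 34/25 * k^2 * B^3 * S - 34/25 * k^2 * B^3 * D - 5224/525 * k^2 * B^3 +
      17/150 * k^2 * B^2 * S^2 + 5521/1050 * k^2 * B^2 * S + 28/5 * k^2 * B^2 * D +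
      60749/315 * k^2 * B^2 - 16/35 * k^2 * B * S^2 - 25544/315 * k^2 * B * S +
      284/9 * k^2 * B * D - 784/3 * k^2 * B + 16/3 * k^2 * S^2 + 388/9 * k^2 * S + 72 * k * B -
      24 * k * S + 12 * k * D"
  by (rule solve_comm_eq[OF assms, of 8 "[1, 1, 1, 7]" "- 27"], simp, simp, simp)
    (code_simp, simp only: coeff_table assms, algebra)

lemmas known_g_1_1_7 [coeff_table] = knownI[of U g, OF g_1_1_7]

lemma g_1_1_1_4 [coeff_table]:
  assumes "z \<in> U"
  shows "g z [1, 1, 1, 4] = 
      -78/35 * k^6 * B^3 - 276/35 * k^5 * B^3 + 279/35 * k^5 * B^2 * S + 1341/7 * k^5 * B^2 +
      4434/35 * k^4 * B^3 - 534/7 * k^4 * B^2 * S - 12/7 * k^4 * B^2 * D - 38676/35 * k^4 * B^2 +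
      36/5 * k^4 * B * S^2 + 8403/35 * k^4 * B * S + 5415/7 * k^4 * B - 9624/35 * k^3 * B^3 +
      5751/35 * k^3 * B^2 * S + 1032/35 * k^3 * B^2 * D + 13299/7 * k^3 * B^2 -
      111/5 * k^3 * B * S^2 + 66/35 * k^3 * B * S * D - 25173/35 * k^3 * B * S +
      1770/7 * k^3 * B * D - 15552/7 * k^3 * B + 3/5 * k^3 * S^3 + 1644/35 * k^3 * S^2 +
      2175/7 * k^3 * S + 792/5 * k^2 * B^3 - 96 * k^2 * B^2 * S - 396/5 * k^2 * B^2 * D -
      4932/5 * k^2 * B^2 + 15 * k^2 * B * S^2 + 42/5 * k^2 * B * S * D + 3354/7 * k^2 * B * S -
      3210/7 * k^2 * B * D + 13161/7 * k^2 * B - 3/5 * k^2 * S^3 - 1644/35 * k^2 * S^2 +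
      360/7 * k^2 * S * D - 3183/7 * k^2 * S + 1920/7 * k^2 * D - 432 * k * B + 144 * k * S -
      312 * k * D"
  by (rule solve_comm_eq[OF assms, of 6 "[1, 1, 1, 1, 4]" "- 28"], simp, simp, simp)
    (code_simp, simp only: coeff_table assms, algebra)

lemmas known_g_1_1_1_4 [coeff_table] = knownI[of U g, OF g_1_1_1_4]

lemma g_1_2_6 [coeff_table]:
  assumes "z \<in> U"
  shows "g z [1, 2, 6] = 
      -1/1575 * k^6 * B^4 + 3302/875 * k^5 * B^4 - 3583/5250 * k^5 * B^3 * S +
      83849/6750 * k^5 * B^3 - 36958/7875 * k^4 * B^4 + 1/25 * k^4 * B^3 * S -
      502/175 * k^4 * B^3 * D - 293789/2625 * k^4 * B^3 - 394/2625 * k^4 * B^2 * S^2 +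
      589943/15750 * k^4 * B^2 * S + 51727/126 * k^4 * B^2 - 24972/875 * k^3 * B^4 +
      45653/2625 * k^3 * B^3 * S + 12486/875 * k^3 * B^3 * D + 4679456/23625 * k^3 * B^3 -
      253/125 * k^3 * B^2 * S^2 - 821/875 * k^3 * B^2 * S * D - 31177/315 * k^3 * B^2 * S -
      3671/225 * k^3 * B^2 * D - 1895177/1575 * k^3 * B^2 + 13/350 * k^3 * B * S^3 +
      13736/1575 * k^3 * B * S^2 + 46351/150 * k^3 * B * S + 9598/15 * k^3 * B +
      3736/125 * k^2 * B^4 - 2174/125 * k^2 * B^3 * S - 1868/125 * k^2 * B^3 * D -
      238646/2625 * k^2 * B^3 + 926/375 * k^2 * B^2 * S^2 + 153/125 * k^2 * B^2 * S * D +
      282119/5250 * k^2 * B^2 * S + 8973/175 * k^2 * B^2 * D + 349427/450 * k^2 * B^2 -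
      2/25 * k^2 * B * S^3 - 2563/350 * k^2 * B * S^2 - 108/35 * k^2 * B * S * D -
      1054691/3150 * k^2 * B * S + 7520/63 * k^2 * B * D - 14222/15 * k^2 * B + 8/35 * k^2 * S^3 +
      2498/105 * k^2 * S^2 + 8642/45 * k^2 * S + 312 * k * B - 104 * k * S + 72 * k * D"
  by (rule solve_comm_eq[OF assms, of 8 "[1, 1, 2, 6]" "- 20"], simp, simp, simp)
    (code_simp, simp only: coeff_table assms, algebra)

lemmas known_g_1_2_6 [coeff_table] = knownI[of U g, OF g_1_2_6]

lemma g_3_8 [coeff_table]:
  assumes "z \<in> U"
  shows "g z [3, 8] = 
      -377/1575 * k^6 * B^5 - 5273/21000 * k^5 * B^5 + 1199/2625 * k^5 * B^4 * S -
      92303/47250 * k^5 * B^4 + 128789/63000 * k^4 * B^5 - 17491/8400 * k^4 * B^4 * S -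
      214/175 * k^4 * B^4 * D + 1070177/126000 * k^4 * B^4 + 1381/10500 * k^4 * B^3 * S^2 -
      142/1125 * k^4 * B^3 * S + 9973/252 * k^4 * B^3 - 25131/1750 * k^3 * B^5 +
      356887/42000 * k^3 * B^4 * S + 25131/3500 * k^3 * B^4 * D + 19679479/378000 * k^3 * B^4 -
      6487/7000 * k^3 * B^3 * S^2 - 1251/3500 * k^3 * B^3 * S * D - 730571/25200 * k^3 * B^3 * S -
      161047/6300 * k^3 * B^3 * D - 2428273/25200 * k^3 * B^3 + 3/175 * k^3 * B^2 * S^3 +
      28733/12600 * k^3 * B^2 * S^2 + 17704/525 * k^3 * B^2 * S + 273337/840 * k^3 * B^2 +
      3613/250 * k^2 * B^5 - 1066/125 * k^2 * B^4 * S - 3613/500 * k^2 * B^4 * D -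
      325043/5250 * k^2 * B^4 + 7519/6000 * k^2 * B^3 * S^2 + 651/1000 * k^2 * B^3 * S * D +
      766009/21000 * k^2 * B^3 * S + 47241/1400 * k^2 * B^3 * D + 658463/25200 * k^2 * B^3 -
      19/400 * k^2 * B^2 * S^3 - 2617/525 * k^2 * B^2 * S^2 - 311/140 * k^2 * B^2 * S * D -
      484157/25200 * k^2 * B^2 * S - 6599/252 * k^2 * B^2 * D - 433523/840 * k^2 * B^2 +
      143/840 * k^2 * B * S^3 + 2 * k^2 * B * S^2 + 441923/2520 * k^2 * B * S + 279 * k^2 * B -
      216 * k * B + 72 * k * S"
  by (rule solve_comm_eq[OF assms, of 10 "[1, 3, 8]" "- 12"], simp, simp, simp)
    (code_simp, simp only: coeff_table assms, algebra)

lemmas known_g_3_8 [coeff_table] = knownI[of U g, OF g_3_8]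

lemma g_2_9 [coeff_table]:
  assumes "z \<in> U"
  shows "g z [2, 9] = 
      47/2520 * k^6 * B^5 - 127/525 * k^5 * B^5 + 23/240 * k^5 * B^4 * S - 16313/15120 * k^5 * B^4
      - 1327/12600 * k^4 * B^5 - 3/100 * k^4 * B^4 * S + 1/28 * k^4 * B^4 * D +
      2909/900 * k^4 * B^4 - 1/240 * k^4 * B^3 * S^2 - 523/720 * k^4 * B^3 * S +
      2257/126 * k^4 * B^3 - 141/175 * k^3 * B^5 + 3811/8400 * k^3 * B^4 * S +
      141/350 * k^3 * B^4 * D + 68717/15120 * k^3 * B^4 - 4/175 * k^3 * B^3 * S^2 -
      31627/12600 * k^3 * B^3 * S - 667/315 * k^3 * B^3 * D - 15133/504 * k^3 * B^3 +
      347/2520 * k^3 * B^2 * S^2 + 8599/840 * k^3 * B^2 * S + 65581/420 * k^3 * B^2 +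
      61/50 * k^2 * B^5 - 61/100 * k^2 * B^4 * S - 61/100 * k^2 * B^4 * D - 3499/525 * k^2 * B^4 +
      61/1200 * k^2 * B^3 * S^2 + 29093/8400 * k^2 * B^3 * S + 18/5 * k^2 * B^3 * D +
      3113/504 * k^2 * B^3 - 83/280 * k^2 * B^2 * S^2 - 9781/2520 * k^2 * B^2 * S -
      209/45 * k^2 * B^2 * D - 63989/420 * k^2 * B^2 + 38/105 * k^2 * B * S^2 +
      16181/315 * k^2 * B * S + 111 * k^2 * B - 54 * k * B + 18 * k * S"
  by (rule solve_comm_eq[OF assms, of 10 "[1, 2, 9]" "- 12"], simp, simp, simp)
    (code_simp, simp only: coeff_table assms, algebra)

lemmas known_g_2_9 [coeff_table] = knownI[of U g, OF g_2_9]

lemma g_1_3_3 [coeff_table]: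
  assumes "z \<in> U"
  shows "g z [1, 3, 3] = 
      -76/35 * k^5 * B^3 - 456/35 * k^4 * B^3 + 247/35 * k^4 * B^2 * S + 2813/35 * k^4 * B^2 +
      2368/35 * k^3 * B^3 - 1268/35 * k^3 * B^2 * S - 344/35 * k^3 * B^2 * D - 2748/7 * k^3 * B^2
      + 24/7 * k^3 * B * S^2 + 795/7 * k^3 * B * S + 1797/7 * k^3 * B - 288/5 * k^2 * B^3 +
      172/5 * k^2 * B^2 * S + 144/5 * k^2 * B^2 * D + 12632/35 * k^2 * B^2 - 26/5 * k^2 * B * S^2
      - 14/5 * k^2 * B * S * D - 5843/35 * k^2 * B * S + 62 * k^2 * B * D - 3831/7 * k^2 * B +
      1/5 * k^2 * S^3 + 508/35 * k^2 * S^2 + 913/7 * k^2 * S + 192 * k * B - 64 * k * S +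
      72 * k * D"
  by (rule solve_comm_eq[OF assms, of 6 "[1, 1, 3, 3]" "- 16"], simp, simp, simp)
    (code_simp, simp only: coeff_table assms, algebra)

lemmas known_g_1_3_3 [coeff_table] = knownI[of U g, OF g_1_3_3]

lemma g_4_5 [coeff_table]:
  assumes "z \<in> U"
  shows "g z [4, 5] = 
      -18/25 * k^5 * B^4 + 87/25 * k^4 * B^4 + 27/50 * k^4 * B^3 * S + 21/2 * k^4 * B^3 +
      708/25 * k^3 * B^4 - 789/50 * k^3 * B^3 * S - 354/25 * k^3 * B^3 * D - 1277/25 * k^3 * B^3 +
      129/100 * k^3 * B^2 * S^2 + 37/2 * k^3 * B^2 * S + 2437/20 * k^3 * B^2 - 972/25 * k^2 * B^4
      + 117/5 * k^2 * B^3 * S + 486/25 * k^2 * B^3 * D + 788/25 * k^2 * B^3 -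
      18/5 * k^2 * B^2 * S^2 - 99/50 * k^2 * B^2 * S * D - 1919/100 * k^2 * B^2 * S -
      223/10 * k^2 * B^2 * D - 6911/20 * k^2 * B^2 + 3/20 * k^2 * B * S^3 + 19/10 * k^2 * B * S^2
      + 2363/20 * k^2 * B * S + 168 * k^2 * B - 210 * k * B + 70 * k * S"
  by (rule solve_comm_eq[OF assms, of 8 "[1, 4, 5]" "- 10"], simp, simp, simp)
    (code_simp, simp only: coeff_table assms, algebra)

lemmas known_g_4_5 [coeff_table] = knownI[of U g, OF g_4_5]

lemma g_2_2_3 [coeff_table]:
  assumes "z \<in> U"
  shows "g z [2, 2, 3] = 
      -22/5 * k^5 * B^3 - 66/5 * k^4 * B^3 + 47/5 * k^4 * B^2 * S + 429/5 * k^4 * B^2 +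
      544/5 * k^3 * B^3 - 291/5 * k^3 * B^2 * S - 92/5 * k^3 * B^2 * D - 505 * k^3 * B^2 +
      27/5 * k^3 * B * S^2 + 737/5 * k^3 * B * S + 342 * k^3 * B - 456/5 * k^2 * B^3 +
      244/5 * k^2 * B^2 * S + 228/5 * k^2 * B^2 * D + 2736/5 * k^2 * B^2 - 27/5 * k^2 * B * S^2 -
      8/5 * k^2 * B * S * D - 1297/5 * k^2 * B * S + 112 * k^2 * B * D - 786 * k^2 * B +
      24 * k^2 * S^2 + 188 * k^2 * S + 264 * k * B - 88 * k * S + 144 * k * D"
  by (rule solve_comm_eq[OF assms, of 6 "[1, 2, 2, 3]" "- 9"], simp, simp, simp)
    (code_simp, simp only: coeff_table assms, algebra)

lemmas known_g_2_2_3 [coeff_table] = knownI[of U g, OF g_2_2_3]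

lemma g_1_1_1_1_1 [coeff_table]:
  assumes "z \<in> U"
  shows "g z [1, 1, 1, 1, 1] = 
      -96 * k^5 * B^2 + 36 * k^5 * B * S + 456 * k^5 * B + 864 * k^4 * B^2 - 420 * k^4 * B * S +
      60 * k^4 * B * D - 2484 * k^4 * B + 36 * k^4 * S^2 + 288 * k^4 * S - 1920 * k^3 * B^2 +
      1008 * k^3 * B * S - 672 * k^3 * B * D + 4044 * k^3 * B - 108 * k^3 * S^2 +
      132 * k^3 * S * D - 720 * k^3 * S + 840 * k^3 * D + 1152 * k^2 * B^2 - 624 * k^2 * B * S +
      912 * k^2 * B * D - 2016 * k^2 * B + 72 * k^2 * S^2 - 192 * k^2 * S * D + 432 * k^2 * S +
      120 * k^2 * D^2 - 2220 * k^2 * D + 1440 * k * D"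
  by (rule solve_comm_eq[OF assms, of 4 "[1, 1, 1, 1, 1, 1]" "- 24"], simp, simp, simp)
    (code_simp, simp only: coeff_table assms, algebra)

lemmas known_g_1_1_1_1_1 [coeff_table] = knownI[of U g, OF g_1_1_1_1_1]

lemma g_1_1_2_3 [coeff_table]:
  assumes "z \<in> U"
  shows "g z [1, 1, 2, 3] = 
      -60/7 * k^6 * B^3 + 696/35 * k^5 * B^3 + 344/35 * k^5 * B^2 * S + 1487/7 * k^5 * B^2 +
      7956/35 * k^4 * B^3 - 1090/7 * k^4 * B^2 * S - 156/7 * k^4 * B^2 * D - 56741/35 * k^4 * B^2
      + 78/5 * k^4 * B * S^2 + 13759/35 * k^4 * B * S + 8592/7 * k^4 * B - 24816/35 * k^3 * B^3 +
      15186/35 * k^3 * B^2 * S + 4848/35 * k^3 * B^2 * D + 24172/7 * k^3 * B^2 -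
      312/5 * k^3 * B * S^2 - 192/35 * k^3 * B * S * D - 49258/35 * k^3 * B * S +
      15132/35 * k^3 * B * D - 28527/7 * k^3 * B + 2 * k^3 * S^3 + 3627/35 * k^3 * S^2 +
      4573/7 * k^3 * S + 2352/5 * k^2 * B^3 - 288 * k^2 * B^2 * S - 1128/5 * k^2 * B^2 * D -
      10222/5 * k^2 * B^2 + 234/5 * k^2 * B * S^2 + 108/5 * k^2 * B * S * D +
      35499/35 * k^2 * B * S - 24/5 * k^2 * B * D^2 - 34623/35 * k^2 * B * D + 25647/7 * k^2 * B -
      2 * k^2 * S^3 - 3627/35 * k^2 * S^2 + 3891/35 * k^2 * S * D - 6477/7 * k^2 * S +
      4989/7 * k^2 * D - 816 * k * B + 272 * k * S - 816 * k * D"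
  by (rule solve_comm_eq[OF assms, of 6 "[1, 1, 1, 2, 3]" "- 24"], simp, simp, simp)
    (code_simp, simp only: coeff_table assms, algebra)

lemmas known_g_1_1_2_3 [coeff_table] = knownI[of U g, OF g_1_1_2_3]

lemma g_1_3_5 [coeff_table]:
  assumes "z \<in> U"
  shows "g z [1, 3, 5] = 
      2377/6300 * k^6 * B^4 + 12179/1750 * k^5 * B^4 - 18527/21000 * k^5 * B^3 * S +
      26491/27000 * k^5 * B^3 - 199967/31500 * k^4 * B^4 - 98/25 * k^4 * B^3 * S -
      2757/350 * k^4 * B^3 * D - 991853/5250 * k^4 * B^3 + 2749/10500 * k^4 * B^2 * S^2 +
      639271/9000 * k^4 * B^2 * S + 7222193/12600 * k^4 * B^2 - 86022/875 * k^3 * B^4 +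
      1331399/21000 * k^3 * B^3 * S + 43011/875 * k^3 * B^3 * D + 87484643/189000 * k^3 * B^3 -
      65253/7000 * k^3 * B^2 * S^2 - 17309/3500 * k^3 * B^2 * S * D - 118625/504 * k^3 * B^2 * S -
      77153/1260 * k^3 * B^2 * D - 547291/252 * k^3 * B^2 + 443/1400 * k^3 * B * S^3 +
      135493/6300 * k^3 * B * S^2 + 359027/600 * k^3 * B * S + 16253/15 * k^3 * B +
      12701/125 * k^2 * B^4 - 8074/125 * k^2 * B^3 * S - 12341/250 * k^2 * B^3 * D -
      1372457/5250 * k^2 * B^3 + 35423/3000 * k^2 * B^2 * S^2 + 3087/500 * k^2 * B^2 * S * D +
      415307/2625 * k^2 * B^2 * S - 18/25 * k^2 * B^2 * D^2 + 3698/25 * k^2 * B^2 * D +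
      20709589/12600 * k^2 * B^2 - 157/200 * k^2 * B * S^3 - 7/25 * k^2 * B * S^2 * D -
      16361/700 * k^2 * B * S^2 - 1057/100 * k^2 * B * S * D - 9008911/12600 * k^2 * B * S +
      46709/180 * k^2 * B * D - 29227/15 * k^2 * B + 1/50 * k^2 * S^4 + 148/175 * k^2 * S^3 +
      54661/1050 * k^2 * S^2 + 19687/45 * k^2 * S + 696 * k * B - 232 * k * S + 180 * k * D"
  by (rule solve_comm_eq[OF assms, of 8 "[1, 1, 3, 5]" "- 20"], simp, simp, simp)
    (code_simp, simp only: coeff_table assms, algebra)

lemmas known_g_1_3_5 [coeff_table] = knownI[of U g, OF g_1_3_5]

lemma g_1_4_4 [coeff_table]:
  assumes "z \<in> U"
  shows "g z [1, 4, 4] = 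
      377/630 * k^6 * B^4 + 217/25 * k^5 * B^4 - 2083/2100 * k^5 * B^3 * S -
      29459/3780 * k^5 * B^3 - 22567/3150 * k^4 * B^4 - 1128/175 * k^4 * B^3 * S -
      1849/175 * k^4 * B^3 * D - 118327/525 * k^4 * B^3 + 89/150 * k^4 * B^2 * S^2 +
      553997/6300 * k^4 * B^2 * S + 560099/900 * k^4 * B^2 - 3612/25 * k^3 * B^4 +
      39779/420 * k^3 * B^3 * S + 1806/25 * k^3 * B^3 * D + 11483947/18900 * k^3 * B^3 -
      10321/700 * k^3 * B^2 * S^2 - 561/70 * k^3 * B^2 * S * D - 1955129/6300 * k^3 * B^2 * S -
      282097/3150 * k^3 * B^2 * D - 8270407/3150 * k^3 * B^2 + 391/700 * k^3 * B * S^3 +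
      90469/3150 * k^3 * B * S^2 + 1555721/2100 * k^3 * B * S + 3818/3 * k^3 * B +
      3722/25 * k^2 * B^4 - 2428/25 * k^2 * B^3 * S - 1789/25 * k^2 * B^3 * D -
      189481/525 * k^2 * B^3 + 5671/300 * k^2 * B^2 * S^2 + 99/10 * k^2 * B^2 * S * D +
      3292/15 * k^2 * B^2 * S - 36/25 * k^2 * B^2 * D^2 + 35786/175 * k^2 * B^2 * D +
      13204393/6300 * k^2 * B^2 - 141/100 * k^2 * B * S^3 - 14/25 * k^2 * B * S^2 * D -
      2311/70 * k^2 * B * S^2 - 5239/350 * k^2 * B * S * D - 5761507/6300 * k^2 * B * S +
      208763/630 * k^2 * B * D - 7372/3 * k^2 * B + 1/25 * k^2 * S^4 + 216/175 * k^2 * S^3 +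
      35281/525 * k^2 * S^2 + 5122/9 * k^2 * S + 900 * k * B - 300 * k * S + 240 * k * D"
  by (rule solve_comm_eq[OF assms, of 8 "[1, 1, 4, 4]" "- 20"], simp, simp, simp)
    (code_simp, simp only: coeff_table assms, algebra)

lemmas known_g_1_4_4 [coeff_table] = knownI[of U g, OF g_1_4_4]

lemma g_5_6 [coeff_table]:
  assumes "z \<in> U"
  shows "g z [5, 6] = 
      -6407/2800 * k^6 * B^5 + 2877/1000 * k^5 * B^5 + 10653/4000 * k^5 * B^4 * S +
      44599/12000 * k^5 * B^4 + 553997/14000 * k^4 * B^5 - 119747/4200 * k^4 * B^4 * S -
      5997/280 * k^4 * B^4 * D + 216077/21000 * k^4 * B^4 + 35503/14000 * k^4 * B^3 * S^2 +
      266813/28000 * k^4 * B^3 * S + 574641/5600 * k^4 * B^3 - 37143/250 * k^3 * B^5 +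
      2669313/28000 * k^3 * B^4 * S + 37143/500 * k^3 * B^4 * D + 26169667/84000 * k^3 * B^4 -
      417863/28000 * k^3 * B^3 * S^2 - 113049/14000 * k^3 * B^3 * S * D -
      1775797/10080 * k^3 * B^3 * S - 449121/2800 * k^3 * B^3 * D - 188999/700 * k^3 * B^3 +
      497/800 * k^3 * B^2 * S^3 + 131227/8400 * k^3 * B^2 * S^2 + 1630421/16800 * k^3 * B^2 * S +
      156671/280 * k^3 * B^2 + 57681/500 * k^2 * B^5 - 39279/500 * k^2 * B^4 * S -
      56601/1000 * k^2 * B^4 * D - 2428809/7000 * k^2 * B^4 + 65661/4000 * k^2 * B^3 * S^2 +
      19797/2000 * k^2 * B^3 * S * D + 3010111/14000 * k^2 * B^3 * S - 27/50 * k^2 * B^3 * D^2 +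
      33723/175 * k^2 * B^3 * D + 229093/3360 * k^2 * B^3 - 1079/800 * k^2 * B^2 * S^3 -
      27/50 * k^2 * B^2 * S^2 * D - 281809/8400 * k^2 * B^2 * S^2 - 49237/2800 * k^2 * B^2 * S * D
      - 220039/3360 * k^2 * B^2 * S - 12055/112 * k^2 * B^2 * D - 451489/280 * k^2 * B^2 +
      1/25 * k^2 * B * S^4 + 847/600 * k^2 * B * S^3 + 16249/2100 * k^2 * B * S^2 +
      154323/280 * k^2 * B * S + 630 * k^2 * B - 756 * k * B + 252 * k * S"
  by (rule solve_comm_eq[OF assms, of 10 "[1, 5, 6]" "- 12"], simp, simp, simp)
    (code_simp, simp only: coeff_table assms, algebra)

lemmas known_g_5_6 [coeff_table] = knownI[of U g, OF g_5_6]

lemma g_2_2_5 [coeff_table]: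
  assumes "z \<in> U"
  shows "g z [2, 2, 5] = 
      579/550 * k^6 * B^4 + 8757/1375 * k^5 * B^4 - 6427/5500 * k^5 * B^3 * S -
      48567/5500 * k^5 * B^3 - 50829/2750 * k^4 * B^4 + 63/55 * k^4 * B^3 * S -
      153/25 * k^4 * B^3 * D - 279503/1375 * k^4 * B^3 - 408/1375 * k^4 * B^2 * S^2 +
      458039/5500 * k^4 * B^2 * S + 810897/1100 * k^4 * B^2 - 117252/1375 * k^3 * B^4 +
      237319/5500 * k^3 * B^3 * S + 58626/1375 * k^3 * B^3 * D + 3839127/5500 * k^3 * B^3 -
      6569/5500 * k^3 * B^2 * S^2 + 3263/2750 * k^3 * B^2 * S * D - 394853/1100 * k^3 * B^2 * S -
      48809/550 * k^3 * B^2 * D - 1616289/550 * k^3 * B^2 - 533/1100 * k^3 * B * S^3 +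
      18729/550 * k^3 * B * S^2 + 175427/220 * k^3 * B * S + 83862/55 * k^3 * B +
      126162/1375 * k^2 * B^4 - 50238/1375 * k^2 * B^3 * S - 78561/1375 * k^2 * B^3 * D -
      678097/1375 * k^2 * B^3 - 9899/5500 * k^2 * B^2 * S^2 + 2637/2750 * k^2 * B^2 * S * D +
      785343/2750 * k^2 * B^2 * S + 1548/275 * k^2 * B^2 * D^2 + 70039/275 * k^2 * B^2 * D +
      2630289/1100 * k^2 * B^2 + 1277/1100 * k^2 * B * S^3 + 2/275 * k^2 * B * S^2 * D -
      21533/550 * k^2 * B * S^2 - 7089/550 * k^2 * B * S * D - 1163111/1100 * k^2 * B * S +
      54717/110 * k^2 * B * D - 155718/55 * k^2 * B - 13/275 * k^2 * S^4 + 256/275 * k^2 * S^3 +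
      22327/275 * k^2 * S^2 + 34746/55 * k^2 * S + 972 * k * B - 324 * k * S + 360 * k * D"
  by (rule solve_comm_eq[OF assms, of 8 "[1, 2, 2, 5]" "- 11"], simp, simp, simp)
    (code_simp, simp only: coeff_table assms, algebra)

lemmas known_g_2_2_5 [coeff_table] = knownI[of U g, OF g_2_2_5]

lemma g_1_2_2_2 [coeff_table]:
  assumes "z \<in> U"
  shows "g z [1, 2, 2, 2] = 
      -498/35 * k^6 * B^3 + 1908/35 * k^5 * B^3 + 67/7 * k^5 * B^2 * S + 7426/35 * k^5 * B^2 +
      10734/35 * k^4 * B^3 - 8004/35 * k^4 * B^2 * S - 1488/35 * k^4 * B^2 * D -
      13555/7 * k^4 * B^2 + 118/5 * k^4 * B * S^2 + 17132/35 * k^4 * B * S + 11379/7 * k^4 * B -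
      41544/35 * k^3 * B^3 + 25477/35 * k^3 * B^2 * S + 9432/35 * k^3 * B^2 * D +
      167939/35 * k^3 * B^2 - 527/5 * k^3 * B * S^2 - 494/35 * k^3 * B * S * D -
      71303/35 * k^3 * B * S + 21758/35 * k^3 * B * D - 40437/7 * k^3 * B + 17/5 * k^3 * S^3 +
      5697/35 * k^3 * S^2 + 6746/7 * k^3 * S + 840 * k^2 * B^3 - 2544/5 * k^2 * B^2 * S -
      2148/5 * k^2 * B^2 * D - 3074 * k^2 * B^2 + 409/5 * k^2 * B * S^2 + 246/5 * k^2 * B * S * D
      + 54171/35 * k^2 * B * S + 24/5 * k^2 * B * D^2 - 56167/35 * k^2 * B * D + 36618/7 * k^2 * B
      - 17/5 * k^2 * S^3 - 8/5 * k^2 * S^2 * D - 5697/35 * k^2 * S^2 + 6329/35 * k^2 * S * D -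
      9266/7 * k^2 * S + 8703/7 * k^2 * D - 1080 * k * B + 360 * k * S - 1440 * k * D"
  by (rule solve_comm_eq[OF assms, of 6 "[1, 1, 2, 2, 2]" "- 18"], simp, simp, simp)
    (code_simp, simp only: coeff_table assms, algebra)

lemmas known_g_1_2_2_2 [coeff_table] = knownI[of U g, OF g_1_2_2_2]

lemma g_2_3_4 [coeff_table]:
  assumes "z \<in> U"
  shows "g z [2, 3, 4] = 
      3991/1540 * k^6 * B^4 + 5433/770 * k^5 * B^4 - 5543/3080 * k^5 * B^3 * S -
      82249/1848 * k^5 * B^3 - 12569/308 * k^4 * B^4 + 519/77 * k^4 * B^3 * S -
      3523/770 * k^4 * B^3 * D - 18442/77 * k^4 * B^3 - 977/1540 * k^4 * B^2 * S^2 +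
      358987/3080 * k^4 * B^2 * S + 2875879/3080 * k^4 * B^2 - 48294/385 * k^3 * B^4 +
      152447/3080 * k^3 * B^3 * S + 24147/385 * k^3 * B^3 * D + 11904929/9240 * k^3 * B^3 +
      17837/3080 * k^3 * B^2 * S^2 + 2489/308 * k^3 * B^2 * S * D - 294781/440 * k^3 * B^2 * S -
      64507/308 * k^3 * B^2 * D - 6843271/1540 * k^3 * B^2 - 713/440 * k^3 * B * S^3 +
      101979/1540 * k^3 * B * S^2 + 3837709/3080 * k^3 * B * S + 24645/11 * k^3 * B +
      7983/55 * k^2 * B^4 - 1926/55 * k^2 * B^3 * S - 12087/110 * k^2 * B^3 * D -
      822583/770 * k^2 * B^3 - 6969/440 * k^2 * B^2 * S^2 - 27/220 * k^2 * B^2 * S * D +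
      95143/154 * k^2 * B^2 * S + 1026/55 * k^2 * B^2 * D^2 + 81553/154 * k^2 * B^2 * D +
      12339799/3080 * k^2 * B^2 + 349/88 * k^2 * B * S^3 - 26707/308 * k^2 * B * S^2 -
      737/28 * k^2 * B * S * D - 5482821/3080 * k^2 * B * S + 283567/308 * k^2 * B * D -
      52245/11 * k^2 * B - 19/110 * k^2 * S^4 + 116/55 * k^2 * S^3 + 15217/110 * k^2 * S^2 +
      12245/11 * k^2 * S + 1650 * k * B - 550 * k * S + 720 * k * D"
  by (rule solve_comm_eq[OF assms, of 8 "[1, 2, 3, 4]" "- 11"], simp, simp, simp)
    (code_simp, simp only: coeff_table assms, algebra)

lemmas known_g_2_3_4 [coeff_table] = knownI[of U g, OF g_2_3_4]

text \<open>In this and the next five equations a power of k and of B splits off; in what remains, k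
  occurs only in k B and D only in B D. This suggests the unknowns of the elimination, and it shows
  that B = 0 needs other equations.\<close>

lemma obstruction_3_7:
  assumes "z \<in> U"
  shows "1/30 * k^3 * B^2 * (
      -6 * k^2 * B^2 + 9 * k * B * S + 67 * k * B + 216 * B^2 - 108 * B * S - 108 * B * D + 72 * B
      + 9 * S^2 - 9 * S - 30) = 0"
  by (rule comm_eqD[OF assms, of 8 "[3, 7]"], simp, simp)
    (code_simp, simp only: coeff_table assms, algebra)

lemma obstruction_2_2_6:
  assumes "z \<in> U"
  shows "1/50 * k^3 * B * (
      30 * k^3 * B^3 - 66 * k^2 * B^3 - 31 * k^2 * B^2 * S - 321 * k^2 * B^2 - 1080 * k * B^3 +
      639 * k * B^2 * S + 540 * k * B^2 * D + 643 * k * B^2 - 66 * k * B * S^2 - 263 * k * B * S +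
      675 * k * B + 2376 * B^3 - 1944 * B^2 * S - 1188 * B^2 * D + 2304 * B^2 + 477 * B * S^2 +
      378 * B * S * D - 1128 * B * S - 630 * B * D + 195 * B - 35 * S^3 + 140 * S^2 - 105 * S) = 0"
  by (rule comm_eqD[OF assms, of 8 "[2, 2, 6]"], simp, simp)
    (code_simp, simp only: coeff_table assms, algebra)

text \<open>There are four unknowns, k B, B, S and B D, against the two equations taken from
  \<epsilon>^8; the remaining four equations come from \<epsilon>^10.\<close>

lemma obstruction_3_9:
  assumes "z \<in> U"
  shows "1/2100 * k^3 * B^2 * (
      -438 * k^3 * B^3 + 378 * k^2 * B^3 + 657 * k^2 * B^2 * S + 271 * k^2 * B^2 + 9288 * k * B^3
      - 5211 * k * B^2 * S - 4644 * k * B^2 * D - 2925 * k * B^2 + 297 * k * B * S^2 +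
      3273 * k * B * S + 15360 * k * B - 13608 * B^3 + 6804 * B^2 * S + 6804 * B^2 * D +
      54864 * B^2 - 567 * B * S^2 - 28953 * B * S - 30240 * B * D + 21810 * B + 2490 * S^2 -
      3210 * S - 6300) = 0"
  by (rule comm_eqD[OF assms, of 10 "[3, 9]"], simp, simp)
    (code_simp, simp only: coeff_table assms, algebra)

lemma obstruction_2_2_8:
  assumes "z \<in> U"
  shows "1/21000 * k^3 * B * (
      25110 * k^4 * B^4 - 65394 * k^3 * B^4 - 28449 * k^3 * B^3 * S - 95679 * k^3 * B^3 -
      566496 * k^2 * B^4 + 394485 * k^2 * B^3 * S + 306180 * k^2 * B^3 * D + 331431 * k^2 * B^3 -
      35289 * k^2 * B^2 * S^2 - 165237 * k^2 * B^2 * S - 310500 * k^2 * B^2 + 1900584 * k * B^4 -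
      1306152 * k * B^3 * S - 950292 * k * B^3 * D - 1731126 * k * B^3 + 231102 * k * B^2 * S^2 +
      143532 * k * B^2 * S * D + 1078625 * k * B^2 * S + 840780 * k * B^2 * D + 467955 * k * B^2 -
      11340 * k * B * S^3 - 105840 * k * B * S^2 - 351270 * k * B * S + 1011150 * k * B -
      1651104 * B^4 + 1316196 * B^3 * S + 825552 * B^3 * D + 2680344 * B^3 - 314118 * B^2 * S^2 -
      245322 * B^2 * S * D - 2687283 * B^2 * S - 1722330 * B^2 * D + 3938295 * B^2 +
      22365 * B * S^3 + 744990 * B * S^2 + 672300 * B * S * D - 1917705 * B * S - 1120500 * B * D
      + 381150 * B - 59850 * S^3 + 239400 * S^2 - 179550 * S) = 0"
  by (rule comm_eqD[OF assms, of 10 "[2, 2, 8]"], simp, simp)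
    (code_simp, simp only: coeff_table assms, algebra)

lemma obstruction_3_3_6:
  assumes "z \<in> U"
  shows "1/99000 * k^3 * B * (
      6413550 * k^4 * B^4 - 17780796 * k^3 * B^4 - 6570351 * k^3 * B^3 * S - 29411551 * k^3 * B^3
      - 151420434 * k^2 * B^4 + 104916900 * k^2 * B^3 * S + 83297700 * k^2 * B^3 * D +
      129216324 * k^2 * B^3 - 10224126 * k^2 * B^2 * S^2 - 56475993 * k^2 * B^2 * S -
      81222825 * k^2 * B^2 + 570967056 * k * B^4 - 418156173 * k * B^3 * S -
      285483528 * k * B^3 * D - 379088669 * k * B^3 + 85363083 * k * B^2 * S^2 +
      54955098 * k * B^2 * S * D + 225843025 * k * B^2 * S + 190222770 * k * B^2 * D -
      40305480 * k * B^2 - 5180175 * k * B * S^3 - 18691530 * k * B * S^2 - 29073855 * k * B * S +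
      195090300 * k * B - 486034776 * B^4 + 421731144 * B^3 * S + 212885388 * B^3 * D +
      287529876 * B^3 - 120206367 * B^2 * S^2 - 74290878 * B^2 * S * D - 318511422 * B^2 * S +
      15066000 * B^2 * D^2 - 254063520 * B^2 * D + 678395205 * B^2 + 13120065 * B * S^3 +
      4043520 * B * S^2 * D + 91458390 * B * S^2 + 90653850 * B * S * D - 329344695 * B * S -
      200518050 * B * D + 95298300 * B - 435600 * S^4 - 7962900 * S^3 + 41184600 * S^2 -
      40082100 * S) = 0"
  by (rule comm_eqD[OF assms, of 10 "[3, 3, 6]"], simp, simp)
    (code_simp, simp only: coeff_table assms, algebra)

lemma obstruction_2_5_5:
  assumes "z \<in> U"
  shows "1/66000 * k^3 * B * (
      4047690 * k^4 * B^4 - 10360836 * k^3 * B^4 - 4281381 * k^3 * B^3 * S - 23447741 * k^3 * B^3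
      - 104811654 * k^2 * B^4 + 69273420 * k^2 * B^3 * S + 56456460 * k^2 * B^3 * D +
      70212924 * k^2 * B^3 - 6714486 * k^2 * B^2 * S^2 - 29816643 * k^2 * B^2 * S -
      45164655 * k^2 * B^2 + 339488496 * k * B^4 - 244563903 * k * B^3 * S -
      169744248 * k * B^3 * D - 201653479 * k * B^3 + 49100373 * k * B^2 * S^2 +
      31333878 * k * B^2 * S * D + 121452095 * k * B^2 * S + 107518110 * k * B^2 * D -
      38692440 * k * B^2 - 2916225 * k * B * S^3 - 10325790 * k * B * S^2 - 8956785 * k * B * S +
      95546700 * k * B - 259530696 * B^4 + 223278984 * B^3 * S + 113707908 * B^3 * D +
      135219276 * B^3 - 63328077 * B^2 * S^2 - 38728098 * B^2 * S * D - 149850342 * B^2 * S +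
      8028720 * B^2 * D^2 - 124757280 * B^2 * D + 329130675 * B^2 + 6934815 * B * S^3 +
      2209680 * B * S^2 * D + 42674010 * B * S^2 + 42226470 * B * S * D - 158415825 * B * S -
      95155950 * B * D + 45650700 * B - 234720 * S^4 - 3719460 * S^3 + 19681080 * S^2 -
      19374900 * S) = 0"
  by (rule comm_eqD[OF assms, of 10 "[2, 5, 5]"], simp, simp)
    (code_simp, simp only: coeff_table assms, algebra)

end

section \<open>Coefficients and obstructions for \<open>B = 0\<close>\<close>

context commuting_flows_B0
begin

lemma g_13 [coeff_table]:
  assumes "z \<in> U"
  shows "g z [13] = 0"
  by (rule solve_comm_eq[OF assms, of 12 "[1, 13]" "- 13"], simp, simp, simp)
    (code_simp, simp only: coeff_table assms, algebra)

lemmas known_g_13 [coeff_table] = knownI[of U g, OF g_13]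

text \<open>At B = 0 the values at pairs [a, 13 - a] are 2 k S times the binomial coefficients of 11
  over a - 1, which are the coefficients of D^10 (u_1 u_2). The quadratic part is thus inherited
  from the geometric series; genuinely new terms start with three entries.\<close>

lemma g_1_12 [coeff_table]:
  assumes "z \<in> U"
  shows "g z [1, 12] = 2 * k * S"
  by (rule solve_comm_eq[OF assms, of 12 "[1, 1, 12]" "- 26"], simp, simp, simp)
    (code_simp, simp only: coeff_table assms, algebra)

lemmas known_g_1_12 [coeff_table] = knownI[of U g, OF g_1_12]

lemma g_6_7 [coeff_table]:
  assumes "z \<in> U"
  shows "g z [6, 7] = 924 * k * S"
  by (rule solve_comm_eq[OF assms, of 12 "[1, 6, 7]" "- 14"], simp, simp, simp)
    (code_simp, simp only: coeff_table assms, algebra)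

lemmas known_g_6_7 [coeff_table] = knownI[of U g, OF g_6_7]

lemma g_3_10 [coeff_table]:
  assumes "z \<in> U"
  shows "g z [3, 10] = 110 * k * S"
  by (rule solve_comm_eq[OF assms, of 12 "[1, 3, 10]" "- 14"], simp, simp, simp)
    (code_simp, simp only: coeff_table assms, algebra)

lemmas known_g_3_10 [coeff_table] = knownI[of U g, OF g_3_10]

lemma g_4_7 [coeff_table]:
  assumes "z \<in> U"
  shows "g z [4, 7] = 168 * k * S"
  by (rule solve_comm_eq[OF assms, of 10 "[1, 4, 7]" "- 12"], simp, simp, simp)
    (code_simp, simp only: coeff_table assms, algebra)

lemmas known_g_4_7 [coeff_table] = knownI[of U g, OF g_4_7]

lemma g_5_8 [coeff_table]:
  assumes "z \<in> U"
  shows "g z [5, 8] = 660 * k * S"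
  by (rule solve_comm_eq[OF assms, of 12 "[1, 5, 8]" "- 14"], simp, simp, simp)
    (code_simp, simp only: coeff_table assms, algebra)

lemmas known_g_5_8 [coeff_table] = knownI[of U g, OF g_5_8]

lemma g_2_11 [coeff_table]:
  assumes "z \<in> U"
  shows "g z [2, 11] = 22 * k * S"
  by (rule solve_comm_eq[OF assms, of 12 "[1, 2, 11]" "- 14"], simp, simp, simp)
    (code_simp, simp only: coeff_table assms, algebra)

lemmas known_g_2_11 [coeff_table] = knownI[of U g, OF g_2_11]

lemma g_1_1_11 [coeff_table]:
  assumes "z \<in> U"
  shows "g z [1, 1, 11] = 120/13 * k^2 * S^2 + 876/13 * k^2 * S - 40 * k * S + 12 * k * D"
  by (rule solve_comm_eq[OF assms, of 12 "[1, 1, 1, 11]" "- 39"], simp, simp, simp)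
    (code_simp, simp only: coeff_table assms, algebra)

lemmas known_g_1_1_11 [coeff_table] = knownI[of U g, OF g_1_1_11]

lemma g_1_1_9 [coeff_table]:
  assumes "z \<in> U"
  shows "g z [1, 1, 9] = 80/11 * k^2 * S^2 + 608/11 * k^2 * S - 32 * k * S + 12 * k * D"
  by (rule solve_comm_eq[OF assms, of 10 "[1, 1, 1, 9]" "- 33"], simp, simp, simp)
    (code_simp, simp only: coeff_table assms, algebra)

lemmas known_g_1_1_9 [coeff_table] = knownI[of U g, OF g_1_1_9]

lemma g_1_4_6 [coeff_table]:
  assumes "z \<in> U"
  shows "g z [1, 4, 6] = 
      1/300 * k^2 * S^5 + 541/2100 * k^2 * S^4 + 8747/2100 * k^2 * S^3 + 484379/1980 * k^2 * S^2 +
      21784/11 * k^2 * S - 1092 * k * S + 672 * k * D"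
  by (rule solve_comm_eq[OF assms, of 10 "[1, 1, 4, 6]" "- 24"], simp, simp, simp)
    (code_simp, simp only: coeff_table assms, algebra)

lemmas known_g_1_4_6 [coeff_table] = knownI[of U g, OF g_1_4_6]

lemma g_1_5_7 [coeff_table]:
  assumes "z \<in> U"
  shows "g z [1, 5, 7] = 
      1/2100 * k^2 * S^6 + 167/2940 * k^2 * S^5 + 26099/14700 * k^2 * S^4 +
      8284687/485100 * k^2 * S^3 + 350659129/315315 * k^2 * S^2 + 793830/91 * k^2 * S -
      4944 * k * S + 2520 * k * D"
  by (rule solve_comm_eq[OF assms, of 12 "[1, 1, 5, 7]" "- 28"], simp, simp, simp)
    (code_simp, simp only: coeff_table assms, algebra)

lemmas known_g_1_5_7 [coeff_table] = knownI[of U g, OF g_1_5_7]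

lemma g_4_9 [coeff_table]:
  assumes "z \<in> U"
  shows "g z [4, 9] = 330 * k * S"
  by (rule solve_comm_eq[OF assms, of 12 "[1, 4, 9]" "- 14"], simp, simp, simp)
    (code_simp, simp only: coeff_table assms, algebra)

lemmas known_g_4_9 [coeff_table] = knownI[of U g, OF g_4_9]

lemma g_1_2_8 [coeff_table]:
  assumes "z \<in> U"
  shows "g z [1, 2, 8] = 
      38/105 * k^2 * S^3 + 148066/3465 * k^2 * S^2 + 3612/11 * k^2 * S - 186 * k * S + 96 * k * D"
  by (rule solve_comm_eq[OF assms, of 10 "[1, 1, 2, 8]" "- 24"], simp, simp, simp)
    (code_simp, simp only: coeff_table assms, algebra)

lemmas known_g_1_2_8 [coeff_table] = knownI[of U g, OF g_1_2_8]

lemma g_1_3_9 [coeff_table]: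
  assumes "z \<in> U"
  shows "g z [1, 3, 9] = 
      47/294 * k^2 * S^4 + 75766/24255 * k^2 * S^3 + 166545019/630630 * k^2 * S^2 +
      183935/91 * k^2 * S - 1160 * k * S + 540 * k * D"
  by (rule solve_comm_eq[OF assms, of 12 "[1, 1, 3, 9]" "- 28"], simp, simp, simp)
    (code_simp, simp only: coeff_table assms, algebra)

lemmas known_g_1_3_9 [coeff_table] = knownI[of U g, OF g_1_3_9]

lemma g_1_3_7 [coeff_table]:
  assumes "z \<in> U"
  shows "g z [1, 3, 7] = 
      1/14 * k^2 * S^4 + 194/105 * k^2 * S^3 + 900371/6930 * k^2 * S^2 + 11392/11 * k^2 * S -
      576 * k * S + 336 * k * D"
  by (rule solve_comm_eq[OF assms, of 10 "[1, 1, 3, 7]" "- 24"], simp, simp, simp)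
    (code_simp, simp only: coeff_table assms, algebra)

lemmas known_g_1_3_7 [coeff_table] = knownI[of U g, OF g_1_3_7]

lemma g_2_2_7 [coeff_table]:
  assumes "z \<in> U"
  shows "g z [2, 2, 7] = 
      -79/455 * k^2 * S^4 + 1388/455 * k^2 * S^3 + 6897/35 * k^2 * S^2 + 19560/13 * k^2 * S -
      816 * k * S + 672 * k * D"
  by (rule solve_comm_eq[OF assms, of 10 "[1, 2, 2, 7]" "- 13"], simp, simp, simp)
    (code_simp, simp only: coeff_table assms, algebra)

lemmas known_g_2_2_7 [coeff_table] = knownI[of U g, OF g_2_2_7]

lemma g_2_3_6 [coeff_table]:
  assumes "z \<in> U"
  shows "g z [2, 3, 6] = 
      -31/2145 * k^2 * S^5 - 1477/2145 * k^2 * S^4 + 55007/5005 * k^2 * S^3 +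
      484161/1001 * k^2 * S^2 + 50120/13 * k^2 * S - 2016 * k * S + 2016 * k * D"
  by (rule solve_comm_eq[OF assms, of 10 "[1, 2, 3, 6]" "- 13"], simp, simp, simp)
    (code_simp, simp only: coeff_table assms, algebra)

lemmas known_g_2_3_6 [coeff_table] = knownI[of U g, OF g_2_3_6]

lemma g_3_3_7 [coeff_table]:
  assumes "z \<in> U"
  shows "g z [3, 3, 7] = 
      -337/75075 * k^2 * S^6 - 398533/525525 * k^2 * S^5 - 2501/325 * k^2 * S^4 +
      64000619/525525 * k^2 * S^3 + 32942932/9555 * k^2 * S^2 + 200344/7 * k^2 * S - 14880 * k * S
      + 15120 * k * D"
  by (rule solve_comm_eq[OF assms, of 12 "[1, 3, 3, 7]" "- 15"], simp, simp, simp)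
    (code_simp, simp only: coeff_table assms, algebra)

lemmas known_g_3_3_7 [coeff_table] = knownI[of U g, OF g_3_3_7]

lemma g_1_4_8 [coeff_table]:
  assumes "z \<in> U"
  shows "g z [1, 4, 8] = 
      39/2450 * k^2 * S^5 + 11707/14700 * k^2 * S^4 + 2263171/242550 * k^2 * S^3 +
      829070533/1261260 * k^2 * S^2 + 465285/91 * k^2 * S - 2910 * k * S + 1440 * k * D"
  by (rule solve_comm_eq[OF assms, of 12 "[1, 1, 4, 8]" "- 28"], simp, simp, simp)
    (code_simp, simp only: coeff_table assms, algebra)

lemmas known_g_1_4_8 [coeff_table] = knownI[of U g, OF g_1_4_8]

lemma g_1_2_10 [coeff_table]:
  assumes "z \<in> U"
  shows "g z [1, 2, 10] = 
      568/1155 * k^2 * S^3 + 3044908/45045 * k^2 * S^2 + 45580/91 * k^2 * S - 292 * k * S +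
      120 * k * D"
  by (rule solve_comm_eq[OF assms, of 12 "[1, 1, 2, 10]" "- 28"], simp, simp, simp)
    (code_simp, simp only: coeff_table assms, algebra)

lemmas known_g_1_2_10 [coeff_table] = knownI[of U g, OF g_1_2_10]

lemma g_2_4_7 [coeff_table]:
  assumes "z \<in> U"
  shows "g z [2, 4, 7] = 
      -4943/1501500 * k^2 * S^6 - 3124217/10510500 * k^2 * S^5 - 991701/318500 * k^2 * S^4 +
      38920751/500500 * k^2 * S^3 + 127998994/47775 * k^2 * S^2 + 21426 * k^2 * S - 11460 * k * S
      + 10080 * k * D"
  by (rule solve_comm_eq[OF assms, of 12 "[1, 2, 4, 7]" "- 15"], simp, simp, simp)
    (code_simp, simp only: coeff_table assms, algebra)

lemmas known_g_2_4_7 [coeff_table] = knownI[of U g, OF g_2_4_7]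

lemma g_2_3_8 [coeff_table]:
  assumes "z \<in> U"
  shows "g z [2, 3, 8] = 
      -12527/175175 * k^2 * S^5 - 57964/35035 * k^2 * S^4 + 414927/13475 * k^2 * S^3 +
      223643996/175175 * k^2 * S^2 + 69789/7 * k^2 * S - 5430 * k * S + 4320 * k * D"
  by (rule solve_comm_eq[OF assms, of 12 "[1, 2, 3, 8]" "- 15"], simp, simp, simp)
    (code_simp, simp only: coeff_table assms, algebra)

lemmas known_g_2_3_8 [coeff_table] = knownI[of U g, OF g_2_3_8]

lemma g_2_2_9 [coeff_table]:
  assumes "z \<in> U"
  shows "g z [2, 2, 9] = 
      -19/49 * k^2 * S^4 + 4684/735 * k^2 * S^3 + 290431/735 * k^2 * S^2 + 20662/7 * k^2 * S -
      1660 * k * S + 1080 * k * D"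
  by (rule solve_comm_eq[OF assms, of 12 "[1, 2, 2, 9]" "- 15"], simp, simp, simp)
    (code_simp, simp only: coeff_table assms, algebra)

lemmas known_g_2_2_9 [coeff_table] = knownI[of U g, OF g_2_2_9]

text \<open>D has dropped out, so S alone is confined to finitely many values.\<close>

lemma obstruction_2_2_2_4:
  assumes "z \<in> U"
  shows "72/55 * k^3 * (4 * S^4 - 28 * S^3 + 59 * S^2 - 35 * S) = 0"
  by (rule comm_eqD[OF assms, of 8 "[2, 2, 2, 4]"], simp, simp)
    (code_simp, simp only: coeff_table assms, algebra)

text \<open>A second polynomial in S alone, used to exclude the nonzero roots of the previous
  one.\<close>

lemma obstruction_2_2_3_7:
  assumes "z \<in> U"
  shows "1/525525 * k^3 * (
      139895 * S^6 + 16572737 * S^5 + 52297215 * S^4 - 1023739611 * S^3 + 2682535844 * S^2 -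
      1744142400 * S) = 0"
  by (rule comm_eqD[OF assms, of 12 "[2, 2, 3, 7]"], simp, simp)
    (code_simp, simp only: coeff_table assms, algebra)

end

context commuting_flows_S0
begin

text \<open>With B = S = 0 the values at [a+1, b+1, c+1] with a + b + c = 8 are 12 k D times 8!/(a!
  b! c!), the pattern of D^8 (u_1^3). The four-entry values that follow deviate from such a pure
  derivative and lead to the obstruction.\<close>

lemma g_1_5_5 [coeff_table]:
  assumes "z \<in> U"
  shows "g z [1, 5, 5] = 840 * k * D"
  by (rule solve_comm_eq[OF assms, of 10 "[1, 1, 5, 5]" "- 24"], simp, simp, simp)
    (code_simp, simp only: coeff_table assms, algebra)

lemmas known_g_1_5_5 [coeff_table] = knownI[of U g, OF g_1_5_5]

lemma g_2_4_5 [coeff_table]: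
  assumes "z \<in> U"
  shows "g z [2, 4, 5] = 3360 * k * D"
  by (rule solve_comm_eq[OF assms, of 10 "[1, 2, 4, 5]" "- 13"], simp, simp, simp)
    (code_simp, simp only: coeff_table assms, algebra)

lemmas known_g_2_4_5 [coeff_table] = knownI[of U g, OF g_2_4_5]

lemma g_3_4_4 [coeff_table]:
  assumes "z \<in> U"
  shows "g z [3, 4, 4] = 6720 * k * D"
  by (rule solve_comm_eq[OF assms, of 10 "[1, 3, 4, 4]" "- 13"], simp, simp, simp)
    (code_simp, simp only: coeff_table assms, algebra)

lemmas known_g_3_4_4 [coeff_table] = knownI[of U g, OF g_3_4_4]

lemma g_3_3_5 [coeff_table]:
  assumes "z \<in> U"
  shows "g z [3, 3, 5] = 5040 * k * D"
  by (rule solve_comm_eq[OF assms, of 10 "[1, 3, 3, 5]" "- 13"], simp, simp, simp)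
    (code_simp, simp only: coeff_table assms, algebra)

lemmas known_g_3_3_5 [coeff_table] = knownI[of U g, OF g_3_3_5]

lemma g_1_1_1_8 [coeff_table]:
  assumes "z \<in> U"
  shows "g z [1, 1, 1, 8] = 5496/11 * k^2 * D - 600 * k * D"
  by (rule solve_comm_eq[OF assms, of 10 "[1, 1, 1, 1, 8]" "- 44"], simp, simp, simp)
    (code_simp, simp only: coeff_table assms, algebra)

lemmas known_g_1_1_1_8 [coeff_table] = knownI[of U g, OF g_1_1_1_8]

lemma g_1_1_4_5 [coeff_table]:
  assumes "z \<in> U"
  shows "g z [1, 1, 4, 5] = 151858/11 * k^2 * D - 16464 * k * D"
  by (rule solve_comm_eq[OF assms, of 10 "[1, 1, 1, 4, 5]" "- 36"], simp, simp, simp)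
    (code_simp, simp only: coeff_table assms, algebra)

lemmas known_g_1_1_4_5 [coeff_table] = knownI[of U g, OF g_1_1_4_5]

lemma g_1_1_3_6 [coeff_table]:
  assumes "z \<in> U"
  shows "g z [1, 1, 3, 6] = 92820/11 * k^2 * D - 10080 * k * D"
  by (rule solve_comm_eq[OF assms, of 10 "[1, 1, 1, 3, 6]" "- 36"], simp, simp, simp)
    (code_simp, simp only: coeff_table assms, algebra)

lemmas known_g_1_1_3_6 [coeff_table] = knownI[of U g, OF g_1_1_3_6]

lemma g_1_3_3_4 [coeff_table]:
  assumes "z \<in> U"
  shows "g z [1, 3, 3, 4] = 9296000/143 * k^2 * D - 77280 * k * D"
  by (rule solve_comm_eq[OF assms, of 10 "[1, 1, 3, 3, 4]" "- 26"], simp, simp, simp)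
    (code_simp, simp only: coeff_table assms, algebra)

lemmas known_g_1_3_3_4 [coeff_table] = knownI[of U g, OF g_1_3_3_4]

lemma g_1_1_2_7 [coeff_table]:
  assumes "z \<in> U"
  shows "g z [1, 1, 2, 7] = 32564/11 * k^2 * D - 3552 * k * D"
  by (rule solve_comm_eq[OF assms, of 10 "[1, 1, 1, 2, 7]" "- 36"], simp, simp, simp)
    (code_simp, simp only: coeff_table assms, algebra)

lemmas known_g_1_1_2_7 [coeff_table] = knownI[of U g, OF g_1_1_2_7]

lemma g_1_2_4_4 [coeff_table]:
  assumes "z \<in> U"
  shows "g z [1, 2, 4, 4] = 6446090/143 * k^2 * D - 53760 * k * D"
  by (rule solve_comm_eq[OF assms, of 10 "[1, 1, 2, 4, 4]" "- 26"], simp, simp, simp)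
    (code_simp, simp only: coeff_table assms, algebra)

lemmas known_g_1_2_4_4 [coeff_table] = knownI[of U g, OF g_1_2_4_4]

lemma g_1_2_3_5 [coeff_table]:
  assumes "z \<in> U"
  shows "g z [1, 2, 3, 5] = 4908932/143 * k^2 * D - 40992 * k * D"
  by (rule solve_comm_eq[OF assms, of 10 "[1, 1, 2, 3, 5]" "- 26"], simp, simp, simp)
    (code_simp, simp only: coeff_table assms, algebra)

lemmas known_g_1_2_3_5 [coeff_table] = knownI[of U g, OF g_1_2_3_5]

lemma g_1_2_2_6 [coeff_table]:
  assumes "z \<in> U"
  shows "g z [1, 2, 2, 6] = 2082556/143 * k^2 * D - 17472 * k * D"
  by (rule solve_comm_eq[OF assms, of 10 "[1, 1, 2, 2, 6]" "- 26"], simp, simp, simp)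
    (code_simp, simp only: coeff_table assms, algebra)

lemmas known_g_1_2_2_6 [coeff_table] = knownI[of U g, OF g_1_2_2_6]

lemma g_2_2_3_4 [coeff_table]:
  assumes "z \<in> U"
  shows "g z [2, 2, 3, 4] = 1386510/13 * k^2 * D - 127680 * k * D"
  by (rule solve_comm_eq[OF assms, of 10 "[1, 2, 2, 3, 4]" "- 14"], simp, simp, simp)
    (code_simp, simp only: coeff_table assms, algebra)

lemmas known_g_2_2_3_4 [coeff_table] = knownI[of U g, OF g_2_2_3_4]

lemma g_2_2_2_5 [coeff_table]:
  assumes "z \<in> U"
  shows "g z [2, 2, 2, 5] = 741114/13 * k^2 * D - 68544 * k * D"
  by (rule solve_comm_eq[OF assms, of 10 "[1, 2, 2, 2, 5]" "- 14"], simp, simp, simp)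
    (code_simp, simp only: coeff_table assms, algebra)

lemmas known_g_2_2_2_5 [coeff_table] = knownI[of U g, OF g_2_2_2_5]

text \<open>Linear in D with a nonzero factor, so that D = 0 follows without a further case
  distinction.\<close>

lemma obstruction_2_2_2_2_4:
  assumes "z \<in> U"
  shows "32400/13 * k^3 * (-D) = 0"
  by (rule comm_eqD[OF assms, of 10 "[2, 2, 2, 2, 4]"], simp, simp)
    (code_simp, simp only: coeff_table assms, algebra)

end

section \<open>Elimination\<close>

text \<open>The parameters stand for \<open>y = k B\<close> and \<open>X = B D\<close>; the intermediate polynomials and the final
  multipliers come from a Groebner basis computation.\<close>

lemma obstruction_elimination:
  fixes y B S X :: complex
  assumes p1: "- 6 * y^2 + 9 * y * S + 216 * B^2 - 108 * B * S + 9 * S^2 + 67 * y + 72 * B - 9 * S - 108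
      * X - 30 = 0"
    and p2: "30 * y^3 - 66 * y^2 * B - 31 * y^2 * S - 1080 * y * B^2 + 639 * y * B * S - 66 * y * S^2
      + 2376 * B^3 - 1944 * B^2 * S + 477 * B * S^2 - 35 * S^3 - 321 * y^2 + 643 * y * B - 263
      * y * S + 540 * y * X + 2304 * B^2 - 1128 * B * S - 1188 * B * X + 140 * S^2 + 378 * S *
      X + 675 * y + 195 * B - 105 * S - 630 * X = 0"
    and p3: "- 438 * y^3 + 378 * y^2 * B + 657 * y^2 * S + 9288 * y * B^2 - 5211 * y * B * S + 297 * y
      * S^2 - 13608 * B^3 + 6804 * B^2 * S - 567 * B * S^2 + 271 * y^2 - 2925 * y * B + 3273 *
      y * S - 4644 * y * X + 54864 * B^2 - 28953 * B * S + 6804 * B * X + 2490 * S^2 + 15360 *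
      y + 21810 * B - 3210 * S - 30240 * X - 6300 = 0"
    and p4: "25110 * y^4 - 65394 * y^3 * B - 28449 * y^3 * S - 566496 * y^2 * B^2 + 394485 * y^2 * B *
      S - 35289 * y^2 * S^2 + 1900584 * y * B^3 - 1306152 * y * B^2 * S + 231102 * y * B * S^2
      - 11340 * y * S^3 - 1651104 * B^4 + 1316196 * B^3 * S - 314118 * B^2 * S^2 + 22365 * B *
      S^3 - 95679 * y^3 + 331431 * y^2 * B - 165237 * y^2 * S + 306180 * y^2 * X - 1731126 * y
      * B^2 + 1078625 * y * B * S - 950292 * y * B * X - 105840 * y * S^2 + 143532 * y * S * X
      + 2680344 * B^3 - 2687283 * B^2 * S + 825552 * B^2 * X + 744990 * B * S^2 - 245322 * B *
      S * X - 59850 * S^3 - 310500 * y^2 + 467955 * y * B - 351270 * y * S + 840780 * y * X +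
      3938295 * B^2 - 1917705 * B * S - 1722330 * B * X + 239400 * S^2 + 672300 * S * X +
      1011150 * y + 381150 * B - 179550 * S - 1120500 * X = 0"
    and p5: "6413550 * y^4 - 17780796 * y^3 * B - 6570351 * y^3 * S - 151420434 * y^2 * B^2 +
      104916900 * y^2 * B * S - 10224126 * y^2 * S^2 + 570967056 * y * B^3 - 418156173 * y *
      B^2 * S + 85363083 * y * B * S^2 - 5180175 * y * S^3 - 486034776 * B^4 + 421731144 * B^3
      * S - 120206367 * B^2 * S^2 + 13120065 * B * S^3 - 435600 * S^4 - 29411551 * y^3 +
      129216324 * y^2 * B - 56475993 * y^2 * S + 83297700 * y^2 * X - 379088669 * y * B^2 +
      225843025 * y * B * S - 285483528 * y * B * X - 18691530 * y * S^2 + 54955098 * y * S * X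
      + 287529876 * B^3 - 318511422 * B^2 * S + 212885388 * B^2 * X + 91458390 * B * S^2 -
      74290878 * B * S * X - 7962900 * S^3 + 4043520 * S^2 * X - 81222825 * y^2 - 40305480 * y
      * B - 29073855 * y * S + 190222770 * y * X + 678395205 * B^2 - 329344695 * B * S -
      254063520 * B * X + 41184600 * S^2 + 90653850 * S * X + 15066000 * X^2 + 195090300 * y +
      95298300 * B - 40082100 * S - 200518050 * X = 0"
    and p6: "4047690 * y^4 - 10360836 * y^3 * B - 4281381 * y^3 * S - 104811654 * y^2 * B^2 + 69273420
      * y^2 * B * S - 6714486 * y^2 * S^2 + 339488496 * y * B^3 - 244563903 * y * B^2 * S +
      49100373 * y * B * S^2 - 2916225 * y * S^3 - 259530696 * B^4 + 223278984 * B^3 * S -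
      63328077 * B^2 * S^2 + 6934815 * B * S^3 - 234720 * S^4 - 23447741 * y^3 + 70212924 * y^2
      * B - 29816643 * y^2 * S + 56456460 * y^2 * X - 201653479 * y * B^2 + 121452095 * y * B *
      S - 169744248 * y * B * X - 10325790 * y * S^2 + 31333878 * y * S * X + 135219276 * B^3 -
      149850342 * B^2 * S + 113707908 * B^2 * X + 42674010 * B * S^2 - 38728098 * B * S * X -
      3719460 * S^3 + 2209680 * S^2 * X - 45164655 * y^2 - 38692440 * y * B - 8956785 * y * S +
      107518110 * y * X + 329130675 * B^2 - 158415825 * B * S - 124757280 * B * X + 19681080 *
      S^2 + 42226470 * S * X + 8028720 * X^2 + 95546700 * y + 45650700 * B - 19374900 * S -
      95155950 * X = 0"
  shows "(y - B) * (y - 2 * B) = 0"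
proof -
  \<comment> \<open>The first equation is linear in X with constant coefficient -108; it removes X
    from the other five, which become polynomials in y, B and S.\<close>
  have q2: "6 * y^2 * S - 9 * y * S^2 + 3 * S^3 - 42 * y^2 - 228 * y * B + 108 * y * S - 216 * B^2 +
      126 * B * S - 48 * S^2 - 115 * y - 90 * B + 135 * S - 150 = 0"
    using p1 p2 by algebra
  have q3: "18 * y^3 - 27 * y^2 * S + 9 * y * S^2 + 93 * y^2 + 180 * y * B - 114 * y * S + 108 * B^2
      - 72 * B * S + 3 * S^2 + 211 * y + 24 * B + 69 * S - 210 = 0"
    using p1 p3 by algebra
  have q4: "- 16200 * y^4 + 25200 * y^3 * B + 21816 * y^3 * S - 45486 * y^2 * B * S - 4374 * y^2 *
      S^2 + 24129 * y * B * S^2 - 1242 * y * S^3 - 3843 * B * S^3 - 95112 * y^3 - 83406 * y^2 *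
      B + 137988 * y^2 * S + 341892 * y * B^2 - 234012 * y * B * S - 16578 * y * S^2 + 427896 *
      B^3 - 294606 * B^2 * S + 100788 * B * S^2 + 7650 * S^3 - 376590 * y^2 - 447925 * y * B +
      275010 * y * S - 639510 * B^2 + 274665 * B * S - 180000 * S^2 - 164950 * y - 225150 * B +
      545850 * S - 622500 = 0"
    using p1 p4 by algebra
  have q5: "32983200 * y^4 - 34570800 * y^3 * B - 50785866 * y^3 * S + 65343186 * y^2 * B * S +
      18673659 * y^2 * S^2 - 37515879 * y * B * S^2 - 978723 * y * S^3 + 6743493 * B * S^3 +
      107730 * S^4 + 191833962 * y^3 + 371542356 * y^2 * B - 302618358 * y^2 * S - 351210492 *
      y * B^2 + 211832307 * y * B * S + 71860383 * y * S^2 - 692956296 * B^3 + 440677746 * B^2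
      * S - 131325003 * B * S^2 - 17183205 * S^3 + 558912215 * y^2 + 371865600 * y * B -
      412509285 * y * S + 698482710 * B^2 - 357955740 * B * S + 273675600 * S^2 + 227928325 * y
      + 479030400 * B - 861414975 * S + 1023515250 = 0"
    using p1 p5 by algebra
  have q6: "16848000 * y^4 - 16750800 * y^3 * B - 25052166 * y^3 * S + 30874446 * y^2 * B * S +
      8280549 * y^2 * S^2 - 16997769 * y * B * S^2 - 169533 * y * S^3 + 2874123 * B * S^3 +
      93150 * S^4 + 90891462 * y^3 + 159885036 * y^2 * B - 136158138 * y^2 * S - 167687172 * y
      * B^2 + 98584317 * y * B * S + 29361753 * y * S^2 - 307441656 * B^3 + 192317166 * B^2 * S
      - 54328293 * B * S^2 - 8932275 * S^3 + 260607865 * y^2 + 168890400 * y * B - 172006635 *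
      y * S + 336766410 * B^2 - 186953940 * B * S + 131450400 * S^2 + 69867475 * y + 250102800
      * B - 410456025 * S + 486930750 = 0"
    using p1 p6 by algebra
  \<comment> \<open>Each of the six combinations contains exactly one of the six cubic monomials
    divisible by y; its other cubic terms are among B^2 S, B S^2 and S^3. So they express all cubics
    divisible by y through the rest.\<close>
  have r1: "17460 * y * S^2 + 19440 * B * S^2 - 5994 * S^3 - 26232 * y^2 + 42048 * y * B - 147711 * y
      * S + 87858 * B^2 - 202428 * B * S + 55401 * S^2 + 313217 * y + 363666 * B - 120111 * S +
      20154 = 0"
    using q2 q3 q4 q5 q6 by algebra
  have r2: "244440 * y * B * S + 209520 * B^2 * S - 103680 * B * S^2 - 9354 * S^3 + 46008 * y^2 +
      713928 * y * B - 481841 * y * S + 926478 * B^2 - 586068 * B * S + 317471 * S^2 + 749627 *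
      y + 739006 * B - 1069421 * S + 1200654 = 0"
    using q2 q3 q4 q5 q6 by algebra
  have r3: "4399920 * y * B^2 - 4085640 * B^2 * S - 2094660 * B * S^2 + 1124694 * S^3 - 9222648 * y^2
      - 24463008 * y * B + 1633071 * y * S - 30134538 * B^2 + 43555428 * B * S - 16438401 * S^2
      + 24983083 * y - 76985766 * B + 63854811 * S - 94268874 = 0"
    using q2 q3 q4 q5 q6 by algebra
  have r4: "3880 * y^2 * S + 6480 * B * S^2 - 58 * S^3 - 35904 * y^2 - 133424 * y * B + 20603 * y * S
      - 110394 * B^2 + 14004 * B * S - 12573 * S^2 + 30039 * y + 63022 * B + 47263 * S - 90282 = 0"
    using q2 q3 q4 q5 q6 by algebra
  have r5: "1466640 * y^2 * B + 1885680 * B^2 * S + 556200 * B * S^2 - 390618 * S^3 + 1396536 * y^2 +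
      3915936 * y * B - 177897 * y * S + 7298046 * B^2 - 14135436 * B * S + 5778087 * S^2 -
      6822941 * y + 28171182 * B - 22897797 * S + 32992638 = 0"
    using q2 q3 q4 q5 q6 by algebra
  have r6: "23280 * y^3 + 45360 * B * S^2 + 3474 * S^3 - 185368 * y^2 - 996048 * y * B + 136461 * y *
      S - 912438 * B^2 + 167868 * B * S - 146211 * S^2 + 334433 * y + 355794 * B + 594681 * S -
      1097574 = 0"
    using q2 q3 q4 q5 q6 by algebra
  \<comment> \<open>A certificate of ideal membership: the integer on the left clears the
    denominators of the rational multipliers, and the identity holds for all y, B, S.\<close>
  have "423876594561613696128880046598638341308508800 * ((y - B) * (y - 2 * B)) =
(90053280730855609442711071376998989203472 * y^2 +
        202515293708462177618502874484121049758060 * y * B -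
        67453028613728523594889234507336569280344 * y * S +
        45430095925659539225614031041541907825036 * B^2 -
        254038125057113080684530879179145744502458 * B * S -
        53450418750365903408252598744896404060800 * S^2 +
        701316294468315255589611369078200765717076 * y +
        429140618436444844354107367418303293221834 * B +
        841073078550598866328993499967211502688300 * S -
        2376233264183098997496574448235548499907008)
      * (17460 * y * S^2 + 19440 * B * S^2 - 5994 * S^3 - 26232 * y^2 + 42048 * y * B - 147711 *
        y * S + 87858 * B^2 - 202428 * B * S + 55401 * S^2 + 313217 * y + 363666 * B - 120111 *
        S + 20154)
      + (803074609434014313504036641053236644544 * y^2 -
        36079583055789181808390286686069459549862 * y * B -
        5088858281535158879629420614666465897867 * y * S -
        21306592803727076213120839477564564536156 * B^2 -
        25276076583144150052753484447022647571090 * B * S +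
        43713036227491416949097510626294667588985 * S^2 +
        2570317992160390327153906037649719888109 * y +
        214612565976791496399535317469073754255942 * B -
        307152047128902720471483846871922899832256 * S +
        631186555345824482424252090056049171890751)
      * (244440 * y * B * S + 209520 * B^2 * S - 103680 * B * S^2 - 9354 * S^3 + 46008 * y^2 +
        713928 * y * B - 481841 * y * S + 926478 * B^2 - 586068 * B * S + 317471 * S^2 + 749627
        * y + 739006 * B - 1069421 * S + 1200654)
      + (- 252132554934435773366337206687261638224 * y^2 -
        789133066804706526411882943613502390228 * y * B +
        246551892351358559658561897037563089238 * y * S +
        1844838136867423535449608448994067809550 * B * S -
        505734486268117053945128036262028250226 * S^2 -
        2158689119307929145796217185668050865962 * y + 1343789951501727077433890294043955157298
        * B - 5640745680105832397040786932714892098510 * S +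
        2307613115492340731427082246001031680004)
      * (4399920 * y * B^2 - 4085640 * B^2 * S - 2094660 * B * S^2 + 1124694 * S^3 - 9222648 *
        y^2 - 24463008 * y * B + 1633071 * y * S - 30134538 * B^2 + 43555428 * B * S - 16438401
        * S^2 + 24983083 * y - 76985766 * B + 63854811 * S - 94268874)
      + (124105026926204760944099682739697589780750 * y * B -
        405239763288850242492199821196495451415624 * y * S +
        13847637962304159829942192773818924129436 * B^2 -
        491443359476778881734501806211228016682171 * B * S +
        517678653590856861480766034384062746761388 * S^2 +
        240935404150288834170492574473154731567504 * y +
        2581616350624148177096681184492149643601029 * B -
        3406778170448648043853209691311271277784858 * S +
        10442923782535688409309488856403195604345742)
      * (3880 * y^2 * S + 6480 * B * S^2 - 58 * S^3 - 35904 * y^2 - 133424 * y * B + 20603 * y *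
        S - 110394 * B^2 + 14004 * B * S - 12573 * S^2 + 30039 * y + 63022 * B + 47263 * S -
        90282)
      + (756397664803307320099011620061784914672 * y * B -
        462165945292454134113370346894316133299 * y * S +
        2367399200414119579235648830840507170684 * B^2 +
        4419879998334857262332977830553966138785 * B * S -
        1759601029879229397898812392494489539291 * S^2 -
        5068629007337196453881435794606433546935 * y + 2824230826736830831318083114479169643017
        * B - 14747994357095380763557434918514421691124 * S +
        1633160572221271889979381781322016764295)
      * (1466640 * y^2 * B + 1885680 * B^2 * S + 556200 * B * S^2 - 390618 * S^3 + 1396536 * y^2
        + 3915936 * y * B - 177897 * y * S + 7298046 * B^2 - 14135436 * B * S + 5778087 * S^2 -
        6822941 * y + 28171182 * B - 22897797 * S + 32992638)
      + (- 361265666086271437784166854617850537976792)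
      * (23280 * y^3 + 45360 * B * S^2 + 3474 * S^3 - 185368 * y^2 - 996048 * y * B + 136461 * y
        * S - 912438 * B^2 + 167868 * B * S - 146211 * S^2 + 334433 * y + 355794 * B + 594681 *
        S - 1097574)"
    by algebra
  \<comment> \<open>The second factor of each product is copied literally from the left-hand side of
    one of r1 to r6, so rewriting with these makes the whole right-hand side 0.\<close>
  then show ?thesis
    unfolding r1 r2 r3 r4 r5 r6 by simp
qed

theorem theorem3:
  fixes U :: "complex set" and ell :: "complex \<Rightarrow> complex"
    and \<alpha> \<beta> \<gamma> \<delta> k :: complex
  assumes "open U" and "connected U" and "U \<noteq> {}"
    and "ell holomorphic_on U" and "\<And>z. z \<in> U \<Longrightarrow> exp (ell z) = z"
    and "\<alpha> \<noteq> 0" and "k \<noteq> 0"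
    and "\<not> (\<alpha> + \<beta> = 0 \<and> 3 * k * \<alpha> + \<gamma> = 0 \<and> \<delta> + k * (k - 1) * \<alpha> = 0)"
    and "integrable_series U (eq_series ell \<alpha> \<beta> \<gamma> \<delta> k)"
  shows "k = 1 \<or> k = 2"
proof -
  define B where "B = (\<alpha> + \<beta>) / (\<alpha> * k)"
  define S where "S = (3 * k * \<alpha> + \<gamma>) / (\<alpha> * k) + 3 * B"
  define D where "D = (\<delta> + k * (k - 1) * \<alpha>) / (\<alpha> * k)"
  interpret log_branch U ell
    by unfold_locales (use assms in auto)
  obtain G where G: "formal_series U G" "leading_coeff_is U G (branch_power ell (2 * k))"
    "commuting_series U (eq_series ell \<alpha> \<beta> \<gamma> \<delta> k) G"
    using assms(9) pw_holo[of "2 * k"] unfolding integrable_series_def by blast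
  have F: "formal_series U (eq_series ell \<alpha> \<beta> \<gamma> \<delta> k)"
    using assms(9) by (simp add: integrable_series_def)
  have BSD: "\<alpha> + \<beta> = \<alpha> * k * B" "3 * k * \<alpha> + \<gamma> = \<alpha> * k * (S - 3 * B)"
    "\<delta> + k * (k - 1) * \<alpha> = \<alpha> * k * D"
    using assms(6,7) by (auto simp: B_def S_def D_def)
  interpret commuting_flows U ell \<alpha> \<beta> \<gamma> \<delta> k B S D G
    by unfold_locales (fact assms(6,7) BSD F G)+
  obtain z where z: "z \<in> U" using assms(3) by auto
  show ?thesis
  proof (cases "B = 0")
    case True
    interpret commuting_flows_B0 U ell \<alpha> \<beta> \<gamma> \<delta> k B S D G
      by unfold_locales (fact True)
    have "S = 0"
    proof (rule ccontr)
      assume S: "S \<noteq> 0"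
      \<comment> \<open>The quartic from the multi-index [2, 2, 2, 4] splits over the rationals. Its
        three nonzero roots are tested in the polynomial from [2, 2, 3, 7], which vanishes at none
        of them.\<close>
      have "S * ((S - 1) * (2 * S - 5) * (2 * S - 7)) = 0"
        using obstruction_2_2_2_4[OF z] k by (simp, algebra)
      then have "S = 1 \<or> S = 5 / 2 \<or> S = 7 / 2" using S by (auto simp: mult.commute)
      then show False
      proof (elim disjE)
        assume "S = 1"
        show False using obstruction_2_2_3_7[OF z] k unfolding \<open>S = 1\<close> by simp
      next
        assume "S = 5 / 2"
        show False using obstruction_2_2_3_7[OF z] k unfolding \<open>S = 5 / 2\<close> by (simp add: power_divide)
      next
        assume "S = 7 / 2"
        show False using obstruction_2_2_3_7[OF z] k unfolding \<open>S = 7 / 2\<close> by (simp add: power_divide)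
      qed
    qed
    interpret commuting_flows_S0 U ell \<alpha> \<beta> \<gamma> \<delta> k B S D G
      by unfold_locales (fact \<open>S = 0\<close>)
    have "D = 0" using obstruction_2_2_2_2_4[OF z] k by simp
    then show ?thesis using assms(8) BSD True \<open>S = 0\<close> by simp
  next
    case False
    \<comment> \<open>Removes the rational constant and the powers of k and B in front of an
      obstruction, both k and B being nonzero here.\<close>
    have cancel: "Q = 0" if "c * P = 0" "c \<noteq> 0" "Q = P" for c P Q :: complex
      using that by simp
    have "(k * B - B) * (k * B - 2 * B) = 0"
    proof (rule obstruction_elimination[where y = "k * B" and B = B and S = S and X = "B * D"],
        goal_cases)
      case 1
      show ?case by (rule cancel[OF obstruction_3_7[OF z]]) (simp add: k False, algebra)
    next
      case 2
      show ?case by (rule cancel[OF obstruction_2_2_6[OF z]]) (simp add: k False, algebra)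
    next
      case 3
      show ?case by (rule cancel[OF obstruction_3_9[OF z]]) (simp add: k False, algebra)
    next
      case 4
      show ?case by (rule cancel[OF obstruction_2_2_8[OF z]]) (simp add: k False, algebra)
    next
      case 5
      show ?case by (rule cancel[OF obstruction_3_3_6[OF z]]) (simp add: k False, algebra)
    next
      case 6
      show ?case by (rule cancel[OF obstruction_2_5_5[OF z]]) (simp add: k False, algebra)
    qed
    then have "B * (k - 1) * (B * (k - 2)) = 0" by (simp add: algebra_simps)
    then show ?thesis using False by simp
  qed
qed

end
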